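(* Under the joint action of the transvector algebra $Z(\mathfrak{g},\mathfrak{s})$ and the group $\mathrm{SO}(m)$, the space of double harmonics decomposes as $$\mathcal{P}(\mathbb{R}^{2m},\mathbb{C})\cap\ker(\Delta_x,\Delta_u)\;\cong\;\bigoplus_{k\ge l\ge 0}\mathbb{V}[k,l]\otimes\mathcal{H}_{k,l}(\mathbb{R}^{2m},\mathbb{C}),$$ the sum running over all pairs of integers $(k,l)$ with $k\ge l\ge 0$. Concretely, for each such $(k,l)$ the map $\mathbb{V}[k,l]\otimes\mathcal{H}_{k,l}\to\mathcal{P}(\mathbb{R}^{2m},\mathbb{C})\cap\ker(\Delta_x,\Delta_u)$, $\Phi(C)S_u^j 1_{[k,l]}\otimes H'\mapsto \Phi(C)S_u^jH'$ (with $\Phi$ a polynomial and $1_{[k,l]}$ the highest weight vector of $\mathbb{V}[k,l]$, corresponding to $H$), is an injective $Z(\mathfrak{g},\mathfrak{s})\times\mathrm{SO}(m)$-intertwining map, and the images of these maps together give the whole space as a direct sum.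
   Context: Fix an integer $m>4$. For $x,u\in\mathbb{R}^m$ let $\mathcal{P}(\mathbb{R}^{2m},\mathbb{C})$ be the complex polynomials in $(x,u)$ and $\mathcal{P}_{p,q}$ those homogeneous of degree $p$ in $x$ and $q$ in $u$. Write $|x|^2=\sum x_j^2$, $\langle u,x\rangle=\sum u_jx_j$, $\Delta_x=\sum\partial_{x_j}^2$, $\Delta_u=\sum\partial_{u_j}^2$, $\langle\partial_u,\partial_x\rangle=\sum\partial_{u_j}\partial_{x_j}$, $\langle x,\partial_u\rangle=\sum x_j\partial_{u_j}$, $\langle u,\partial_x\rangle=\sum u_j\partial_{x_j}$, $\mathbb{E}_x=\sum x_j\partial_{x_j}$, $\mathbb{E}_u=\sum u_j\partial_{u_j}$, and $\ker(D_1,\dots,D_r)=\bigcap\ker D_i$. Every $P\in\mathcal{P}_{p,q}$ can be written uniquely as $P=\sum_{a,b\ge0}|x|^{2a}|u|^{2b}H'_{p-2a,q-2b}$ with $H'_{p-2a,q-2b}\in\mathcal{P}_{p-2a,q-2b}\cap\ker(\Delta_x,\Delta_u)$; let $\pi_{\mathfrak{s}}$ be the linear operator with $\pi_{\mathfrak{s}}P=H'_{p,q}$ (the composition of the extremal projection operators of the two harmonic copies of $\mathfrak{sl}(2)$). On $\ker(\Delta_x,\Delta_u)$ define $S_x=\pi_{\mathfrak{s}}\langle x,\partial_u\rangle$, $S_u=\pi_{\mathfrak{s}}\langle u,\partial_x\rangle$, $A=\pi_{\mathfrak{s}}\langle\partial_u,\partial_x\rangle$, $C=\pi_{\mathfrak{s}}\langle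 u,x\rangle$. The transvector algebra $Z(\mathfrak{g},\mathfrak{s})$ (of the pair $\mathfrak{g}=\mathfrak{sp}(4)$, $\mathfrak{s}=\mathfrak{sl}(2)_x\oplus\mathfrak{sl}(2)_u$) acts on $\ker(\Delta_x,\Delta_u)$ and is generated (with coefficients rational in $\mathbb{E}_x,\mathbb{E}_u$) by $S_x,S_u,A,C$. $\mathrm{SO}(m)$ acts by $(g\cdot P)(x,u)=P(g^{-1}x,g^{-1}u)$. For $k\ge l\ge0$ the simplicial harmonics are $\mathcal{H}_{k,l}=\mathcal{P}_{k,l}\cap\ker(\Delta_x,\Delta_u,\langle\partial_u,\partial_x\rangle,\langle x,\partial_u\rangle)$ (a model of the irreducible $\mathrm{SO}(m)$-module of highest weight $(k,l,0,\dots,0)$). For fixed nonzero $H\in\mathcal{H}_{k,l}$, the $Z(\mathfrak{g},\mathfrak{s})$-module $\mathbb{V}[k,l]$ is realised as $\bigoplus_{i\ge0}\bigoplus_{j=0}^{k-l}\mathrm{Span}(C^iS_u^jH)$, with highest weight vector $H$. *)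

theory Defs
  imports "HOL-Analysis.Analysis"
begin

type_synonym 'n pfun = "real^'n \<Rightarrow> real^'n \<Rightarrow> complex"

definition zf :: "'n pfun" where "zf = (\<lambda>x u. 0)"

definition monom :: "('n \<Rightarrow> nat) \<Rightarrow> ('n \<Rightarrow> nat) \<Rightarrow> 'n::finite pfun" where
  "monom \<alpha> \<beta> = (\<lambda>x u. \<Prod>j\<in>UNIV. complex_of_real ((x$j)^(\<alpha> j) * (u$j)^(\<beta> j)))"

definition is_poly :: "'n::finite pfun \<Rightarrow> bool" where
  "is_poly P \<longleftrightarrow> (\<exists>S c. finite S \<and> P = (\<lambda>x u. \<Sum>(\<alpha>,\<beta>)\<in>S. c (\<alpha>,\<beta>) * monom \<alpha> \<beta> x u))"

definition bihom :: "nat \<Rightarrow> nat \<Rightarrow> 'n::finite pfun \<Rightarrow> bool" where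
  "bihom p q P \<longleftrightarrow> (\<exists>S c. finite S \<and> (\<forall>(\<alpha>,\<beta>)\<in>S. sum \<alpha> UNIV = p \<and> sum \<beta> UNIV = q) \<and>
        P = (\<lambda>x u. \<Sum>(\<alpha>,\<beta>)\<in>S. c (\<alpha>,\<beta>) * monom \<alpha> \<beta> x u))"

definition dx :: "'n::finite \<Rightarrow> 'n pfun \<Rightarrow> 'n pfun" where
  "dx j P = (\<lambda>x u. vector_derivative (\<lambda>t::real. P (x + t *\<^sub>R axis j 1) u) (at 0))"

definition du :: "'n::finite \<Rightarrow> 'n pfun \<Rightarrow> 'n pfun" where
  "du j P = (\<lambda>x u. vector_derivative (\<lambda>t::real. P x (u + t *\<^sub>R axis j 1)) (at 0))"

definition lap_x :: "'n::finite pfun \<Rightarrow> 'n pfun" where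
  "lap_x P = (\<lambda>x u. \<Sum>j\<in>UNIV. dx j (dx j P) x u)"

definition lap_u :: "'n::finite pfun \<Rightarrow> 'n pfun" where
  "lap_u P = (\<lambda>x u. \<Sum>j\<in>UNIV. du j (du j P) x u)"

definition dudx :: "'n::finite pfun \<Rightarrow> 'n pfun" where
  "dudx P = (\<lambda>x u. \<Sum>j\<in>UNIV. du j (dx j P) x u)"

definition xdu :: "'n::finite pfun \<Rightarrow> 'n pfun" where
  "xdu P = (\<lambda>x u. \<Sum>j\<in>UNIV. complex_of_real (x$j) * du j P x u)"

definition udx :: "'n::finite pfun \<Rightarrow> 'n pfun" where
  "udx P = (\<lambda>x u. \<Sum>j\<in>UNIV. complex_of_real (u$j) * dx j P x u)"

definition mult_ux :: "'n::finite pfun \<Rightarrow> 'n pfun" where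
  "mult_ux P = (\<lambda>x u. complex_of_real (\<Sum>j\<in>UNIV. u$j * x$j) * P x u)"

definition Ex :: "'n::finite pfun \<Rightarrow> 'n pfun" where
  "Ex P = (\<lambda>x u. \<Sum>j\<in>UNIV. complex_of_real (x$j) * dx j P x u)"

definition Eu :: "'n::finite pfun \<Rightarrow> 'n pfun" where
  "Eu P = (\<lambda>x u. \<Sum>j\<in>UNIV. complex_of_real (u$j) * du j P x u)"

definition dharm :: "'n::finite pfun \<Rightarrow> bool" where
  "dharm P \<longleftrightarrow> is_poly P \<and> lap_x P = zf \<and> lap_u P = zf"

text \<open>The projection \<pi>_s: P = \<Sum>_{a,b} |x|^{2a}|u|^{2b} H'_{a,b} with H'_{a,b} double harmonic
  (applied bidegree-wise, i.e. extended linearly to non-homogeneous polynomials);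
  \<pi>_s P is the component H'_{0,0}.\<close>
definition pi_s :: "'n::finite pfun \<Rightarrow> 'n pfun" where
  "pi_s P = (THE H. \<exists>F Hf. finite F \<and> (0,0) \<in> F \<and> (\<forall>ab\<in>F. dharm (Hf ab)) \<and> H = Hf (0,0) \<and>
     P = (\<lambda>x u. \<Sum>(a,b)\<in>F. complex_of_real ((\<Sum>j\<in>UNIV. (x$j)^2)^a * (\<Sum>j\<in>UNIV. (u$j)^2)^b)
                                * Hf (a,b) x u))"

definition Sx :: "'n::finite pfun \<Rightarrow> 'n pfun" where "Sx P = pi_s (xdu P)"
definition Su :: "'n::finite pfun \<Rightarrow> 'n pfun" where "Su P = pi_s (udx P)"
definition Aop :: "'n::finite pfun \<Rightarrow> 'n pfun" where "Aop P = pi_s (dudx P)"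
definition Cop :: "'n::finite pfun \<Rightarrow> 'n pfun" where "Cop P = pi_s (mult_ux P)"

definition SH :: "nat \<Rightarrow> nat \<Rightarrow> 'n::finite pfun set" where
  "SH k l = {P. bihom k l P \<and> lap_x P = zf \<and> lap_u P = zf \<and> dudx P = zf \<and> xdu P = zf}"

definition CS :: "nat \<Rightarrow> nat \<Rightarrow> 'n::finite pfun \<Rightarrow> 'n pfun" where
  "CS i j H = (Cop ^^ i) ((Su ^^ j) H)"

text \<open>Image of \<Sum>_{i,j} c_{ij} C^i S_u^j 1_{[k,l]} \<otimes> H' under the map V[k,l] \<otimes> H_{k,l} \<rightarrow> double harmonics.\<close>
definition lincomb :: "(nat \<times> nat \<Rightarrow> complex) \<Rightarrow> 'n::finite pfun \<Rightarrow> 'n pfun" where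
  "lincomb c H = (\<lambda>x u. \<Sum>(i,j)\<in>{ij. c ij \<noteq> 0}. c (i,j) * CS i j H x u)"

definition valid_idx :: "nat \<times> nat \<times> nat \<times> nat \<Rightarrow> bool" where
  "valid_idx t = (case t of (k,l,i,j) \<Rightarrow> l \<le> k \<and> j \<le> k - l)"

definition rep :: "(nat \<times> nat \<times> nat \<times> nat \<Rightarrow> 'n::finite pfun) \<Rightarrow> 'n pfun" where
  "rep F = (\<lambda>x u. \<Sum>t\<in>{t. F t \<noteq> zf}. (case t of (k,l,i,j) \<Rightarrow> CS i j (F t) x u))"

definition SOm :: "(real^'n^'n::finite) set" where
  "SOm = {g. orthogonal_matrix g \<and> det g = 1}"

definition act :: "real^'n^'n \<Rightarrow> 'n::finite pfun \<Rightarrow> 'n pfun" where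
  "act g P = (\<lambda>x u. P (matrix_inv g *v x) (matrix_inv g *v u))"

end

theory Submission
  imports Defs
begin

text \<open>Let $P$ be double harmonic of bidegree $(p,q)$ and put $a = 2p-2+m$, $b = 2q-2+m$. Then
  $\langle u,x\rangle P = CP + |x|^2 S_uP/a + |u|^2 S_xP/b + |x|^2|u|^2 AP/(ab)$, and similar but shorter
  expansions hold for the other three operators. Inserting them into the commutators of the
  $\mathfrak{sp}(4)$-operators and comparing harmonic parts gives $S_uC = (1-2/a)\,CS_u$, $S_xC = (1-2/b)\,CS_x$
  and a formula for $AC$. Hence $A\,C^iS_u^jH = \lambda\,C^{i-1}S_u^jH$ for simplicial harmonics $H$, with an
  explicit $\lambda$ that does not vanish for $i > 0$ when $m > 4$.

  Existence of the decomposition: by induction on the degree in $u$, $AP$ lies in the span of the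
  $C^iS_u^jH$, so $AP = AQ$ for some $Q$ in that span. The difference $P - Q$ is in the kernel of $A$, where
  $S_u$ and $S_x$ are just $\langle u,\partial_x\rangle$ and $\langle x,\partial_u\rangle$ and the representation theory
  of $\mathfrak{gl}(2)$ applies. Uniqueness: if $(i,j)$ is lexicographically maximal in a vanishing
  combination, then $S_x^jA^i$ maps each term with this $(i,j)$ to a nonzero multiple of its simplicial
  harmonic and kills all other terms; the bidegrees $(k,l)$ then separate the remaining harmonics.\<close>

section \<open>The algebra of polynomials in two vector variables\<close>

text \<open>The projection \<open>pi_s\<close> is a definite description, so each use of it needs a
  harmonic expansion. No expansion theorem for arbitrary polynomials is proved: on double harmonics
  the four operators have closed formulas, and these, combined with terms that carry a factor
  \<open>nx\<close> or \<open>nu\<close>, cover all harmonic parts that occur in the computations.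
  Only uniqueness of expansions is shown in general.

  The bound m > 4 makes 2p - 4 + m positive for every degree p >= 0. When S_u or S_x passes C^i, the
  factors 1 - 2/a or 1 - 2/b telescope to fractions built from such numbers. So the generators send
  C^i S_u^j H to multiples of neighbouring vectors, with coefficients that depend on k, l, i, j but
  not on H. This independence of H is what makes the maps intertwine.\<close>

lemma monom_mult: "monom \<alpha> \<beta> x u * monom \<alpha>' \<beta>' x u = monom (\<lambda>j. \<alpha> j + \<alpha>' j) (\<lambda>j. \<beta> j + \<beta>' j) x u"
  by (simp add: monom_def prod.distrib[symmetric] power_add mult_ac)

lemma monom_0: "monom (\<lambda>_. 0) (\<lambda>_. 0) = (\<lambda>x u. 1)"
  by (simp add: monom_def)

lemma monom_x: "monom (\<lambda>i. if i = j then 1 else 0) (\<lambda>_. 0) = (\<lambda>x u. complex_of_real (x $ j))"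
proof -
  have "(\<Prod>i\<in>UNIV. complex_of_real (x $ i ^ (if i = j then 1 else 0))) = (\<Prod>i\<in>UNIV. if i = j then complex_of_real (x $ i) else 1)" for x :: "real^'a"
    by (intro prod.cong) auto
  then show ?thesis by (simp add: monom_def fun_eq_iff)
qed

lemma monom_u: "monom (\<lambda>_. 0) (\<lambda>i. if i = j then 1 else 0) = (\<lambda>x u. complex_of_real (u $ j))"
proof -
  have "(\<Prod>i\<in>UNIV. complex_of_real (x $ i ^ (if i = j then 1 else 0))) = (\<Prod>i\<in>UNIV. if i = j then complex_of_real (x $ i) else 1)" for x :: "real^'a"
    by (intro prod.cong) auto
  then show ?thesis by (simp add: monom_def fun_eq_iff)
qed

lemma is_poly_add:
  assumes "is_poly P" "is_poly Q"
  shows "is_poly (\<lambda>x u. P x u + Q x u)"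
proof -
  obtain S c where S: "finite S" "P = (\<lambda>x u. \<Sum>(\<alpha>,\<beta>)\<in>S. c (\<alpha>,\<beta>) * monom \<alpha> \<beta> x u)"
    using assms(1) unfolding is_poly_def by blast
  obtain T d where T: "finite T" "Q = (\<lambda>x u. \<Sum>(\<alpha>,\<beta>)\<in>T. d (\<alpha>,\<beta>) * monom \<alpha> \<beta> x u)"
    using assms(2) unfolding is_poly_def by blast
  define e where "e t = (if t \<in> S then c t else 0) + (if t \<in> T then d t else 0)" for t
  have "P x u = (\<Sum>(\<alpha>,\<beta>)\<in>S\<union>T. (if (\<alpha>,\<beta>) \<in> S then c (\<alpha>,\<beta>) else 0) * monom \<alpha> \<beta> x u)" for x u
    unfolding S(2) using S(1) T(1) by (intro sum.mono_neutral_cong_left) auto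
  moreover have "Q x u = (\<Sum>(\<alpha>,\<beta>)\<in>S\<union>T. (if (\<alpha>,\<beta>) \<in> T then d (\<alpha>,\<beta>) else 0) * monom \<alpha> \<beta> x u)" for x u
    unfolding T(2) using S(1) T(1) by (intro sum.mono_neutral_cong_left) auto
  ultimately have "(\<lambda>x u. P x u + Q x u) = (\<lambda>x u. \<Sum>(\<alpha>,\<beta>)\<in>S\<union>T. e (\<alpha>,\<beta>) * monom \<alpha> \<beta> x u)"
    by (auto simp: fun_eq_iff sum.distrib[symmetric] e_def algebra_simps intro!: sum.cong)
  with S T show ?thesis unfolding is_poly_def by (intro exI[of _ "S\<union>T"] exI[of _ e]) auto
qed

lemma is_poly_cmonom: "is_poly (\<lambda>x u. c * monom \<alpha> \<beta> x u)"
  unfolding is_poly_def by (intro exI[of _ "{(\<alpha>,\<beta>)}"] exI[of _ "\<lambda>_. c"]) auto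

lemma is_poly_const: "is_poly (\<lambda>x u. c)"
  using is_poly_cmonom[of c "\<lambda>_. 0" "\<lambda>_. 0"] by (simp add: monom_0)

lemma is_poly_x: "is_poly (\<lambda>x u. complex_of_real (x $ j))"
  using is_poly_cmonom[of 1] by (metis (no_types, lifting) ext monom_x mult_1)

lemma is_poly_u: "is_poly (\<lambda>x u. complex_of_real (u $ j))"
  using is_poly_cmonom[of 1] by (metis (no_types, lifting) ext monom_u mult_1)

lemma is_poly_sum: "(\<And>s. s \<in> S \<Longrightarrow> is_poly (f s)) \<Longrightarrow> is_poly (\<lambda>x u. \<Sum>s\<in>S. f s x u)"
  by (induction S rule: infinite_finite_induct) (auto intro: is_poly_const is_poly_add)

lemma is_poly_mult:
  assumes "is_poly P" "is_poly Q"
  shows "is_poly (\<lambda>x u. P x u * Q x u)"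
proof -
  obtain S c where S: "finite S" "P = (\<lambda>x u. \<Sum>(\<alpha>,\<beta>)\<in>S. c (\<alpha>,\<beta>) * monom \<alpha> \<beta> x u)"
    using assms(1) unfolding is_poly_def by blast
  obtain T d where T: "finite T" "Q = (\<lambda>x u. \<Sum>(\<alpha>,\<beta>)\<in>T. d (\<alpha>,\<beta>) * monom \<alpha> \<beta> x u)"
    using assms(2) unfolding is_poly_def by blast
  have "(\<lambda>x u. P x u * Q x u) = (\<lambda>x u. \<Sum>s\<in>S. \<Sum>t\<in>T. (c s * d t) *
     monom (\<lambda>j. fst s j + fst t j) (\<lambda>j. snd s j + snd t j) x u)"
    unfolding S T by (auto simp: fun_eq_iff sum_product monom_mult[symmetric] split_def intro!: sum.cong)
  then show ?thesis by (auto intro!: is_poly_sum is_poly_cmonom)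
qed

text \<open>Polynomials form the algebra generated by the constants and the coordinates, so a
  property compatible with sums and products has to be checked on these generators only. This
  replaces calculations with coefficient families.\<close>

lemma is_poly_induct [consumes 1, case_names const x u add mult]:
  assumes P: "is_poly P"
    and const: "\<And>c. R (\<lambda>x u. c)"
    and x: "\<And>j. R (\<lambda>x u. complex_of_real (x $ j))"
    and u: "\<And>j. R (\<lambda>x u. complex_of_real (u $ j))"
    and add: "\<And>P Q. is_poly P \<Longrightarrow> is_poly Q \<Longrightarrow> R P \<Longrightarrow> R Q \<Longrightarrow> R (\<lambda>x u. P x u + Q x u)"
    and mult: "\<And>P Q. is_poly P \<Longrightarrow> is_poly Q \<Longrightarrow> R P \<Longrightarrow> R Q \<Longrightarrow> R (\<lambda>x u. P x u * Q x u)"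
  shows "R P"
proof -
  \<comment> \<open>The rules \<open>add\<close> and \<open>mult\<close> accept polynomial arguments
    only, so polynomiality is carried along with \<open>R\<close>.\<close>
  let ?R = "\<lambda>P. is_poly P \<and> R P"
  have cst: "?R (\<lambda>x u. c)" for c using const is_poly_const by auto
  have mul: "?R (\<lambda>x u. P x u * Q x u)" if "?R P" "?R Q" for P Q
    using that mult is_poly_mult by blast
  have pw: "?R (\<lambda>x u. f x u ^ n)" if "?R f" for f n
  proof (induction n)
    case (Suc n)
    show ?case using mul[OF that Suc] by (simp only: power_Suc)
  qed (simp only: power_0 cst)
  have prd: "?R (\<lambda>x u. \<Prod>j\<in>J. f j x u)" if f: "\<And>j. ?R (f j)" for f and J :: "'a set"
    using finite[of J]
  proof (induction J rule: finite_induct)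
    case (insert j J)
    show ?case using mul[OF f[of j] insert.IH] by (simp only: prod.insert[OF insert.hyps])
  qed (simp only: prod.empty cst)
  have pl: "?R (\<lambda>x u. P x u + Q x u)" if "?R P" "?R Q" for P Q
    using that add is_poly_add by blast
  have mon: "?R (monom \<alpha> \<beta>)" for \<alpha> \<beta>
    unfolding monom_def of_real_mult of_real_power
    by (intro prd mul pw conjI is_poly_x is_poly_u x u)
  have sm: "?R (\<lambda>y v. \<Sum>s\<in>S. f s y v)" if f: "\<And>s. ?R (f s)" and "finite S"
    for f and S :: "(('a \<Rightarrow> nat) \<times> ('a \<Rightarrow> nat)) set"
    using that(2)
  proof (induction S rule: finite_induct)
    case (insert j S)
    show ?case using pl[OF f[of j] insert.IH] by (simp only: sum.insert[OF insert.hyps])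
  qed (simp only: sum.empty cst)
  obtain S c where S: "finite S" "P = (\<lambda>x u. \<Sum>(\<alpha>,\<beta>)\<in>S. c (\<alpha>,\<beta>) * monom \<alpha> \<beta> x u)"
    using P unfolding is_poly_def by blast
  have "?R (\<lambda>x u. \<Sum>s\<in>S. c s * monom (fst s) (snd s) x u)"
    by (intro sm mul mon cst S)
  then show ?thesis unfolding S by (simp add: split_def)
qed

section \<open>Partial derivatives of polynomials\<close>

lemma coord_has_derivative:
  "((\<lambda>t. complex_of_real ((x + t *\<^sub>R axis j 1) $ i)) has_vector_derivative (if i = j then 1 else 0)) (at 0)"
proof -
  have "((\<lambda>t. (x + t *\<^sub>R axis j 1) $ i) has_real_derivative (if i = j then 1 else 0)) (at 0)"
    by (auto intro!: derivative_eq_intros simp: axis_def)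
  from has_vector_derivative_of_real[OF this] show ?thesis by (simp split: if_splits)
qed

text \<open>\<open>dx\<close> is built on \<open>vector_derivative\<close>, a description operator
  that is informative only where a derivative exists. Existence and polynomiality of a derivative
  are therefore proved together, and \<open>dx j P\<close> is identified with it at the end.\<close>

lemma has_dx:
  assumes "is_poly P"
  shows "is_poly (dx j P) \<and> (\<forall>x u. ((\<lambda>t. P (x + t *\<^sub>R axis j 1) u) has_vector_derivative dx j P x u) (at 0))"
proof -
  have main: "\<exists>D. is_poly D \<and> (\<forall>x u. ((\<lambda>t. P (x + t *\<^sub>R axis j 1) u) has_vector_derivative D x u) (at 0))"
    using assms
  proof (induction rule: is_poly_induct)
    case (const c)
    then show ?case by (intro exI[of _ "\<lambda>x u. 0"]) (auto intro: is_poly_const)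
  next
    case (x i)
    show ?case
      by (intro exI[of _ "\<lambda>x u. if i = j then 1 else 0"]) (intro conjI allI is_poly_const coord_has_derivative)
  next
    case (u i)
    then show ?case by (intro exI[of _ "\<lambda>x u. 0"]) (auto intro: is_poly_const)
  next
    case (add P Q)
    then obtain D E where D: "is_poly D" "\<And>x u. ((\<lambda>t. P (x + t *\<^sub>R axis j 1) u) has_vector_derivative D x u) (at 0)"
      and E: "is_poly E" "\<And>x u. ((\<lambda>t. Q (x + t *\<^sub>R axis j 1) u) has_vector_derivative E x u) (at 0)"
      by blast
    show ?case
      by (intro exI[of _ "\<lambda>x u. D x u + E x u"]) (auto intro!: is_poly_add D E has_vector_derivative_add)
  next
    case (mult P Q)
    then obtain D E where D: "is_poly D" "\<And>x u. ((\<lambda>t. P (x + t *\<^sub>R axis j 1) u) has_vector_derivative D x u) (at 0)"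
      and E: "is_poly E" "\<And>x u. ((\<lambda>t. Q (x + t *\<^sub>R axis j 1) u) has_vector_derivative E x u) (at 0)"
      by blast
    have "((\<lambda>t. P (x + t *\<^sub>R axis j 1) u * Q (x + t *\<^sub>R axis j 1) u) has_vector_derivative P x u * E x u + D x u * Q x u) (at 0)" for x u
      using has_vector_derivative_mult[OF D(2) E(2), of x u] by simp
    then show ?case
      using D E mult by (intro exI[of _ "\<lambda>x u. P x u * E x u + D x u * Q x u"]) (auto intro!: is_poly_add is_poly_mult)
  qed
  then obtain D where D: "is_poly D" "\<And>x u. ((\<lambda>t. P (x + t *\<^sub>R axis j 1) u) has_vector_derivative D x u) (at 0)" by blast
  then have "dx j P = D" unfolding dx_def by (simp add: vector_derivative_at fun_eq_iff)
  with D show ?thesis by simp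
qed

text \<open>Exchanging the two arguments turns derivatives in u into derivatives in x, so the facts
  about \<open>du\<close> are inherited from \<open>dx\<close>.\<close>

lemma du_swap: "du j P = (\<lambda>x u. dx j (\<lambda>x u. P u x) u x)"
  by (simp add: du_def dx_def)

lemma is_poly_swap: "is_poly P \<Longrightarrow> is_poly (\<lambda>x u. P u x)"
  by (induction rule: is_poly_induct) (auto intro: is_poly_const is_poly_x is_poly_u is_poly_add is_poly_mult)

lemma has_du:
  assumes "is_poly P"
  shows "is_poly (du j P) \<and> (\<forall>x u. ((\<lambda>t. P x (u + t *\<^sub>R axis j 1)) has_vector_derivative du j P x u) (at 0))"
  using has_dx[OF is_poly_swap[OF assms]] is_poly_swap unfolding du_swap by blast

lemma dx_rules:
  fixes P Q :: "'n::finite pfun"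
  shows "dx j (\<lambda>x u. c) = (\<lambda>x u. 0)"
    "dx j (\<lambda>x u. complex_of_real (x $ i)) = (\<lambda>x u. if i = j then 1 else 0)"
    "dx j (\<lambda>x u. complex_of_real (u $ i)) = (\<lambda>x u. 0)"
    "is_poly P \<Longrightarrow> is_poly Q \<Longrightarrow> dx j (\<lambda>x u. P x u + Q x u) = (\<lambda>x u. dx j P x u + dx j Q x u)"
    "is_poly P \<Longrightarrow> is_poly Q \<Longrightarrow> dx j (\<lambda>x u. P x u * Q x u) = (\<lambda>x u. dx j P x u * Q x u + P x u * dx j Q x u)"
proof -
  show "dx j (\<lambda>x u. c) = (\<lambda>x u. 0)" "dx j (\<lambda>x u. complex_of_real (u $ i)) = (\<lambda>x u. 0)"
    by (simp_all add: dx_def)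
  show "dx j (\<lambda>x u. complex_of_real (x $ i)) = (\<lambda>x u. if i = j then 1 else 0)"
    unfolding dx_def by (intro ext vector_derivative_at coord_has_derivative)
next
  assume P: "is_poly P" and Q: "is_poly Q"
  note D = has_dx[OF P, THEN conjunct2, rule_format] has_dx[OF Q, THEN conjunct2, rule_format]
  show "dx j (\<lambda>x u. P x u + Q x u) = (\<lambda>x u. dx j P x u + dx j Q x u)"
    using vector_derivative_at[OF has_vector_derivative_add[OF D]] by (simp add: dx_def fun_eq_iff)
  show "dx j (\<lambda>x u. P x u * Q x u) = (\<lambda>x u. dx j P x u * Q x u + P x u * dx j Q x u)"
    using vector_derivative_at[OF has_vector_derivative_mult[OF D]] by (simp add: dx_def fun_eq_iff add.commute)
qed

lemma du_rules:
  fixes P Q :: "'n::finite pfun"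
  shows "du j (\<lambda>x u. c) = (\<lambda>x u. 0)"
    "du j (\<lambda>x u. complex_of_real (u $ i)) = (\<lambda>x u. if i = j then 1 else 0)"
    "du j (\<lambda>x u. complex_of_real (x $ i)) = (\<lambda>x u. 0)"
    "is_poly P \<Longrightarrow> is_poly Q \<Longrightarrow> du j (\<lambda>x u. P x u + Q x u) = (\<lambda>x u. du j P x u + du j Q x u)"
    "is_poly P \<Longrightarrow> is_poly Q \<Longrightarrow> du j (\<lambda>x u. P x u * Q x u) = (\<lambda>x u. du j P x u * Q x u + P x u * du j Q x u)"
  unfolding du_swap by (simp_all add: dx_rules is_poly_swap)

text \<open>On this type the partial derivatives are derivations without any side condition on polynomiality.\<close>

typedef 'n dpoly = "{P :: 'n::finite pfun. is_poly P}"
  morphisms eval Abs_dpoly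
  using is_poly_const by blast

setup_lifting type_definition_dpoly

instantiation dpoly :: (finite) "{comm_ring_1, real_algebra_1}"
begin

lift_definition zero_dpoly :: "'a dpoly" is "\<lambda>x u. 0" by (rule is_poly_const)
lift_definition one_dpoly :: "'a dpoly" is "\<lambda>x u. 1" by (rule is_poly_const)
lift_definition plus_dpoly :: "'a dpoly \<Rightarrow> 'a dpoly \<Rightarrow> 'a dpoly" is "\<lambda>P Q x u. P x u + Q x u" by (rule is_poly_add)
lift_definition times_dpoly :: "'a dpoly \<Rightarrow> 'a dpoly \<Rightarrow> 'a dpoly" is "\<lambda>P Q x u. P x u * Q x u" by (rule is_poly_mult)
lift_definition scaleR_dpoly :: "real \<Rightarrow> 'a dpoly \<Rightarrow> 'a dpoly" is "\<lambda>c P x u. complex_of_real c * P x u"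
  by (intro is_poly_mult is_poly_const)
lift_definition uminus_dpoly :: "'a dpoly \<Rightarrow> 'a dpoly" is "\<lambda>P x u. - P x u"
  using is_poly_mult[OF is_poly_const[of "-1"]] by simp
definition minus_dpoly :: "'a dpoly \<Rightarrow> 'a dpoly \<Rightarrow> 'a dpoly" where "minus_dpoly P Q = P + - Q"

instance
  by standard (unfold minus_dpoly_def, (transfer, auto simp: algebra_simps fun_eq_iff)+)

end

text \<open>Complex scalars act as multiplication by these constants. The scalar multiplication of
  the type class is real, which fits the structure constants below: they are all real.\<close>

lift_definition cst :: "complex \<Rightarrow> 'n::finite dpoly" is "\<lambda>c x u. c" by (rule is_poly_const)
lift_definition cX :: "'n \<Rightarrow> 'n::finite dpoly" is "\<lambda>j x u. complex_of_real (x $ j)" by (rule is_poly_x)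
lift_definition cU :: "'n \<Rightarrow> 'n::finite dpoly" is "\<lambda>j x u. complex_of_real (u $ j)" by (rule is_poly_u)
lift_definition dX :: "'n \<Rightarrow> 'n::finite dpoly \<Rightarrow> 'n dpoly" is dx using has_dx by blast
lift_definition dU :: "'n \<Rightarrow> 'n::finite dpoly \<Rightarrow> 'n dpoly" is du using has_du by blast

lemma dpoly_induct [case_names cst cX cU add mult]:
  assumes "\<And>c. R (cst c)" "\<And>j. R (cX j)" "\<And>j. R (cU j)"
    and "\<And>P Q. R P \<Longrightarrow> R Q \<Longrightarrow> R (P + Q)" "\<And>P Q. R P \<Longrightarrow> R Q \<Longrightarrow> R (P * Q)"
  shows "R (P :: 'n::finite dpoly)"
proof -
  have "is_poly f \<Longrightarrow> R (Abs_dpoly f)" for f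
  proof (induction rule: is_poly_induct)
    case (const c) then show ?case using assms(1)[of c] by (simp add: cst_def)
  next
    case (x j) then show ?case using assms(2)[of j] by (simp add: cX_def)
  next
    case (u j) then show ?case using assms(3)[of j] by (simp add: cU_def)
  next
    case (add P Q) then show ?case using assms(4)[of "Abs_dpoly P" "Abs_dpoly Q"]
      by (simp add: plus_dpoly_def Abs_dpoly_inverse)
  next
    case (mult P Q) then show ?case using assms(5)[of "Abs_dpoly P" "Abs_dpoly Q"]
      by (simp add: times_dpoly_def Abs_dpoly_inverse)
  qed
  from this[of "eval P"] show ?thesis using eval[of P] by (simp add: eval_inverse)
qed

lemma cst_simps: "cst 0 = 0" "cst 1 = 1" "cst (a + b) = cst a + cst b" "cst (a * b) = cst a * cst b" "cst (- a) = - cst a"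
  by (transfer, simp)+

lemma scaleR_conv_cst: "c *\<^sub>R P = cst (complex_of_real c) * P"
  by transfer simp

lemma dX_rules [simp]:
  "dX j (cst c) = 0" "dX j (cX i) = (if i = j then 1 else 0)" "dX j (cU i) = 0"
  "dX j (P + Q) = dX j P + dX j Q" "dX j (P * Q) = dX j P * Q + P * dX j Q"
  by (transfer, simp add: dx_rules fun_eq_iff)+

lemma dU_rules [simp]:
  "dU j (cst c) = 0" "dU j (cU i) = (if i = j then 1 else 0)" "dU j (cX i) = 0"
  "dU j (P + Q) = dU j P + dU j Q" "dU j (P * Q) = dU j P * Q + P * dU j Q"
  by (transfer, simp add: du_rules fun_eq_iff)+

lemma d_scaleR [simp]: "dX j (c *\<^sub>R P) = c *\<^sub>R dX j P" "dU j (c *\<^sub>R P) = c *\<^sub>R dU j P"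
  by (simp_all add: scaleR_conv_cst)

lemma d_0_1 [simp]: "dX j 0 = 0" "dU j 0 = 0" "dX j 1 = 0" "dU j 1 = 0"
  by (metis cst_simps(1) dX_rules(1), metis cst_simps(1) dU_rules(1), metis cst_simps(2) dX_rules(1), metis cst_simps(2) dU_rules(1))

text \<open>For polynomials the symmetry of mixed derivatives is purely algebraic: it is checked on
  the generators and passes to products by the Leibniz rule.\<close>

lemma d_commute:
  "dX i (dX j P) = dX j (dX i P)" "dU i (dU j P) = dU j (dU i P)" "dU i (dX j P) = dX j (dU i P)"
  by (induction P rule: dpoly_induct) (simp_all add: algebra_simps)

lemma d_sum [simp]: "dX j (sum f S) = (\<Sum>s\<in>S. dX j (f s))" "dU j (sum f S) = (\<Sum>s\<in>S. dU j (f s))"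
  by (induction S rule: infinite_finite_induct) simp_all

section \<open>The $\mathfrak{sp}(4)$-operators and their commutators\<close>

definition nx :: "'n::finite dpoly" where "nx = (\<Sum>j\<in>UNIV. cX j * cX j)"
definition nu :: "'n::finite dpoly" where "nu = (\<Sum>j\<in>UNIV. cU j * cU j)"
definition ip :: "'n::finite dpoly" where "ip = (\<Sum>j\<in>UNIV. cU j * cX j)"

definition lapX :: "'n::finite dpoly \<Rightarrow> 'n dpoly" where "lapX P = (\<Sum>j\<in>UNIV. dX j (dX j P))"
definition lapU :: "'n::finite dpoly \<Rightarrow> 'n dpoly" where "lapU P = (\<Sum>j\<in>UNIV. dU j (dU j P))"
definition dUX :: "'n::finite dpoly \<Rightarrow> 'n dpoly" where "dUX P = (\<Sum>j\<in>UNIV. dU j (dX j P))"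
definition xdU :: "'n::finite dpoly \<Rightarrow> 'n dpoly" where "xdU P = (\<Sum>j\<in>UNIV. cX j * dU j P)"
definition udX :: "'n::finite dpoly \<Rightarrow> 'n dpoly" where "udX P = (\<Sum>j\<in>UNIV. cU j * dX j P)"
definition eulX :: "'n::finite dpoly \<Rightarrow> 'n dpoly" where "eulX P = (\<Sum>j\<in>UNIV. cX j * dX j P)"
definition eulU :: "'n::finite dpoly \<Rightarrow> 'n dpoly" where "eulU P = (\<Sum>j\<in>UNIV. cU j * dU j P)"

lemmas op_defs = lapX_def lapU_def dUX_def xdU_def udX_def eulX_def eulU_def

lemma op_add [simp]:
  "lapX (P + Q) = lapX P + lapX Q" "lapU (P + Q) = lapU P + lapU Q" "dUX (P + Q) = dUX P + dUX Q"
  "xdU (P + Q) = xdU P + xdU Q" "udX (P + Q) = udX P + udX Q"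
  "eulX (P + Q) = eulX P + eulX Q" "eulU (P + Q) = eulU P + eulU Q"
  by (simp_all add: op_defs sum.distrib distrib_left)

lemma op_cst [simp]:
  "lapX (cst c * P) = cst c * lapX P" "lapU (cst c * P) = cst c * lapU P" "dUX (cst c * P) = cst c * dUX P"
  "xdU (cst c * P) = cst c * xdU P" "udX (cst c * P) = cst c * udX P"
  "eulX (cst c * P) = cst c * eulX P" "eulU (cst c * P) = cst c * eulU P"
  by (simp_all add: op_defs sum_distrib_left mult.left_commute)

lemma op_scaleR [simp]:
  "lapX (r *\<^sub>R P) = r *\<^sub>R lapX P" "lapU (r *\<^sub>R P) = r *\<^sub>R lapU P" "dUX (r *\<^sub>R P) = r *\<^sub>R dUX P"
  "xdU (r *\<^sub>R P) = r *\<^sub>R xdU P" "udX (r *\<^sub>R P) = r *\<^sub>R udX P"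
  "eulX (r *\<^sub>R P) = r *\<^sub>R eulX P" "eulU (r *\<^sub>R P) = r *\<^sub>R eulU P"
  by (simp_all add: scaleR_conv_cst)

lemma op_0 [simp]: "lapX 0 = 0" "lapU 0 = 0" "dUX 0 = 0" "xdU 0 = 0" "udX 0 = 0" "eulX 0 = 0" "eulU 0 = 0"
  by (simp_all add: op_defs)

lemma op_minus [simp]:
  "lapX (- P) = - lapX P" "lapU (- P) = - lapU P" "dUX (- P) = - dUX P" "xdU (- P) = - xdU P"
  "udX (- P) = - udX P" "eulX (- P) = - eulX P" "eulU (- P) = - eulU P"
  using op_scaleR[of "-1" P] by simp_all

lemma op_diff [simp]:
  "lapX (P - Q) = lapX P - lapX Q" "lapU (P - Q) = lapU P - lapU Q" "dUX (P - Q) = dUX P - dUX Q"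
  "xdU (P - Q) = xdU P - xdU Q" "udX (P - Q) = udX P - udX Q"
  "eulX (P - Q) = eulX P - eulX Q" "eulU (P - Q) = eulU P - eulU Q"
  using op_add[of P "- Q"] by simp_all

lemma op_sum:
  "lapX (sum f S) = (\<Sum>s\<in>S. lapX (f s))" "lapU (sum f S) = (\<Sum>s\<in>S. lapU (f s))"
  "dUX (sum f S) = (\<Sum>s\<in>S. dUX (f s))" "xdU (sum f S) = (\<Sum>s\<in>S. xdU (f s))" "udX (sum f S) = (\<Sum>s\<in>S. udX (f s))"
  "eulX (sum f S) = (\<Sum>s\<in>S. eulX (f s))" "eulU (sum f S) = (\<Sum>s\<in>S. eulU (f s))"
  by (induction S rule: infinite_finite_induct) simp_all

lemma op_mult:
  "xdU (P * Q) = xdU P * Q + P * xdU Q" "udX (P * Q) = udX P * Q + P * udX Q"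
  "eulX (P * Q) = eulX P * Q + P * eulX Q" "eulU (P * Q) = eulU P * Q + P * eulU Q"
  by (simp_all add: op_defs sum.distrib sum_distrib_left sum_distrib_right distrib_left mult_ac)

lemma sum_delta1 [simp]:
  fixes f :: "'n::finite \<Rightarrow> 'a::comm_ring_1"
  shows "(\<Sum>j\<in>UNIV. f j * (if j = i then 1 else 0)) = f i"
  "(\<Sum>j\<in>UNIV. (if j = i then 1 else 0) * f j) = f i"
  "(\<Sum>j\<in>UNIV. f j * (if i = j then 1 else 0)) = f i"
  "(\<Sum>j\<in>UNIV. (if i = j then 1 else 0) * f j) = f i"
proof -
  have "f j * (if P then 1 else 0) = (if P then f j else 0)" "(if P then 1 else 0) * f j = (if P then f j else 0)" for j P
    by simp_all
  then show "(\<Sum>j\<in>UNIV. f j * (if j = i then 1 else 0)) = f i" "(\<Sum>j\<in>UNIV. (if j = i then 1 else 0) * f j) = f i"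
    "(\<Sum>j\<in>UNIV. f j * (if i = j then 1 else 0)) = f i" "(\<Sum>j\<in>UNIV. (if i = j then 1 else 0) * f j) = f i"
    by (simp_all only: sum.delta sum.delta' finite_class.finite_UNIV UNIV_I if_True)
qed

lemma d_quad [simp]:
  "dX j nx = 2 *\<^sub>R cX j" "dX j nu = 0" "dX j ip = cU j"
  "dU j nu = 2 *\<^sub>R cU j" "dU j nx = 0" "dU j ip = cX j"
  by (simp_all add: nx_def nu_def ip_def sum.distrib scaleR_2 mult.assoc flip: sum_distrib_left)

lemma op_quad [simp]:
  "xdU nx = 0" "xdU nu = 2 *\<^sub>R ip" "xdU ip = nx"
  "udX nx = 2 *\<^sub>R ip" "udX nu = 0" "udX ip = nu"
  "eulX nx = 2 *\<^sub>R nx" "eulX nu = 0" "eulX ip = ip"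
  "eulU nx = 0" "eulU nu = 2 *\<^sub>R nu" "eulU ip = ip"
  by (simp_all add: xdU_def udX_def eulX_def eulU_def scaleR_sum_right[symmetric])
    (simp_all add: nx_def nu_def ip_def mult.commute)

lemma d_commute_op:
  "dX j (xdU P) = xdU (dX j P) + dU j P" "dU j (xdU P) = xdU (dU j P)"
  "dU j (udX P) = udX (dU j P) + dX j P" "dX j (udX P) = udX (dX j P)"
  "dX j (eulX P) = eulX (dX j P) + dX j P" "dU j (eulX P) = eulX (dU j P)"
  "dU j (eulU P) = eulU (dU j P) + dU j P" "dX j (eulU P) = eulU (dX j P)"
  by (simp_all add: op_defs sum.distrib d_commute add.commute)

lemma op_commute_lap:
  "lapX (xdU P) = xdU (lapX P) + 2 *\<^sub>R dUX P" "lapU (xdU P) = xdU (lapU P)"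
  "lapU (udX P) = udX (lapU P) + 2 *\<^sub>R dUX P" "lapX (udX P) = udX (lapX P)"
  "lapX (eulX P) = eulX (lapX P) + 2 *\<^sub>R lapX P" "lapX (eulU P) = eulU (lapX P)"
  "lapU (eulU P) = eulU (lapU P) + 2 *\<^sub>R lapU P" "lapU (eulX P) = eulX (lapU P)"
  by (simp_all add: lapX_def lapU_def dUX_def d_commute_op op_sum sum.distrib scaleR_2 d_commute(3) add.assoc sum_distrib_left)

lemma op_commute_dUX:
  "dUX (xdU P) = xdU (dUX P) + lapU P" "dUX (udX P) = udX (dUX P) + lapX P"
  "dUX (eulX P) = eulX (dUX P) + dUX P" "dUX (eulU P) = eulU (dUX P) + dUX P"
  by (simp_all add: lapX_def lapU_def dUX_def d_commute_op op_sum sum.distrib)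

lemma lap_commute:
  "lapX (lapU P) = lapU (lapX P)" "lapX (dUX P) = dUX (lapX P)" "lapU (dUX P) = dUX (lapU P)"
proof -
  have "lapX (dX j P) = dX j (lapX P)" "lapX (dU j P) = dU j (lapX P)"
    "lapU (dX j P) = dX j (lapU P)" "lapU (dU j P) = dU j (lapU P)" for j and P :: "'a dpoly"
    by (simp_all add: lapX_def lapU_def d_commute)
  then show "lapX (lapU P) = lapU (lapX P)" "lapX (dUX P) = dUX (lapX P)" "lapU (dUX P) = dUX (lapU P)"
    by (simp_all add: lapU_def[of P] dUX_def op_sum) (simp add: lapU_def)
qed

lemma op_gen:
  "xdU (cst c) = 0" "xdU (cX j) = 0" "xdU (cU j) = cX j"
  "udX (cst c) = 0" "udX (cX j) = cU j" "udX (cU j) = 0"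
  "eulX (cst c) = 0" "eulX (cX j) = cX j" "eulX (cU j) = 0"
  "eulU (cst c) = 0" "eulU (cX j) = 0" "eulU (cU j) = cU j"
  by (simp_all add: op_defs)

lemma op_commute_eul:
  "xdU (udX P) = udX (xdU P) + eulX P - eulU P"
  "eulX (xdU P) = xdU (eulX P) + xdU P" "eulU (xdU P) = xdU (eulU P) - xdU P"
  "eulX (udX P) = udX (eulX P) - udX P" "eulU (udX P) = udX (eulU P) + udX P"
  "eulX (eulU P) = eulU (eulX P)"
proof -
  \<comment> \<open>Both compositions share the second-order part, the sum of
    \<open>cX j * udX (dU j P)\<close>; what remains of each is an Euler operator.\<close>
  have "xdU (udX P) = (\<Sum>j\<in>UNIV. cX j * udX (dU j P)) + eulX P"
    by (simp add: xdU_def[of "udX P"] d_commute_op eulX_def distrib_left sum.distrib)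
  moreover have "udX (xdU P) = (\<Sum>j\<in>UNIV. cX j * udX (dU j P)) + eulU P"
    unfolding xdU_def op_sum by (simp add: op_mult op_gen eulU_def sum.distrib add.commute)
  ultimately show "xdU (udX P) = udX (xdU P) + eulX P - eulU P" by simp
  show "eulX (xdU P) = xdU (eulX P) + xdU P"
    unfolding xdU_def op_sum by (simp add: op_mult op_gen d_commute_op sum.distrib add.commute)
  show "eulU (xdU P) = xdU (eulU P) - xdU P"
    unfolding xdU_def op_sum by (simp add: op_mult op_gen d_commute_op sum.distrib distrib_left)
  show "eulX (udX P) = udX (eulX P) - udX P"
    unfolding udX_def op_sum by (simp add: op_mult op_gen d_commute_op sum.distrib distrib_left)
  show "eulU (udX P) = udX (eulU P) + udX P"
    unfolding udX_def op_sum by (simp add: op_mult op_gen d_commute_op sum.distrib add.commute)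
  show "eulX (eulU P) = eulU (eulX P)"
    unfolding eulU_def op_sum by (simp add: op_mult op_gen d_commute_op)
qed

text \<open>With their analogues for \<open>nu\<close> and \<open>ip\<close> these are the brackets
  of sp(4) between multiplications and second-order operators; 4E + 2m is, up to scaling, the Cartan
  element of the harmonic sl(2) in x.\<close>

lemma lap_mult_nx:
  "lapX (nx * P) = nx * lapX P + 4 *\<^sub>R eulX P + (2 * real CARD('n)) *\<^sub>R P"
  "lapU (nx * P) = nx * lapU P"
  "dUX (nx * P) = nx * dUX P + 2 *\<^sub>R xdU P" for P :: "'n::finite dpoly"
proof -
  have *: "dX j (dX j (nx * P)) = 2 *\<^sub>R P + 4 *\<^sub>R (cX j * dX j P) + nx * dX j (dX j P)" for j
    by (simp add: algebra_simps flip: scaleR_add_left)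
  show "lapX (nx * P) = nx * lapX P + 4 *\<^sub>R eulX P + (2 * real CARD('n)) *\<^sub>R P"
    unfolding lapX_def eulX_def * by (simp add: sum.distrib sum_constant_scaleR scaleR_sum_right sum_distrib_left mult.commute del: sum_constant)
  show "lapU (nx * P) = nx * lapU P"
    by (simp add: lapU_def sum_distrib_left)
  show "dUX (nx * P) = nx * dUX P + 2 *\<^sub>R xdU P"
    by (simp add: dUX_def xdU_def sum.distrib sum_distrib_left scaleR_sum_right)
qed

lemma lap_mult_nu:
  "lapU (nu * P) = nu * lapU P + 4 *\<^sub>R eulU P + (2 * real CARD('n)) *\<^sub>R P"
  "lapX (nu * P) = nu * lapX P"
  "dUX (nu * P) = nu * dUX P + 2 *\<^sub>R udX P" for P :: "'n::finite dpoly"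
proof -
  have *: "dU j (dU j (nu * P)) = 2 *\<^sub>R P + 4 *\<^sub>R (cU j * dU j P) + nu * dU j (dU j P)" for j
    by (simp add: algebra_simps flip: scaleR_add_left)
  show "lapU (nu * P) = nu * lapU P + 4 *\<^sub>R eulU P + (2 * real CARD('n)) *\<^sub>R P"
    unfolding lapU_def eulU_def * by (simp add: sum.distrib sum_constant_scaleR scaleR_sum_right sum_distrib_left mult.commute del: sum_constant)
  show "lapX (nu * P) = nu * lapX P"
    by (simp add: lapX_def sum_distrib_left)
  show "dUX (nu * P) = nu * dUX P + 2 *\<^sub>R udX P"
    by (simp add: dUX_def udX_def sum.distrib sum_distrib_left scaleR_sum_right add.commute)
qed

lemma lap_mult_ip:
  "lapX (ip * P) = ip * lapX P + 2 *\<^sub>R udX P"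
  "lapU (ip * P) = ip * lapU P + 2 *\<^sub>R xdU P"
  "dUX (ip * P) = ip * dUX P + eulX P + eulU P + real CARD('n) *\<^sub>R P" for P :: "'n::finite dpoly"
  by (simp_all add: lapX_def lapU_def dUX_def udX_def xdU_def eulX_def eulU_def sum.distrib sum_distrib_left scaleR_sum_right sum_constant_scaleR scaleR_2 del: sum_constant)

lemma op_mult_quad:
  "xdU (nx * P) = nx * xdU P" "xdU (nu * P) = nu * xdU P + 2 *\<^sub>R (ip * P)" "xdU (ip * P) = ip * xdU P + nx * P"
  "udX (nx * P) = nx * udX P + 2 *\<^sub>R (ip * P)" "udX (nu * P) = nu * udX P" "udX (ip * P) = ip * udX P + nu * P"
  "eulX (nx * P) = nx * eulX P + 2 *\<^sub>R (nx * P)" "eulX (nu * P) = nu * eulX P" "eulX (ip * P) = ip * eulX P + ip * P"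
  "eulU (nu * P) = nu * eulU P + 2 *\<^sub>R (nu * P)" "eulU (nx * P) = nx * eulU P" "eulU (ip * P) = ip * eulU P + ip * P"
  by (simp_all add: op_mult)

section \<open>Bihomogeneous polynomials\<close>

lemma eval_simps [simp]:
  "eval 0 x u = 0" "eval 1 x u = 1" "eval (P + Q) x u = eval P x u + eval Q x u"
  "eval (P * Q) x u = eval P x u * eval Q x u" "eval (- P) x u = - eval P x u"
  "eval (cst c) x u = c" "eval (cX j) x u = complex_of_real (x $ j)" "eval (cU j) x u = complex_of_real (u $ j)"
  "eval (r *\<^sub>R P) x u = complex_of_real r * eval P x u"
  by (transfer, simp)+

lemma eval_more [simp]:
  "eval (P - Q) x u = eval P x u - eval Q x u" "eval (P ^ n) x u = eval P x u ^ n"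
  "eval (sum f S) x u = (\<Sum>s\<in>S. eval (f s) x u)" "eval (prod f S) x u = (\<Prod>s\<in>S. eval (f s) x u)"
proof -
  show "eval (P - Q) x u = eval P x u - eval Q x u"
    using eval_simps(3)[of "P - Q" Q x u] by simp
  show "eval (P ^ n) x u = eval P x u ^ n" by (induction n) simp_all
  show "eval (sum f S) x u = (\<Sum>s\<in>S. eval (f s) x u)" "eval (prod f S) x u = (\<Prod>s\<in>S. eval (f s) x u)"
    by (induction S rule: infinite_finite_induct) simp_all
qed

lemma dpoly_eqI: "(\<And>x u. eval P x u = eval Q x u) \<Longrightarrow> P = Q"
  by (metis eval_inject ext)

definition mon :: "('n \<Rightarrow> nat) \<Rightarrow> ('n \<Rightarrow> nat) \<Rightarrow> 'n::finite dpoly" where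
  "mon \<alpha> \<beta> = (\<Prod>j\<in>UNIV. cX j ^ \<alpha> j * cU j ^ \<beta> j)"

lemma eval_mon [simp]: "eval (mon \<alpha> \<beta>) x u = monom \<alpha> \<beta> x u"
  by (simp add: mon_def monom_def)

lemma dpoly_monomials:
  "\<exists>S c. finite S \<and> P = (\<Sum>t\<in>S. cst (c t) * mon (fst t) (snd t))"
proof -
  obtain S c where "finite S" "eval P = (\<lambda>x u. \<Sum>(\<alpha>,\<beta>)\<in>S. c (\<alpha>,\<beta>) * monom \<alpha> \<beta> x u)"
    using eval[of P] unfolding is_poly_def by blast
  then show ?thesis
    by (intro exI[of _ S] exI[of _ c] conjI dpoly_eqI) (auto simp: split_def)
qed

text \<open>The degrees are integers because lowering operators can reach negative degrees, where only $P = 0$ is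
  bihomogeneous.\<close>

definition bh :: "int \<Rightarrow> int \<Rightarrow> 'n::finite dpoly \<Rightarrow> bool" where
  "bh p q P \<longleftrightarrow> eulX P = of_int p *\<^sub>R P \<and> eulU P = of_int q *\<^sub>R P"

lemma bh_linear:
  "bh p q 0"
  "bh p q P \<Longrightarrow> bh p q Q \<Longrightarrow> bh p q (P + Q)"
  "bh p q P \<Longrightarrow> bh p q Q \<Longrightarrow> bh p q (P - Q)"
  "bh p q P \<Longrightarrow> bh p q (r *\<^sub>R P)"
  "bh p q P \<Longrightarrow> bh p q (cst c * P)"
  by (simp_all add: bh_def scaleR_add_right scaleR_diff_right)

lemma bh_sum: "(\<And>s. s \<in> S \<Longrightarrow> bh p q (f s)) \<Longrightarrow> bh p q (sum f S)"
  by (induction S rule: infinite_finite_induct) (auto intro: bh_linear)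

lemma bh_mult: "bh p q P \<Longrightarrow> bh p' q' P' \<Longrightarrow> bh (p + p') (q + q') (P * P')"
  by (simp add: bh_def op_mult algebra_simps)

lemma bh_one: "bh 0 0 1"
  using op_gen(7,10)[of 1] by (simp add: bh_def cst_simps)

lemma bh_power: "bh p q P \<Longrightarrow> bh (int n * p) (int n * q) (P ^ n)"
proof (induction n)
  case (Suc n)
  then show ?case using bh_mult[of p q P "int n * p" "int n * q" "P ^ n"] by (simp add: algebra_simps)
qed (simp add: bh_one)

lemma bh_prod: "(\<And>s. bh (p s) (q s) (f s)) \<Longrightarrow> bh (sum p S) (sum q S) (prod f S)"
  by (induction S rule: infinite_finite_induct) (simp_all add: bh_one bh_mult)

lemma bh_mon: "bh (int (sum \<alpha> UNIV)) (int (sum \<beta> UNIV)) (mon \<alpha> \<beta>)"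
proof -
  have "bh (int (\<alpha> j)) (int (\<beta> j)) (cX j ^ \<alpha> j * cU j ^ \<beta> j)" for j
    using bh_mult[OF bh_power[of 1 0 "cX j" "\<alpha> j"] bh_power[of 0 1 "cU j" "\<beta> j"]] by (simp add: bh_def op_gen)
  then show ?thesis unfolding mon_def of_nat_sum by (intro bh_prod)
qed

lemma bh_ops:
  assumes "bh p q P"
  shows "bh (p - 1) (q + 1) (udX P)" "bh (p + 1) (q - 1) (xdU P)" "bh (p - 1) (q - 1) (dUX P)"
    "bh (p - 2) q (lapX P)" "bh p (q - 2) (lapU P)"
    "bh (p + 2) q (nx * P)" "bh p (q + 2) (nu * P)" "bh (p + 1) (q + 1) (ip * P)"
proof -
  have e: "eulX P = of_int p *\<^sub>R P" "eulU P = of_int q *\<^sub>R P" using assms by (simp_all add: bh_def)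
  show "bh (p - 1) (q + 1) (udX P)" "bh (p + 1) (q - 1) (xdU P)"
    by (simp_all add: bh_def op_commute_eul e algebra_simps)
  show "bh (p - 1) (q - 1) (dUX P)"
    using op_commute_dUX(3,4)[of P] by (simp add: bh_def e algebra_simps)
  show "bh (p - 2) q (lapX P)" "bh p (q - 2) (lapU P)"
    using op_commute_lap(5-8)[of P] by (simp_all add: bh_def e algebra_simps)
  show "bh (p + 2) q (nx * P)" "bh p (q + 2) (nu * P)" "bh (p + 1) (q + 1) (ip * P)"
    by (simp_all add: bh_def op_mult_quad e scaleR_add_left add.commute)
qed

text \<open>Eigenvectors for different joint eigenvalues of the Euler operators are independent. The
  weights enter through a function \<open>w\<close>, so that shifted weights can be used once a
  degree-lowering operator has been applied.\<close>

lemma bh_independent: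
  fixes G :: "'i \<Rightarrow> 'n::finite dpoly"
  assumes "finite I" "inj_on w I" "\<And>i. i \<in> I \<Longrightarrow> bh (fst (w i)) (snd (w i)) (G i)" "(\<Sum>i\<in>I. G i) = 0"
  shows "\<forall>i\<in>I. G i = 0"
  using assms
proof (induction I arbitrary: G rule: finite_induct)
  case (insert t I)
  have s: "G t + (\<Sum>i\<in>I. G i) = 0" using insert by simp
  have w: "bh (fst (w i)) (snd (w i)) (G i)" if "i \<in> insert t I" for i using insert.prems that by blast
  have "eulX (G t + (\<Sum>i\<in>I. G i)) = 0" "eulU (G t + (\<Sum>i\<in>I. G i)) = 0" unfolding s by simp_all
  then have e: "of_int (fst (w t)) *\<^sub>R G t + (\<Sum>i\<in>I. of_int (fst (w i)) *\<^sub>R G i) = 0"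
    "of_int (snd (w t)) *\<^sub>R G t + (\<Sum>i\<in>I. of_int (snd (w i)) *\<^sub>R G i) = 0"
    using w by (simp_all add: op_sum bh_def)
  have Gt: "G t = - (\<Sum>i\<in>I. G i)" using s by (simp add: eq_neg_iff_add_eq_0)
  \<comment> \<open>Subtracting the eigenvalue of \<open>t\<close> times the original relation
    removes \<open>G t\<close>. Both Euler operators are used, because two weights may differ in one
    coordinate only.\<close>
  have "(\<Sum>i\<in>I. (of_int (fst (w i)) - of_int (fst (w t))) *\<^sub>R G i) = 0"
    "(\<Sum>i\<in>I. (of_int (snd (w i)) - of_int (snd (w t))) *\<^sub>R G i) = 0"
    using e unfolding Gt by (simp_all add: sum_subtractf scaleR_left_diff_distrib scaleR_sum_right[symmetric])
  then have "\<forall>i\<in>I. (of_int (fst (w i)) - of_int (fst (w t))) *\<^sub>R G i = 0"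
    "\<forall>i\<in>I. (of_int (snd (w i)) - of_int (snd (w t))) *\<^sub>R G i = 0"
    using insert.prems insert.IH[of "\<lambda>i. (of_int (fst (w i)) - of_int (fst (w t))) *\<^sub>R G i"]
      insert.IH[of "\<lambda>i. (of_int (snd (w i)) - of_int (snd (w t))) *\<^sub>R G i"] w
    by (auto intro: bh_linear inj_on_subset)
  moreover have "w i \<noteq> w t" if "i \<in> I" for i using insert.prems(1) insert.hyps(2) that by (auto simp: inj_on_def)
  ultimately have "\<forall>i\<in>I. G i = 0" by (auto simp: prod_eq_iff)
  then show ?case using Gt by simp
qed simp

text \<open>Monomials are grouped by degree. The last clause remembers that a component is a
  combination of monomials of the right degree, in the \<open>if\<close> form that
  \<open>bh_component\<close> yields; \<open>bihom_iff\<close> draws on it.\<close>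

lemma bh_decomp:
  obtains D :: "(int \<times> int) set" and G where "finite D" "P = (\<Sum>d\<in>D. G d)"
    "\<And>d. d \<in> D \<Longrightarrow> fst d \<ge> 0 \<and> snd d \<ge> 0 \<and> bh (fst d) (snd d) (G d)"
    "\<And>p q. bh p q P \<Longrightarrow> bihom (nat p) (nat q) (eval (if (p,q) \<in> D then G (p,q) else 0))"
proof -
  obtain S c where S: "finite S" "P = (\<Sum>t\<in>S. cst (c t) * mon (fst t) (snd t))"
    using dpoly_monomials by blast
  define h where "h t = cst (c t) * mon (fst t) (snd t)" for t
  define deg where "deg t = (int (sum (fst t) UNIV), int (sum (snd t) UNIV))" for t :: "('a \<Rightarrow> nat) \<times> ('a \<Rightarrow> nat)"
  define G where "G d = sum h {t\<in>S. deg t = d}" for d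
  show ?thesis
  proof (rule that[of "deg ` S" G])
    show "finite (deg ` S)" using S by simp
    show "P = (\<Sum>d\<in>deg ` S. G d)"
      unfolding S G_def h_def[symmetric] using sum.image_gen[OF S(1), of h deg] by simp
    show "fst d \<ge> 0 \<and> snd d \<ge> 0 \<and> bh (fst d) (snd d) (G d)" if "d \<in> deg ` S" for d
    proof (intro conjI)
      show "bh (fst d) (snd d) (G d)"
        unfolding G_def h_def
      proof (intro bh_sum bh_linear(5))
        fix s assume "s \<in> {t\<in>S. deg t = d}"
        then show "bh (fst d) (snd d) (mon (fst s) (snd s))" using bh_mon[of "fst s" "snd s"] by (auto simp: deg_def)
      qed
    qed (use that in \<open>auto simp: deg_def sum_nonneg\<close>)
    have "bihom (nat p) (nat q) (eval (G (p,q)))" for p q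
      unfolding bihom_def G_def h_def
      by (rule exI[of _ "{t\<in>S. deg t = (p,q)}"], rule exI[of _ c])
        (auto simp: S(1) deg_def split_def fun_eq_iff simp flip: of_nat_sum)
    moreover have "bihom (nat p) (nat q) (eval (0 :: 'a dpoly))" for p q
      unfolding bihom_def by (rule exI[of _ "{}"]) (auto simp: fun_eq_iff)
    ultimately show "bihom (nat p) (nat q) (eval (if (p,q) \<in> deg ` S then G (p,q) else 0))" for p q
      by simp
  qed
qed

lemma bh_component:
  assumes "finite D" "P = (\<Sum>d\<in>D. G d)" "\<And>d. d \<in> D \<Longrightarrow> bh (fst d) (snd d) (G d)" "bh p q P"
  shows "P = (if (p,q) \<in> D then G (p,q) else 0)"
proof -
  \<comment> \<open>Entering \<open>P\<close> with a minus sign at its own weight turns the equality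
    into a vanishing sum over distinct weights, whether or not \<open>(p,q)\<close> lies in
    \<open>D\<close>.\<close>
  define G' where "G' d = (if d \<in> D then G d else 0) - (if d = (p,q) then P else 0)" for d
  have "\<forall>d\<in>insert (p,q) D. G' d = 0"
  proof (rule bh_independent[where w = id])
    have "(\<Sum>d\<in>insert (p,q) D. if d \<in> D then G d else 0) = (\<Sum>d\<in>D. G d)"
      using assms(1) by (intro sum.mono_neutral_cong_right) auto
    then show "(\<Sum>d\<in>insert (p,q) D. G' d) = 0"
      unfolding G'_def sum_subtractf using assms(1,2) by simp
  qed (use assms in \<open>auto simp: G'_def bh_linear\<close>)
  then show ?thesis by (auto simp: G'_def split: if_splits)
qed

lemma bh_negative:
  assumes "bh p q P" "p < 0 \<or> q < 0"
  shows "P = 0"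
proof -
  obtain D G where D: "finite D" "P = (\<Sum>d\<in>D. G d)"
    "\<And>d. d \<in> D \<Longrightarrow> fst d \<ge> 0 \<and> snd d \<ge> 0 \<and> bh (fst d) (snd d) (G d)"
    by (rule bh_decomp[of P]) (rule that)
  then have "P = (if (p,q) \<in> D then G (p,q) else 0)"
    using assms by (intro bh_component) auto
  moreover have "(p,q) \<notin> D" using D(3)[of "(p,q)"] assms(2) by auto
  ultimately show ?thesis by simp
qed

text \<open>A joint Euler eigenvector has no component outside its own weight, so it is a
  combination of monomials of that degree; this links the monomial definition to
  \<open>bh\<close>.\<close>

lemma bihom_iff: "bihom p q f \<longleftrightarrow> (\<exists>P. f = eval P \<and> bh (int p) (int q) P)"
proof
  assume "bihom p q f"
  then obtain S c where S: "finite S" "\<forall>(\<alpha>,\<beta>)\<in>S. sum \<alpha> UNIV = p \<and> sum \<beta> UNIV = q"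
    "f = (\<lambda>x u. \<Sum>(\<alpha>,\<beta>)\<in>S. c (\<alpha>,\<beta>) * monom \<alpha> \<beta> x u)" unfolding bihom_def by blast
  have "bh (int p) (int q) (\<Sum>t\<in>S. cst (c t) * mon (fst t) (snd t))"
  proof (intro bh_sum bh_linear(5))
    fix s assume "s \<in> S"
    then show "bh (int p) (int q) (mon (fst s) (snd s))" using bh_mon[of "fst s" "snd s"] S(2) by auto
  qed
  moreover have "f = eval (\<Sum>t\<in>S. cst (c t) * mon (fst t) (snd t))"
    unfolding S(3) by (simp add: fun_eq_iff split_def)
  ultimately show "\<exists>P. f = eval P \<and> bh (int p) (int q) P" by blast
next
  assume "\<exists>P. f = eval P \<and> bh (int p) (int q) P"
  then obtain P where P: "f = eval P" "bh (int p) (int q) P" by blast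
  obtain D G where D: "finite D" "P = (\<Sum>d\<in>D. G d)"
    "\<And>d. d \<in> D \<Longrightarrow> fst d \<ge> 0 \<and> snd d \<ge> 0 \<and> bh (fst d) (snd d) (G d)"
    "\<And>p q. bh p q P \<Longrightarrow> bihom (nat p) (nat q) (eval (if (p,q) \<in> D then G (p,q) else 0))"
    by (rule bh_decomp[of P]) (rule that)
  have "P = (if (int p, int q) \<in> D then G (int p, int q) else 0)"
    using D(3) P(2) by (intro bh_component[OF D(1,2)]) auto
  then show "bihom p q f" using D(4)[OF P(2)] P(1) by simp
qed

definition dh :: "'n::finite dpoly \<Rightarrow> bool" where
  "dh P \<longleftrightarrow> lapX P = 0 \<and> lapU P = 0"

lemma dh_linear:
  "dh 0"
  "dh P \<Longrightarrow> dh Q \<Longrightarrow> dh (P + Q)"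
  "dh P \<Longrightarrow> dh Q \<Longrightarrow> dh (P - Q)"
  "dh P \<Longrightarrow> dh (r *\<^sub>R P)"
  "dh P \<Longrightarrow> dh (cst c * P)"
  by (simp_all add: dh_def)

lemma dh_sum: "(\<And>s. s \<in> S \<Longrightarrow> dh (f s)) \<Longrightarrow> dh (sum f S)"
  by (induction S rule: infinite_finite_induct) (auto intro: dh_linear)

text \<open>A Laplacian shifts all weights by the same amount, so the images of the components still
  have distinct weights and must vanish one by one.\<close>

lemma dh_decomp:
  assumes "dh P"
  obtains D :: "(int \<times> int) set" and G where "finite D" "P = (\<Sum>d\<in>D. G d)"
    "\<And>d. d \<in> D \<Longrightarrow> fst d \<ge> 0 \<and> snd d \<ge> 0 \<and> bh (fst d) (snd d) (G d) \<and> dh (G d)"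
proof -
  obtain D G where D: "finite D" "P = (\<Sum>d\<in>D. G d)"
    "\<And>d. d \<in> D \<Longrightarrow> fst d \<ge> 0 \<and> snd d \<ge> 0 \<and> bh (fst d) (snd d) (G d)"
    by (rule bh_decomp[of P]) (rule that)
  have "\<forall>d\<in>D. lapX (G d) = 0"
    using D bh_ops(4)[OF D(3)[THEN conjunct2, THEN conjunct2]] assms
    by (intro bh_independent[where w = "\<lambda>d. (fst d - 2, snd d)"]) (auto simp: inj_on_def dh_def op_sum)
  moreover have "\<forall>d\<in>D. lapU (G d) = 0"
    using D bh_ops(5)[OF D(3)[THEN conjunct2, THEN conjunct2]] assms
    by (intro bh_independent[where w = "\<lambda>d. (fst d, snd d - 2)"]) (auto simp: inj_on_def dh_def op_sum)
  ultimately show ?thesis using D that[of D G] by (simp add: dh_def)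
qed

text \<open>On polynomials the Euler operator has only nonnegative eigenvalues, so adding a positive
  constant makes it injective.\<close>

lemma eulX_inject:
  assumes "eulX P + c *\<^sub>R P = 0" "c > 0"
  shows "P = 0"
proof -
  obtain D G where D: "finite D" "P = (\<Sum>d\<in>D. G d)"
    "\<And>d. d \<in> D \<Longrightarrow> fst d \<ge> 0 \<and> snd d \<ge> 0 \<and> bh (fst d) (snd d) (G d)"
    by (rule bh_decomp[of P]) (rule that)
  have "(\<Sum>d\<in>D. (of_int (fst d) + c) *\<^sub>R G d) = eulX P + c *\<^sub>R P"
    unfolding D(2) op_sum scaleR_sum_right sum.distrib[symmetric]
    using D(3) by (intro sum.cong) (auto simp: bh_def algebra_simps)
  then have "\<forall>d\<in>D. (of_int (fst d) + c) *\<^sub>R G d = 0"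
    using D assms by (intro bh_independent[where w = id]) (auto intro: bh_linear)
  moreover have "of_int (fst d) + c \<noteq> 0" if "d \<in> D" for d using D(3)[OF that] assms(2)
    by (smt (verit) of_int_nonneg)
  ultimately show ?thesis unfolding D(2) by (intro sum.neutral) auto
qed

lemma eulU_inject:
  assumes "eulU P + c *\<^sub>R P = 0" "c > 0"
  shows "P = 0"
proof -
  obtain D G where D: "finite D" "P = (\<Sum>d\<in>D. G d)"
    "\<And>d. d \<in> D \<Longrightarrow> fst d \<ge> 0 \<and> snd d \<ge> 0 \<and> bh (fst d) (snd d) (G d)"
    by (rule bh_decomp[of P]) (rule that)
  have "(\<Sum>d\<in>D. (of_int (snd d) + c) *\<^sub>R G d) = eulU P + c *\<^sub>R P"
    unfolding D(2) op_sum scaleR_sum_right sum.distrib[symmetric]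
    using D(3) by (intro sum.cong) (auto simp: bh_def algebra_simps)
  then have "\<forall>d\<in>D. (of_int (snd d) + c) *\<^sub>R G d = 0"
    using D assms by (intro bh_independent[where w = id]) (auto intro: bh_linear)
  moreover have "of_int (snd d) + c \<noteq> 0" if "d \<in> D" for d using D(3)[OF that] assms(2)
    by (smt (verit) of_int_nonneg)
  ultimately show ?thesis unfolding D(2) by (intro sum.neutral) auto
qed

section \<open>The harmonic part of a polynomial\<close>

lemma eul_pow:
  "eulX (nx ^ a * P) = nx ^ a * eulX P + (2 * real a) *\<^sub>R (nx ^ a * P)"
  "eulU (nu ^ a * P) = nu ^ a * eulU P + (2 * real a) *\<^sub>R (nu ^ a * P)"
  by (induction a) (simp_all add: op_mult_quad mult.assoc distrib_left scaleR_add_left add_ac)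

text \<open>Each of the a + 1 factors \<open>nx\<close> contributes 4E + 2m, evaluated at a degree
  already raised by 2s, for s = 0, ..., a; these contributions add up to (a + 1)(4E + 2m +
  4a).\<close>

lemma lapX_pow:
  fixes P :: "'n::finite dpoly"
  assumes "lapX P = 0"
  shows "lapX (nx ^ Suc a * P) = nx ^ a * ((4 * real (Suc a)) *\<^sub>R eulX P + (real (Suc a) * (2 * real CARD('n) + 4 * real a)) *\<^sub>R P)"
proof (induction a)
  case 0
  then show ?case using assms by (simp add: lap_mult_nx)
next
  case (Suc a)
  have *: "4 * real (Suc (Suc a)) = 4 * real (Suc a) + 4"
    "real (Suc (Suc a)) * (2 * real CARD('n) + 4 * real (Suc a))
     = real (Suc a) * (2 * real CARD('n) + 4 * real a) + 4 * (2 * real (Suc a)) + 2 * real CARD('n)"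
    by (simp_all add: algebra_simps)
  have "lapX (nx ^ Suc (Suc a) * P) = nx * lapX (nx ^ Suc a * P) + 4 *\<^sub>R eulX (nx ^ Suc a * P) + (2 * real CARD('n)) *\<^sub>R (nx ^ Suc a * P)"
    using lap_mult_nx(1)[of "nx ^ Suc a * P"] by (simp add: mult.assoc)
  then show ?case
    unfolding Suc eul_pow *
    by (simp only: power_Suc mult.assoc distrib_left mult_scaleR_right scaleR_add_right scaleR_scaleR scaleR_add_left add_ac)
qed

lemma lapU_pow:
  fixes P :: "'n::finite dpoly"
  assumes "lapU P = 0"
  shows "lapU (nu ^ Suc a * P) = nu ^ a * ((4 * real (Suc a)) *\<^sub>R eulU P + (real (Suc a) * (2 * real CARD('n) + 4 * real a)) *\<^sub>R P)"
proof (induction a)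
  case 0
  then show ?case using assms by (simp add: lap_mult_nu)
next
  case (Suc a)
  have *: "4 * real (Suc (Suc a)) = 4 * real (Suc a) + 4"
    "real (Suc (Suc a)) * (2 * real CARD('n) + 4 * real (Suc a))
     = real (Suc a) * (2 * real CARD('n) + 4 * real a) + 4 * (2 * real (Suc a)) + 2 * real CARD('n)"
    by (simp_all add: algebra_simps)
  have "lapU (nu ^ Suc (Suc a) * P) = nu * lapU (nu ^ Suc a * P) + 4 *\<^sub>R eulU (nu ^ Suc a * P) + (2 * real CARD('n)) *\<^sub>R (nu ^ Suc a * P)"
    using lap_mult_nu(1)[of "nu ^ Suc a * P"] by (simp add: mult.assoc)
  then show ?case
    unfolding Suc eul_pow *
    by (simp only: power_Suc mult.assoc distrib_left mult_scaleR_right scaleR_add_right scaleR_scaleR scaleR_add_left add_ac)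
qed

lemma lap_pow_other: "lapU (nx ^ a * P) = nx ^ a * lapU P" "lapX (nu ^ a * P) = nu ^ a * lapX P"
  by (induction a) (simp_all add: lap_mult_nx lap_mult_nu mult.assoc)

text \<open>Uniqueness of the Fischer decomposition in x. The Laplacian shortens the relation: the
  coefficient at \<open>nx ^ a\<close> becomes a positive multiple of E + c applied to
  \<open>G (Suc a)\<close>, with c > 0. It is again harmonic, so it vanishes by induction, and
  \<open>eulX_inject\<close> gives \<open>G (Suc a) = 0\<close>.\<close>

lemma nx_independent:
  fixes G :: "nat \<Rightarrow> 'n::finite dpoly"
  assumes "(\<Sum>a\<le>N. nx ^ a * G a) = 0" "\<And>a. lapX (G a) = 0" "a \<le> N"
  shows "G a = 0"
  using assms
proof (induction N arbitrary: G a)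
  case (Suc N)
  define G' where "G' a = (4 * real (Suc a)) *\<^sub>R eulX (G (Suc a)) + (real (Suc a) * (2 * real CARD('n) + 4 * real a)) *\<^sub>R G (Suc a)" for a
  have "0 = lapX (\<Sum>a\<le>Suc N. nx ^ a * G a)" using Suc.prems by simp
  also have "\<dots> = (\<Sum>a\<le>N. nx ^ a * G' a)"
    unfolding sum.atMost_Suc_shift op_add op_sum G'_def lapX_pow[OF Suc.prems(2)] using Suc.prems(2) by simp
  finally have "(\<Sum>a\<le>N. nx ^ a * G' a) = 0" by simp
  moreover have "lapX (G' a) = 0" for a by (simp add: G'_def op_commute_lap Suc.prems)
  ultimately have G': "G' a = 0" if "a \<le> N" for a using Suc.IH that by blast
  have G: "G (Suc a) = 0" if "a \<le> N" for a
  proof -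
    have "(4 * real (Suc a)) *\<^sub>R (eulX (G (Suc a)) + ((2 * real CARD('n) + 4 * real a) / 4) *\<^sub>R G (Suc a)) = G' a"
      by (simp add: G'_def scaleR_add_right)
    then have "eulX (G (Suc a)) + ((2 * real CARD('n) + 4 * real a) / 4) *\<^sub>R G (Suc a) = 0"
      unfolding G'[OF that] by (simp only: scaleR_eq_0_iff) simp
    then show ?thesis by (rule eulX_inject) (simp add: add_pos_nonneg)
  qed
  have "G 0 = 0" using Suc.prems(1) unfolding sum.atMost_Suc_shift using G by simp
  with G Suc.prems(3) show ?case by (cases a) auto
qed simp

lemma nu_independent:
  fixes G :: "nat \<Rightarrow> 'n::finite dpoly"
  assumes "(\<Sum>a\<le>N. nu ^ a * G a) = 0" "\<And>a. lapU (G a) = 0" "a \<le> N"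
  shows "G a = 0"
  using assms
proof (induction N arbitrary: G a)
  case (Suc N)
  define G' where "G' a = (4 * real (Suc a)) *\<^sub>R eulU (G (Suc a)) + (real (Suc a) * (2 * real CARD('n) + 4 * real a)) *\<^sub>R G (Suc a)" for a
  have "0 = lapU (\<Sum>a\<le>Suc N. nu ^ a * G a)" using Suc.prems by simp
  also have "\<dots> = (\<Sum>a\<le>N. nu ^ a * G' a)"
    unfolding sum.atMost_Suc_shift op_add op_sum G'_def lapU_pow[OF Suc.prems(2)] using Suc.prems(2) by simp
  finally have "(\<Sum>a\<le>N. nu ^ a * G' a) = 0" by simp
  moreover have "lapU (G' a) = 0" for a by (simp add: G'_def op_commute_lap Suc.prems)
  ultimately have G': "G' a = 0" if "a \<le> N" for a using Suc.IH that by blast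
  have G: "G (Suc a) = 0" if "a \<le> N" for a
  proof -
    have "(4 * real (Suc a)) *\<^sub>R (eulU (G (Suc a)) + ((2 * real CARD('n) + 4 * real a) / 4) *\<^sub>R G (Suc a)) = G' a"
      by (simp add: G'_def scaleR_add_right)
    then have "eulU (G (Suc a)) + ((2 * real CARD('n) + 4 * real a) / 4) *\<^sub>R G (Suc a) = 0"
      unfolding G'[OF that] by (simp only: scaleR_eq_0_iff) simp
    then show ?thesis by (rule eulU_inject) (simp add: add_pos_nonneg)
  qed
  have "G 0 = 0" using Suc.prems(1) unfolding sum.atMost_Suc_shift using G by simp
  with G Suc.prems(3) show ?case by (cases a) auto
qed simp

text \<open>The coefficients vanish off $F$, so that $F$ can be enlarged freely and the coefficient family is unique.\<close>

definition expands :: "'n::finite dpoly \<Rightarrow> (nat \<times> nat) set \<Rightarrow> (nat \<times> nat \<Rightarrow> 'n dpoly) \<Rightarrow> bool" where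
  "expands P F Hf \<longleftrightarrow> finite F \<and> (\<forall>t. dh (Hf t)) \<and> (\<forall>t. t \<notin> F \<longrightarrow> Hf t = 0)
     \<and> P = (\<Sum>(a,b)\<in>F. nx ^ a * nu ^ b * Hf (a,b))"

lemma expands_superset: "expands P F Hf \<Longrightarrow> finite F' \<Longrightarrow> F \<subseteq> F' \<Longrightarrow> expands P F' Hf"
  unfolding expands_def by (auto intro!: sum.mono_neutral_left) blast

text \<open>The variables are treated one after the other: multiplication by \<open>nu\<close>
  commutes with the Laplacian in x, so for each a the inner sum over b is harmonic in x and
  \<open>nx_independent\<close> isolates it; \<open>nu_independent\<close> then separates its
  terms.\<close>

lemma expands_unique:
  assumes "expands P F Hf" "expands P F' Hf'"
  shows "Hf = Hf'"
proof -
  have "finite (F \<union> F')" using assms by (simp add: expands_def)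
  then have "finite (fst ` (F \<union> F') \<union> snd ` (F \<union> F'))" by blast
  then obtain N where N: "\<And>t. t \<in> fst ` (F \<union> F') \<union> snd ` (F \<union> F') \<Longrightarrow> t \<le> N"
    by (meson finite_nat_set_iff_bounded_le)
  then have sub: "F \<subseteq> {..N} \<times> {..N}" "F' \<subseteq> {..N} \<times> {..N}" by force+
  define D where "D a b = Hf (a,b) - Hf' (a,b)" for a b
  have e: "expands P ({..N} \<times> {..N}) Hf" "expands P ({..N} \<times> {..N}) Hf'"
    using assms sub by (auto intro: expands_superset)
  have "(\<Sum>(a,b)\<in>{..N}\<times>{..N}. nx ^ a * nu ^ b * Hf (a,b)) = (\<Sum>(a,b)\<in>{..N}\<times>{..N}. nx ^ a * nu ^ b * Hf' (a,b))"
    using e unfolding expands_def by metis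
  then have "(\<Sum>(a,b)\<in>{..N}\<times>{..N}. nx ^ a * nu ^ b * D a b) = 0"
    by (simp add: D_def split_def right_diff_distrib sum_subtractf)
  then have s: "(\<Sum>a\<le>N. nx ^ a * (\<Sum>b\<le>N. nu ^ b * D a b)) = 0"
    by (simp add: sum.cartesian_product sum_distrib_left mult.assoc)
  have dh: "dh (D a b)" for a b using assms unfolding D_def expands_def by (simp add: dh_linear)
  have i: "(\<Sum>b\<le>N. nu ^ b * D a b) = 0" if "a \<le> N" for a
    using dh by (intro nx_independent[OF s _ that]) (simp add: op_sum lap_pow_other dh_def)
  have "D a b = 0" if "a \<le> N" "b \<le> N" for a b
    using dh by (intro nu_independent[OF i _ that(2)] that) (simp add: dh_def)
  then have "Hf t = Hf' t" if "t \<in> {..N} \<times> {..N}" for t using that by (cases t) (auto simp: D_def)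
  moreover have "Hf t = Hf' t" if "t \<notin> {..N} \<times> {..N}" for t using that e unfolding expands_def by metis
  ultimately show ?thesis by blast
qed

definition hpart :: "'n::finite dpoly \<Rightarrow> 'n dpoly \<Rightarrow> bool" where
  "hpart P H \<longleftrightarrow> (\<exists>F Hf. expands P F Hf \<and> H = Hf (0,0))"

lemma hpart_unique: "hpart P H \<Longrightarrow> hpart P H' \<Longrightarrow> H = H'"
  unfolding hpart_def using expands_unique by metis

lemma hpart_dh: "dh H \<Longrightarrow> hpart H H"
  unfolding hpart_def expands_def
  by (intro exI[of _ "{(0,0)}"] exI[of _ "\<lambda>t. if t = (0,0) then H else 0"]) (auto simp: dh_linear)

lemma hpart_add:
  assumes "hpart P H" "hpart Q K"
  shows "hpart (P + Q) (H + K)"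
proof -
  obtain F Hf F' Hf' where e: "expands P F Hf" "H = Hf (0,0)" "expands Q F' Hf'" "K = Hf' (0,0)"
    using assms unfolding hpart_def by blast
  have "expands P (F \<union> F') Hf" "expands Q (F \<union> F') Hf'"
    using expands_superset[OF e(1), of "F \<union> F'"] expands_superset[OF e(3), of "F \<union> F'"] e
    unfolding expands_def[of P F] expands_def[of Q F'] by blast+
  then have "expands (P + Q) (F \<union> F') (\<lambda>t. Hf t + Hf' t)"
    unfolding expands_def by (simp add: dh_linear sum.distrib split_def distrib_left)
  with e show ?thesis unfolding hpart_def by blast
qed

lemma hpart_cst:
  assumes "hpart P H"
  shows "hpart (cst c * P) (cst c * H)"
proof -
  obtain F Hf where e: "expands P F Hf" "H = Hf (0,0)"
    using assms unfolding hpart_def by blast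
  then have "expands (cst c * P) F (\<lambda>t. cst c * Hf t)"
    unfolding expands_def by (auto simp: dh_linear sum_distrib_left split_def mult_ac)
  with e show ?thesis unfolding hpart_def by blast
qed

lemma hpart_scaleR: "hpart P H \<Longrightarrow> hpart (r *\<^sub>R P) (r *\<^sub>R H)"
  unfolding scaleR_conv_cst by (rule hpart_cst)

text \<open>Multiplication by \<open>nx\<close> shifts the expansion by one in the first index and
  so empties position (0,0). This is how correction terms disappear when harmonic parts are
  compared.\<close>

lemma hpart_nx:
  assumes "hpart P H"
  shows "hpart (nx * P) 0"
proof -
  obtain F Hf where e: "expands P F Hf" "H = Hf (0,0)"
    using assms unfolding hpart_def by blast
  \<comment> \<open>Truncated subtraction would send index 0 to 0, so row 0 is set to zero
    explicitly.\<close>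
  define Hf' where "Hf' t = (if fst t = 0 then 0 else Hf (fst t - 1, snd t))" for t
  have "(\<Sum>(a,b)\<in>(\<lambda>(a,b). (Suc a, b)) ` F. nx ^ a * nu ^ b * Hf' (a,b)) = (\<Sum>(a,b)\<in>F. nx ^ Suc a * nu ^ b * Hf (a,b))"
    by (subst sum.reindex) (auto simp: inj_on_def Hf'_def split_def)
  moreover have "dh (Hf' t)" for t using e by (simp add: Hf'_def expands_def dh_linear)
  moreover have "Hf' t = 0" if "t \<notin> (\<lambda>(a,b). (Suc a, b)) ` F" for t
  proof (cases t)
    case (Pair a b)
    then show ?thesis using e that by (cases a) (force simp: Hf'_def expands_def)+
  qed
  ultimately have "expands (nx * P) ((\<lambda>(a,b). (Suc a, b)) ` F) Hf'"
    using e unfolding expands_def by (auto simp: sum_distrib_left split_def mult_ac)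
  then show ?thesis unfolding hpart_def by (metis Hf'_def fst_conv)
qed

lemma hpart_nu:
  assumes "hpart P H"
  shows "hpart (nu * P) 0"
proof -
  obtain F Hf where e: "expands P F Hf" "H = Hf (0,0)"
    using assms unfolding hpart_def by blast
  define Hf' where "Hf' t = (if snd t = 0 then 0 else Hf (fst t, snd t - 1))" for t
  have "(\<Sum>(a,b)\<in>(\<lambda>(a,b). (a, Suc b)) ` F. nx ^ a * nu ^ b * Hf' (a,b)) = (\<Sum>(a,b)\<in>F. nx ^ a * nu ^ Suc b * Hf (a,b))"
    by (subst sum.reindex) (auto simp: inj_on_def Hf'_def split_def)
  moreover have "dh (Hf' t)" for t using e by (simp add: Hf'_def expands_def dh_linear)
  moreover have "Hf' t = 0" if "t \<notin> (\<lambda>(a,b). (a, Suc b)) ` F" for t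
  proof (cases t)
    case (Pair a b)
    then show ?thesis using e that by (cases b) (force simp: Hf'_def expands_def)+
  qed
  ultimately have "expands (nu * P) ((\<lambda>(a,b). (a, Suc b)) ` F) Hf'"
    using e unfolding expands_def by (auto simp: sum_distrib_left split_def mult_ac)
  then show ?thesis unfolding hpart_def by (metis Hf'_def snd_conv)
qed

section \<open>Relations in the transvector algebra\<close>

lemma hpart_imp_dh: "hpart P H \<Longrightarrow> dh H"
  unfolding hpart_def expands_def by blast

definition pis :: "'n::finite dpoly \<Rightarrow> 'n dpoly" where "pis P = (THE H. hpart P H)"

lemma pis_eq: "hpart P H \<Longrightarrow> pis P = H"
  unfolding pis_def using hpart_unique by (intro the_equality) auto

definition SX :: "'n::finite dpoly \<Rightarrow> 'n dpoly" where "SX P = pis (xdU P)"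
definition SU :: "'n::finite dpoly \<Rightarrow> 'n dpoly" where "SU P = pis (udX P)"
definition AA :: "'n::finite dpoly \<Rightarrow> 'n dpoly" where "AA P = pis (dUX P)"
definition CC :: "'n::finite dpoly \<Rightarrow> 'n dpoly" where "CC P = pis (ip * P)"

text \<open>The contraction commutes with both Laplacians; hence A is \<open>dUX\<close> itself,
  without a correction term.\<close>

lemma dh_dUX: "dh P \<Longrightarrow> dh (dUX P)"
  by (simp add: dh_def lap_commute)

lemma hpart_dUX: "dh P \<Longrightarrow> hpart (dUX P) (dUX P)"
  by (intro hpart_dh dh_dUX)

lemma AA_eq: "dh P \<Longrightarrow> AA P = dUX P"
  unfolding AA_def by (intro pis_eq hpart_dUX)

definition DH :: "int \<Rightarrow> int \<Rightarrow> 'n::finite dpoly \<Rightarrow> bool" where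
  "DH p q P \<longleftrightarrow> dh P \<and> bh p q P"

lemma DH_dh: "DH p q P \<Longrightarrow> dh P"
  by (simp add: DH_def)

lemma DH_linear:
  "DH p q 0"
  "DH p q P \<Longrightarrow> DH p q Q \<Longrightarrow> DH p q (P + Q)"
  "DH p q P \<Longrightarrow> DH p q Q \<Longrightarrow> DH p q (P - Q)"
  "DH p q P \<Longrightarrow> DH p q (r *\<^sub>R P)"
  "DH p q P \<Longrightarrow> DH p q (cst c * P)"
  by (simp_all add: DH_def dh_linear bh_linear)

lemma DH_dUX: "DH p q P \<Longrightarrow> DH (p - 1) (q - 1) (dUX P)"
  by (simp add: DH_def dh_dUX bh_ops)

lemma DH_eigen:
  assumes "DH p q P"
  shows "lapX P = 0" "lapU P = 0" "eulX P = of_int p *\<^sub>R P" "eulU P = of_int q *\<^sub>R P"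
    "eulX (udX P) = (of_int p - 1) *\<^sub>R udX P" "eulU (xdU P) = (of_int q - 1) *\<^sub>R xdU P"
    "eulX (dUX P) = (of_int p - 1) *\<^sub>R dUX P" "eulU (dUX P) = (of_int q - 1) *\<^sub>R dUX P"
  using assms bh_ops(1-3)[of p q P] by (simp_all add: DH_def dh_def bh_def)

section \<open>Explicit projections and the relations between the generators\<close>

locale dim_gt_4 =
  fixes dummy :: "'n::finite itself"
  assumes dim: "CARD('n) > 4"
begin

text \<open>If $Q$ is harmonic in $x$ of $x$-degree $p - 1$, then $\Delta_x(|x|^2 Q) = 2\,\mathrm{cf}(p)\,Q$; so $\mathrm{cf}(p)$ and
  $\mathrm{cf}(q)$ are the $a$ and $b$ above.\<close>

definition cf :: "int \<Rightarrow> real" where "cf p = 2 * of_int p - 2 + real CARD('n)"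

lemma cf_pos: "p \<ge> 0 \<Longrightarrow> cf p > 0"
proof -
  assume "p \<ge> 0"
  then have "real_of_int p \<ge> 0" by simp
  then show ?thesis using dim by (simp add: cf_def)
qed

text \<open>The Laplacian in u sends \<open>udX P\<close> to twice \<open>dUX P\<close>, and
  \<open>nu * dUX P\<close> to 2 \<open>cf q\<close> times \<open>dUX P\<close>, because
  \<open>dUX P\<close> has degree q - 1 in u. The coefficient 1 / \<open>cf q\<close> balances the
  two.\<close>

lemma SU_explicit:
  fixes P :: "'n dpoly"
  assumes "DH p q P"
  shows "hpart (udX P) (udX P - (1 / cf q) *\<^sub>R (nu * dUX P))"
    "SU P = udX P - (1 / cf q) *\<^sub>R (nu * dUX P)" "DH (p - 1) (q + 1) (SU P)"
proof -
  let ?H = "udX P - (1 / cf q) *\<^sub>R (nu * dUX P)"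
  note e = DH_eigen[OF assms]
  have "lapU (nu * dUX P) = (2 * cf q) *\<^sub>R dUX P"
    by (simp add: lap_mult_nu lap_commute e cf_def flip: scaleR_add_left)
  \<comment> \<open>\<open>cf q\<close> can vanish only for negative q, where P = 0, so the division
    by zero is harmless.\<close>
  moreover have "dUX P = 0" if "cf q = 0"
    using bh_negative[of p q P] assms cf_pos[of q] that by (force simp: DH_def)
  ultimately have "dh ?H"
    by (auto simp: dh_def op_commute_lap lap_mult_nu lap_commute e)
  from hpart_add[OF hpart_dh[OF this] hpart_nu[OF hpart_scaleR[OF hpart_dUX, of P "1 / cf q"]]]
  show h: "hpart (udX P) ?H" using assms by (simp add: DH_def)
  then show s: "SU P = ?H" unfolding SU_def by (rule pis_eq)
  have "bh (p - 1) (q + 1) ?H"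
    using bh_ops(1)[of p q P] bh_ops(7)[OF bh_ops(3)[of p q P]] assms
    by (intro bh_linear) (simp_all add: DH_def algebra_simps)
  with \<open>dh ?H\<close> show "DH (p - 1) (q + 1) (SU P)" by (simp add: DH_def s)
qed

lemma SX_explicit:
  fixes P :: "'n dpoly"
  assumes "DH p q P"
  shows "hpart (xdU P) (xdU P - (1 / cf p) *\<^sub>R (nx * dUX P))"
    "SX P = xdU P - (1 / cf p) *\<^sub>R (nx * dUX P)" "DH (p + 1) (q - 1) (SX P)"
proof -
  let ?H = "xdU P - (1 / cf p) *\<^sub>R (nx * dUX P)"
  note e = DH_eigen[OF assms]
  have "lapX (nx * dUX P) = (2 * cf p) *\<^sub>R dUX P"
    by (simp add: lap_mult_nx lap_commute e cf_def flip: scaleR_add_left)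
  moreover have "dUX P = 0" if "cf p = 0"
    using bh_negative[of p q P] assms cf_pos[of p] that by (force simp: DH_def)
  ultimately have "dh ?H"
    by (auto simp: dh_def op_commute_lap lap_mult_nx lap_commute e)
  from hpart_add[OF hpart_dh[OF this] hpart_nx[OF hpart_scaleR[OF hpart_dUX, of P "1 / cf p"]]]
  show h: "hpart (xdU P) ?H" using assms by (simp add: DH_def)
  then show s: "SX P = ?H" unfolding SX_def by (rule pis_eq)
  have "bh (p + 1) (q - 1) ?H"
    using bh_ops(2)[of p q P] bh_ops(6)[OF bh_ops(3)[of p q P]] assms
    by (intro bh_linear) (simp_all add: DH_def algebra_simps)
  with \<open>dh ?H\<close> show "DH (p + 1) (q - 1) (SX P)" by (simp add: DH_def s)
qed


text \<open>\<open>H\<close> is the product of the truncated projections 1 - |x|^2 Lap_x / (2 cf p)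
  and 1 - |u|^2 Lap_u / (2 cf q), applied to \<open>ip * P\<close>: the Laplacians give twice
  \<open>udX P\<close> and twice \<open>xdU P\<close>, and both together four times
  \<open>dUX P\<close>.\<close>

lemma CC_explicit:
  fixes P :: "'n dpoly"
  assumes "DH p q P"
  defines "H \<equiv> ip * P - (1 / cf p) *\<^sub>R (nx * udX P) - (1 / cf q) *\<^sub>R (nu * xdU P)
    + (1 / (cf p * cf q)) *\<^sub>R (nx * (nu * dUX P))"
  shows "hpart (ip * P) H" "CC P = H" "DH (p + 1) (q + 1) (CC P)"
proof -
  note e = DH_eigen[OF assms(1)]
  have "P = 0 \<or> cf p \<noteq> 0 \<and> cf q \<noteq> 0"
    using bh_negative[of p q P] assms cf_pos[of p] cf_pos[of q] by (force simp: DH_def)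
  then have "dh H"
  proof
    assume nz: "cf p \<noteq> 0 \<and> cf q \<noteq> 0"
    have "lapX (nx * udX P) = (2 * cf p) *\<^sub>R udX P"
      by (simp add: lap_mult_nx op_commute_lap e cf_def flip: scaleR_add_left)
    moreover have "lapX (nx * (nu * dUX P)) = (2 * cf p) *\<^sub>R (nu * dUX P)"
      by (simp add: lap_mult_nx lap_mult_nu lap_commute op_mult_quad e cf_def flip: scaleR_add_left)
    ultimately have "lapX H = 0"
      using nz by (simp add: H_def lap_mult_ip lap_mult_nu op_commute_lap e)
    moreover have "lapU (nu * xdU P) = (2 * cf q) *\<^sub>R xdU P"
      by (simp add: lap_mult_nu op_commute_lap e cf_def flip: scaleR_add_left)
    moreover have "lapU (nu * dUX P) = (2 * cf q) *\<^sub>R dUX P"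
      by (simp add: lap_mult_nu lap_commute op_mult_quad e cf_def flip: scaleR_add_left)
    ultimately show "dh H"
      using nz by (simp add: H_def dh_def lap_mult_ip lap_mult_nx op_commute_lap e)
  qed (simp add: H_def dh_linear)
  have ex: "hpart (udX P) (SU P)" "hpart (xdU P) (SX P)" "hpart (dUX P) (dUX P)"
    using SU_explicit(1,2)[OF assms(1)] SX_explicit(1,2)[OF assms(1)] hpart_dUX[of P] assms(1) by (simp_all add: DH_def)
  \<comment> \<open>\<open>ip * P\<close> is \<open>H\<close> plus terms with a factor
    \<open>nx\<close> or \<open>nu\<close>. Their cofactors must merely have some harmonic part, so
    \<open>udX P\<close> and \<open>xdU P\<close> can stay unprojected.\<close>
  have "hpart (H + nx * ((1 / cf p) *\<^sub>R udX P) + nu * ((1 / cf q) *\<^sub>R xdU P) + nx * ((-1 / (cf p * cf q)) *\<^sub>R (nu * dUX P))) (H + 0 + 0 + 0)"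
    by (rule hpart_add hpart_nx hpart_nu hpart_scaleR ex hpart_dh[OF \<open>dh H\<close>])+
  then show h: "hpart (ip * P) H" by (simp add: H_def)
  then show s: "CC P = H" unfolding CC_def by (rule pis_eq)
  have "bh (p + 1) (q + 1) H"
    using bh_ops(8)[of p q P] bh_ops(6)[OF bh_ops(1)[of p q P]] bh_ops(7)[OF bh_ops(2)[of p q P]]
      bh_ops(6)[OF bh_ops(7)[OF bh_ops(3)[of p q P]]] assms(1)
    unfolding H_def by (intro bh_linear) (simp_all add: DH_def algebra_simps)
  with \<open>dh H\<close> show "DH (p + 1) (q + 1) (CC P)" by (simp add: DH_def s)
qed

lemma hpart_ops_bh:
  fixes P :: "'n dpoly"
  assumes "DH p q P"
  shows "hpart (udX P) (SU P)" "hpart (xdU P) (SX P)" "hpart (dUX P) (dUX P)" "hpart (ip * P) (CC P)"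
  using SU_explicit(1,2)[OF assms] SX_explicit(1,2)[OF assms] CC_explicit(1,2)[OF assms] hpart_dUX[of P] assms
  by (simp_all add: DH_def)

text \<open>The expansion of \<open>ip * P\<close> comes in three forms: two leave one first-order
  cofactor unprojected, the last projects both. Each relation below uses the form that leaves only
  known harmonic parts.\<close>

lemma expand_ops:
  fixes P :: "'n dpoly"
  assumes "DH p q P"
  shows "udX P = SU P + (1 / cf q) *\<^sub>R (nu * dUX P)" "xdU P = SX P + (1 / cf p) *\<^sub>R (nx * dUX P)"
    "ip * P = CC P + (1 / cf p) *\<^sub>R (nx * SU P) + (1 / cf q) *\<^sub>R (nu * xdU P)"
    "ip * P = CC P + (1 / cf q) *\<^sub>R (nu * SX P) + (1 / cf p) *\<^sub>R (nx * udX P)"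
    "ip * P = CC P + (1 / cf p) *\<^sub>R (nx * SU P) + (1 / cf q) *\<^sub>R (nu * SX P)
      + (1 / (cf p * cf q)) *\<^sub>R (nx * (nu * dUX P))"
  unfolding SU_explicit(2)[OF assms] SX_explicit(2)[OF assms] CC_explicit(2)[OF assms]
  by (simp_all add: algebra_simps)

text \<open>The harmonic part of \<open>udX (ip * P)\<close> is computed twice. If
  \<open>ip * P\<close> is expanded first, \<open>udX\<close> turns the factor \<open>nx\<close> in
  front of \<open>SU P\<close> into twice \<open>ip\<close>, which adds (2 / cf p) C S_u P to S_u C
  P. If \<open>udX\<close> is moved past \<open>ip\<close> first, the result is C S_u P, since the
  extra term \<open>nu * P\<close> has harmonic part zero.\<close>

lemma SU_CC:
  fixes P :: "'n dpoly"
  assumes P: "DH p q P"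
  shows "SU (CC P) = (1 - 2 / cf p) *\<^sub>R CC (SU P)"
proof -
  note S = SU_explicit(3)[OF P] and X = SX_explicit(3)[OF P] and C = CC_explicit(3)[OF P] and A = DH_dUX[OF P]
  have "hpart (udX (CC P) + nx * ((1 / cf p) *\<^sub>R udX (SU P)) + (2 / cf p) *\<^sub>R (ip * SU P)
      + nu * ((1 / cf q) *\<^sub>R (udX (SX P) + nx * ((1 / cf p) *\<^sub>R udX (dUX P)) + (2 / cf p) *\<^sub>R (ip * dUX P))))
    (SU (CC P) + 0 + (2 / cf p) *\<^sub>R CC (SU P) + 0)"
    by (rule hpart_add hpart_nx hpart_nu hpart_scaleR hpart_ops_bh(1)[OF C] hpart_ops_bh(1)[OF S] hpart_ops_bh(4)[OF S]
      hpart_ops_bh(1)[OF X] hpart_ops_bh(1)[OF A] hpart_ops_bh(4)[OF A])+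
  also have "udX (CC P) + nx * ((1 / cf p) *\<^sub>R udX (SU P)) + (2 / cf p) *\<^sub>R (ip * SU P)
      + nu * ((1 / cf q) *\<^sub>R (udX (SX P) + nx * ((1 / cf p) *\<^sub>R udX (dUX P)) + (2 / cf p) *\<^sub>R (ip * dUX P)))
      = udX (CC P + (1 / cf p) *\<^sub>R (nx * SU P) + (1 / cf q) *\<^sub>R (nu * (SX P + (1 / cf p) *\<^sub>R (nx * dUX P))))"
    by (simp add: op_mult_quad algebra_simps)
  also have "\<dots> = udX (ip * P)" unfolding expand_ops(2)[OF P, symmetric] expand_ops(3)[OF P, symmetric] ..
  finally have 1: "hpart (udX (ip * P)) (SU (CC P) + (2 / cf p) *\<^sub>R CC (SU P))" by simp
  have "hpart (ip * SU P + nu * ((1 / cf q) *\<^sub>R (ip * dUX P)) + nu * P) (CC (SU P) + 0 + 0)"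
    by (rule hpart_add hpart_nx hpart_nu hpart_scaleR hpart_ops_bh(4)[OF S] hpart_ops_bh(4)[OF A] hpart_dh[OF DH_dh[OF P]])+
  also have "ip * SU P + nu * ((1 / cf q) *\<^sub>R (ip * dUX P)) + nu * P = ip * (SU P + (1 / cf q) *\<^sub>R (nu * dUX P)) + nu * P"
    by (simp add: algebra_simps)
  also have "\<dots> = udX (ip * P)" unfolding expand_ops(1)[OF P, symmetric] op_mult_quad ..
  finally have "SU (CC P) + (2 / cf p) *\<^sub>R CC (SU P) = CC (SU P)" using hpart_unique[OF 1] by simp
  then show ?thesis by (simp add: scaleR_left_diff_distrib eq_diff_eq)
qed

lemma SX_CC:
  fixes P :: "'n dpoly"
  assumes P: "DH p q P"
  shows "SX (CC P) = (1 - 2 / cf q) *\<^sub>R CC (SX P)"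
proof -
  note S = SU_explicit(3)[OF P] and X = SX_explicit(3)[OF P] and C = CC_explicit(3)[OF P] and A = DH_dUX[OF P]
  have "hpart (xdU (CC P) + nu * ((1 / cf q) *\<^sub>R xdU (SX P)) + (2 / cf q) *\<^sub>R (ip * SX P)
      + nx * ((1 / cf p) *\<^sub>R (xdU (SU P) + nu * ((1 / cf q) *\<^sub>R xdU (dUX P)) + (2 / cf q) *\<^sub>R (ip * dUX P))))
    (SX (CC P) + 0 + (2 / cf q) *\<^sub>R CC (SX P) + 0)"
    by (rule hpart_add hpart_nx hpart_nu hpart_scaleR hpart_ops_bh(2)[OF C] hpart_ops_bh(2)[OF X] hpart_ops_bh(4)[OF X]
      hpart_ops_bh(2)[OF S] hpart_ops_bh(2)[OF A] hpart_ops_bh(4)[OF A])+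
  also have "xdU (CC P) + nu * ((1 / cf q) *\<^sub>R xdU (SX P)) + (2 / cf q) *\<^sub>R (ip * SX P)
      + nx * ((1 / cf p) *\<^sub>R (xdU (SU P) + nu * ((1 / cf q) *\<^sub>R xdU (dUX P)) + (2 / cf q) *\<^sub>R (ip * dUX P)))
      = xdU (CC P + (1 / cf q) *\<^sub>R (nu * SX P) + (1 / cf p) *\<^sub>R (nx * (SU P + (1 / cf q) *\<^sub>R (nu * dUX P))))"
    by (simp add: op_mult_quad algebra_simps)
  also have "\<dots> = xdU (ip * P)" unfolding expand_ops(1)[OF P, symmetric] expand_ops(4)[OF P, symmetric] ..
  finally have 1: "hpart (xdU (ip * P)) (SX (CC P) + (2 / cf q) *\<^sub>R CC (SX P))" by simp
  have "hpart (ip * SX P + nx * ((1 / cf p) *\<^sub>R (ip * dUX P)) + nx * P) (CC (SX P) + 0 + 0)"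
    by (rule hpart_add hpart_nx hpart_nu hpart_scaleR hpart_ops_bh(4)[OF X] hpart_ops_bh(4)[OF A] hpart_dh[OF DH_dh[OF P]])+
  also have "ip * SX P + nx * ((1 / cf p) *\<^sub>R (ip * dUX P)) + nx * P = ip * (SX P + (1 / cf p) *\<^sub>R (nx * dUX P)) + nx * P"
    by (simp add: algebra_simps)
  also have "\<dots> = xdU (ip * P)" unfolding expand_ops(2)[OF P, symmetric] op_mult_quad ..
  finally have "SX (CC P) + (2 / cf q) *\<^sub>R CC (SX P) = CC (SX P)" using hpart_unique[OF 1] by simp
  then show ?thesis by (simp add: scaleR_left_diff_distrib eq_diff_eq)
qed

text \<open>Modulo \<open>nx\<close> and \<open>nu\<close>, the contraction turns the corrections
  with factor \<open>nx\<close> and \<open>nu\<close> into 2 S_x S_u P and 2 S_u S_x P, and the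
  double correction into 4 C A P. Moving it past \<open>ip\<close> instead produces the Euler
  operators and the dimension.\<close>

lemma dUX_CC:
  fixes P :: "'n dpoly"
  assumes P: "DH p q P"
  shows "dUX (CC P) + (2 / cf p) *\<^sub>R SX (SU P) + (2 / cf q) *\<^sub>R SU (SX P) + (4 / (cf p * cf q)) *\<^sub>R CC (dUX P)
    = CC (dUX P) + (of_int (p + q) + real CARD('n)) *\<^sub>R P"
proof -
  note S = SU_explicit(3)[OF P] and X = SX_explicit(3)[OF P] and C = CC_explicit(3)[OF P] and A = DH_dUX[OF P]
  have "hpart (dUX (CC P) + (nx * ((1 / cf p) *\<^sub>R dUX (SU P)) + (2 / cf p) *\<^sub>R xdU (SU P))
      + (nu * ((1 / cf q) *\<^sub>R dUX (SX P)) + (2 / cf q) *\<^sub>R udX (SX P))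
      + (nx * ((1 / (cf p * cf q)) *\<^sub>R (nu * dUX (dUX P) + 2 *\<^sub>R udX (dUX P)))
        + (nu * ((2 / (cf p * cf q)) *\<^sub>R xdU (dUX P)) + (4 / (cf p * cf q)) *\<^sub>R (ip * dUX P))))
    (dUX (CC P) + (0 + (2 / cf p) *\<^sub>R SX (SU P)) + (0 + (2 / cf q) *\<^sub>R SU (SX P))
      + (0 + (0 + (4 / (cf p * cf q)) *\<^sub>R CC (dUX P))))"
    by (rule hpart_add hpart_nx hpart_nu hpart_scaleR hpart_ops_bh[OF C] hpart_ops_bh[OF S] hpart_ops_bh[OF X] hpart_ops_bh[OF A])+
  also have "dUX (CC P) + (nx * ((1 / cf p) *\<^sub>R dUX (SU P)) + (2 / cf p) *\<^sub>R xdU (SU P))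
      + (nu * ((1 / cf q) *\<^sub>R dUX (SX P)) + (2 / cf q) *\<^sub>R udX (SX P))
      + (nx * ((1 / (cf p * cf q)) *\<^sub>R (nu * dUX (dUX P) + 2 *\<^sub>R udX (dUX P)))
        + (nu * ((2 / (cf p * cf q)) *\<^sub>R xdU (dUX P)) + (4 / (cf p * cf q)) *\<^sub>R (ip * dUX P)))
      = dUX (CC P + (1 / cf p) *\<^sub>R (nx * SU P) + (1 / cf q) *\<^sub>R (nu * SX P)
      + (1 / (cf p * cf q)) *\<^sub>R (nx * (nu * dUX P)))"
    by (simp add: op_mult_quad lap_mult_nx lap_mult_nu algebra_simps)
  also have "\<dots> = dUX (ip * P)" unfolding expand_ops(5)[OF P, symmetric] ..
  also have "\<dots> = ip * dUX P + (of_int (p + q) + real CARD('n)) *\<^sub>R P"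
    by (simp add: lap_mult_ip DH_eigen[OF P] scaleR_add_left add.assoc)
  finally have 1: "hpart (ip * dUX P + (of_int (p + q) + real CARD('n)) *\<^sub>R P)
    (dUX (CC P) + (2 / cf p) *\<^sub>R SX (SU P) + (2 / cf q) *\<^sub>R SU (SX P) + (4 / (cf p * cf q)) *\<^sub>R CC (dUX P))"
    by (simp add: add.assoc)
  have "hpart (ip * dUX P + (of_int (p + q) + real CARD('n)) *\<^sub>R P) (CC (dUX P) + (of_int (p + q) + real CARD('n)) *\<^sub>R P)"
    using P by (intro hpart_add hpart_scaleR hpart_ops_bh(4)[OF A] hpart_dh) (simp add: DH_def)
  from hpart_unique[OF 1 this] show ?thesis .
qed

section \<open>Extension from bihomogeneous to arbitrary double harmonics\<close>

lemma hpart_sum: "(\<And>s. s \<in> S \<Longrightarrow> hpart (f s) (h s)) \<Longrightarrow> hpart (sum f S) (sum h S)"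
  by (induction S rule: infinite_finite_induct) (simp_all add: hpart_add hpart_dh dh_linear)

text \<open>The coefficients of the explicit formulas depend on the bidegree, so the harmonic parts
  for an inhomogeneous \<open>P\<close> are assembled from its components.\<close>

lemma hpart_ops:
  fixes P :: "'n dpoly"
  assumes "dh P"
  shows "hpart (udX P) (SU P)" "hpart (xdU P) (SX P)" "hpart (ip * P) (CC P)"
proof -
  obtain D G where D: "finite D" "P = (\<Sum>d\<in>D. G d)"
    "\<And>d. d \<in> D \<Longrightarrow> fst d \<ge> 0 \<and> snd d \<ge> 0 \<and> bh (fst d) (snd d) (G d) \<and> dh (G d)"
    by (rule dh_decomp[OF assms]) (rule that)
  have G: "DH (fst d) (snd d) (G d)" if "d \<in> D" for d using D(3)[OF that] by (simp add: DH_def)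
  have "hpart (udX P) (\<Sum>d\<in>D. SU (G d))" "hpart (xdU P) (\<Sum>d\<in>D. SX (G d))" "hpart (ip * P) (\<Sum>d\<in>D. CC (G d))"
    unfolding D(2) op_sum sum_distrib_left using hpart_ops_bh[OF G] by (simp_all add: hpart_sum)
  then show "hpart (udX P) (SU P)" "hpart (xdU P) (SX P)" "hpart (ip * P) (CC P)"
    unfolding SU_def SX_def CC_def using pis_eq by metis+
qed

lemma dh_S:
  fixes P :: "'n dpoly"
  assumes "dh P"
  shows "dh (SU P)" "dh (SX P)" "dh (CC P)"
  using hpart_ops[OF assms] hpart_imp_dh by blast+

lemma S_add:
  fixes P :: "'n dpoly"
  assumes "dh P" "dh Q"
  shows "SU (P + Q) = SU P + SU Q" "SX (P + Q) = SX P + SX Q" "CC (P + Q) = CC P + CC Q"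
  using hpart_add[OF hpart_ops(1)[OF assms(1)] hpart_ops(1)[OF assms(2)]]
    hpart_add[OF hpart_ops(2)[OF assms(1)] hpart_ops(2)[OF assms(2)]]
    hpart_add[OF hpart_ops(3)[OF assms(1)] hpart_ops(3)[OF assms(2)]]
  by (auto simp: SU_def[of "P + Q"] SX_def[of "P + Q"] CC_def[of "P + Q"] distrib_left intro: pis_eq)

lemma S_cst:
  fixes P :: "'n dpoly"
  assumes "dh P"
  shows "SU (cst c * P) = cst c * SU P" "SX (cst c * P) = cst c * SX P" "CC (cst c * P) = cst c * CC P"
  using hpart_ops[OF assms, THEN hpart_cst[of _ _ c]]
  by (auto simp: SU_def[of "cst c * P"] SX_def[of "cst c * P"] CC_def[of "cst c * P"] mult.left_commute intro: pis_eq)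

lemma S_scaleR:
  fixes P :: "'n dpoly"
  assumes "dh P"
  shows "SU (r *\<^sub>R P) = r *\<^sub>R SU P" "SX (r *\<^sub>R P) = r *\<^sub>R SX P" "CC (r *\<^sub>R P) = r *\<^sub>R CC P"
  unfolding scaleR_conv_cst by (rule S_cst[OF assms])+

lemma S_0: "SU (0 :: 'n dpoly) = 0" "SX (0 :: 'n dpoly) = 0" "CC (0 :: 'n dpoly) = 0"
  using S_scaleR[of 0 0] by (simp_all add: dh_linear)

end

section \<open>The modules $\mathbb{V}[k,l]$\<close>

text \<open>The kernel of $A$ in bidegree $(p,q)$, on which $S_u$ and $S_x$ need no correction terms.\<close>

definition HH :: "int \<Rightarrow> int \<Rightarrow> 'n::finite dpoly \<Rightarrow> bool" where
  "HH p q P \<longleftrightarrow> DH p q P \<and> dUX P = 0"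

definition SHH :: "nat \<Rightarrow> nat \<Rightarrow> 'n::finite dpoly \<Rightarrow> bool" where
  "SHH k l H \<longleftrightarrow> HH (int k) (int l) H \<and> xdU H = 0"

definition V :: "nat \<Rightarrow> nat \<Rightarrow> 'n::finite dpoly \<Rightarrow> 'n dpoly" where
  "V i j H = (CC ^^ i) ((SU ^^ j) H)"

lemma HH_linear:
  "HH p q 0"
  "HH p q P \<Longrightarrow> HH p q Q \<Longrightarrow> HH p q (P + Q)"
  "HH p q P \<Longrightarrow> HH p q Q \<Longrightarrow> HH p q (P - Q)"
  "HH p q P \<Longrightarrow> HH p q (r *\<^sub>R P)"
  "HH p q P \<Longrightarrow> HH p q (cst c * P)"
  by (simp_all add: HH_def DH_linear)

lemma SHH_linear:
  "SHH k l 0"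
  "SHH k l P \<Longrightarrow> SHH k l Q \<Longrightarrow> SHH k l (P + Q)"
  "SHH k l P \<Longrightarrow> SHH k l Q \<Longrightarrow> SHH k l (P - Q)"
  "SHH k l P \<Longrightarrow> SHH k l (r *\<^sub>R P)"
  "SHH k l P \<Longrightarrow> SHH k l (cst c * P)"
  by (simp_all add: SHH_def HH_linear)

lemma HH_udX: "HH p q P \<Longrightarrow> HH (p - 1) (q + 1) (udX P)"
  by (auto simp: HH_def DH_def bh_ops dh_def op_commute_lap op_commute_dUX)

lemma HH_xdU: "HH p q P \<Longrightarrow> HH (p + 1) (q - 1) (xdU P)"
  by (auto simp: HH_def DH_def bh_ops dh_def op_commute_lap op_commute_dUX)

lemma HH_udX_pow: "HH p q P \<Longrightarrow> HH (p - int j) (q + int j) ((udX ^^ j) P)"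
proof (induction j)
  case (Suc j)
  then show ?case using HH_udX[of "p - int j" "q + int j"] by (simp add: algebra_simps)
qed simp

text \<open>The weight differences p - q - 2s for s = 0, ..., j add up to (j + 1)(p - q - j).
  Assuming \<open>udX (xdU P) = 0\<close> covers both highest weight vectors and the
  \<open>P\<close> of \<open>HH_lowest\<close>, for which \<open>xdU P\<close> is not known to
  vanish.\<close>

lemma xdU_udX_pow:
  assumes "HH p q P" "udX (xdU P) = 0"
  shows "xdU ((udX ^^ Suc j) P) = ((real j + 1) * (of_int p - of_int q - real j)) *\<^sub>R (udX ^^ j) P"
proof (induction j)
  case 0
  then show ?case using assms DH_eigen[of p q P] by (simp add: op_commute_eul HH_def scaleR_diff_left)
next
  case (Suc j)
  let ?Q = "(udX ^^ Suc j) P"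
  have e: "eulX ?Q = of_int (p - int (Suc j)) *\<^sub>R ?Q" "eulU ?Q = of_int (q + int (Suc j)) *\<^sub>R ?Q"
    using HH_udX_pow[OF assms(1), of "Suc j"] unfolding HH_def DH_def bh_def by blast+
  have "xdU (udX ?Q) = udX (xdU ?Q) + eulX ?Q - eulU ?Q" by (rule op_commute_eul)
  also have "\<dots> = ((real j + 1) * (of_int p - of_int q - real j)) *\<^sub>R ?Q + of_int (p - int (Suc j)) *\<^sub>R ?Q - of_int (q + int (Suc j)) *\<^sub>R ?Q"
    unfolding e Suc by simp
  also have "\<dots> = ((real (Suc j) + 1) * (of_int p - of_int q - real (Suc j))) *\<^sub>R ?Q"
    unfolding scaleR_add_left[symmetric] scaleR_diff_left[symmetric] by (simp add: algebra_simps)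
  finally show ?case by simp
qed

text \<open>Otherwise all $\langle u,\partial_x\rangle^jP$ would be nonzero, since $\langle x,\partial_u\rangle$ leads back with nonzero
  factors; but they have negative degree in $x$ for $j > p$.\<close>

lemma HH_lowest:
  assumes "HH p q P" "udX (xdU P) = 0" "p < q"
  shows "P = 0"
proof -
  have step: "(udX ^^ j) P = 0" if "(udX ^^ Suc j) P = 0" for j
  proof -
    have "real_of_int p < real_of_int q" using assms(3) by simp
    then have "of_int p - of_int q - real j < 0" by linarith
    then have "(real j + 1) * (of_int p - of_int q - real j) \<noteq> 0" by auto
    then show ?thesis using xdU_udX_pow[OF assms(1,2), of j] that by simp
  qed
  \<comment> \<open>The exponent p + 1 brings the degree in x down to -1; for negative p,
    \<open>P\<close> vanishes at once.\<close>
  have "(udX ^^ nat (p + 1)) P = 0 \<or> P = 0"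
    using HH_udX_pow[OF assms(1), of "nat (p + 1)"] bh_negative[of p q P] assms(1)
      bh_negative[of "p - int (nat (p + 1))" _ "(udX ^^ nat (p + 1)) P"]
    unfolding HH_def DH_def by (cases "p < 0") auto
  moreover have "(udX ^^ n) P = 0 \<Longrightarrow> P = 0" for n
    by (induction n) (use step in auto)
  ultimately show ?thesis by blast
qed

context dim_gt_4
begin

lemma S_HH:
  fixes P :: "'n dpoly"
  assumes "HH p q P"
  shows "SU P = udX P" "SX P = xdU P"
  using assms SU_explicit(2)[of p q P] SX_explicit(2)[of p q P] by (simp_all add: HH_def)

lemma SU_pow_HH:
  fixes P :: "'n dpoly"
  assumes "HH p q P"
  shows "(SU ^^ j) P = (udX ^^ j) P"
proof (induction j)
  case (Suc j)
  then show ?case using S_HH(1)[OF HH_udX_pow[OF assms, of j]] by simp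
qed simp

lemma CC_pow_DH:
  fixes P :: "'n dpoly"
  assumes "DH p q P"
  shows "DH (p + int i) (q + int i) ((CC ^^ i) P)"
proof (induction i)
  case (Suc i)
  then show ?case using CC_explicit(3)[OF Suc] by (simp add: algebra_simps)
qed (simp add: assms)

lemma CC_pow_linear:
  fixes P :: "'n dpoly"
  assumes "dh P"
  shows "dh ((CC ^^ i) P)" "(CC ^^ i) (cst c * P) = cst c * (CC ^^ i) P" "(CC ^^ i) (r *\<^sub>R P) = r *\<^sub>R (CC ^^ i) P"
    "dh Q \<Longrightarrow> (CC ^^ i) (P + Q) = (CC ^^ i) P + (CC ^^ i) Q" "(CC ^^ i) (0 :: 'n dpoly) = 0"
proof -
  have dh: "dh ((CC ^^ i) P)" if "dh P" for P :: "'n dpoly" and i by (induction i) (use that dh_S in auto)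
  show "dh ((CC ^^ i) P)" using dh assms .
  show "(CC ^^ i) (cst c * P) = cst c * (CC ^^ i) P" "(CC ^^ i) (r *\<^sub>R P) = r *\<^sub>R (CC ^^ i) P"
    by (induction i) (use dh[OF assms] S_cst S_scaleR in auto)
  show "dh Q \<Longrightarrow> (CC ^^ i) (P + Q) = (CC ^^ i) P + (CC ^^ i) Q"
    by (induction i) (use dh assms S_add in auto)
  show "(CC ^^ i) (0 :: 'n dpoly) = 0" by (induction i) (auto simp: S_0)
qed

text \<open>By \<open>SU_CC\<close> the factors are (x + 2s) / (x + 2s + 2) for s = 0, ..., i - 1,
  and their product telescopes. Here m > 4 gives x = 2p - 4 + m > 0, so that the fraction is 1 at i
  = 0.\<close>

lemma SU_CC_pow:
  fixes Q :: "'n dpoly"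
  assumes "DH p q Q" "p \<ge> 0"
  defines "x \<equiv> cf p - 2"
  shows "SU ((CC ^^ i) Q) = (x / (x + 2 * real i)) *\<^sub>R (CC ^^ i) (SU Q)"
proof (induction i)
  case 0
  have "real_of_int p \<ge> 0" using assms by simp
  then have "x > 0" using dim by (simp add: x_def cf_def)
  then show ?case by simp
next
  case (Suc i)
  have "real_of_int p \<ge> 0" using assms by simp
  then have x: "x > 0" using dim by (simp add: x_def cf_def)
  have c: "cf (p + int i) = x + 2 * real i + 2" by (simp add: cf_def x_def)
  have "SU ((CC ^^ Suc i) Q) = (1 - 2 / cf (p + int i)) *\<^sub>R CC (SU ((CC ^^ i) Q))"
    using SU_CC[OF CC_pow_DH[OF assms(1), of i]] by simp
  also have "CC (SU ((CC ^^ i) Q)) = (x / (x + 2 * real i)) *\<^sub>R (CC ^^ Suc i) (SU Q)"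
    unfolding Suc using S_scaleR(3) CC_pow_linear(1) SU_explicit(3)[OF assms(1)] by (simp add: DH_def)
  also have "(1 - 2 / cf (p + int i)) *\<^sub>R (x / (x + 2 * real i)) *\<^sub>R (CC ^^ Suc i) (SU Q)
     = (x / (x + 2 * real (Suc i))) *\<^sub>R (CC ^^ Suc i) (SU Q)"
  proof -
    have "(1 - 2 / (z + 2)) * (x / z) = x / (z + 2)" if "z > 0" for z :: real
      using that by (simp add: diff_divide_eq_iff)
    from this[of "x + 2 * real i"] show ?thesis unfolding c scaleR_scaleR using x by (simp add: add_ac)
  qed
  finally show ?case .
qed

lemma SX_CC_pow:
  fixes Q :: "'n dpoly"
  assumes "DH p q Q" "q \<ge> 0"
  defines "x \<equiv> cf q - 2"
  shows "SX ((CC ^^ i) Q) = (x / (x + 2 * real i)) *\<^sub>R (CC ^^ i) (SX Q)"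
proof (induction i)
  case 0
  have "real_of_int q \<ge> 0" using assms by simp
  then have "x > 0" using dim by (simp add: x_def cf_def)
  then show ?case by simp
next
  case (Suc i)
  have "real_of_int q \<ge> 0" using assms by simp
  then have x: "x > 0" using dim by (simp add: x_def cf_def)
  have c: "cf (q + int i) = x + 2 * real i + 2" by (simp add: cf_def x_def)
  have "SX ((CC ^^ Suc i) Q) = (1 - 2 / cf (q + int i)) *\<^sub>R CC (SX ((CC ^^ i) Q))"
    using SX_CC[OF CC_pow_DH[OF assms(1), of i]] by simp
  also have "CC (SX ((CC ^^ i) Q)) = (x / (x + 2 * real i)) *\<^sub>R (CC ^^ Suc i) (SX Q)"
    unfolding Suc using S_scaleR(3) CC_pow_linear(1) SX_explicit(3)[OF assms(1)] by (simp add: DH_def)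
  also have "(1 - 2 / cf (q + int i)) *\<^sub>R (x / (x + 2 * real i)) *\<^sub>R (CC ^^ Suc i) (SX Q)
     = (x / (x + 2 * real (Suc i))) *\<^sub>R (CC ^^ Suc i) (SX Q)"
  proof -
    have "(1 - 2 / (z + 2)) * (x / z) = x / (z + 2)" if "z > 0" for z :: real
      using that by (simp add: diff_divide_eq_iff)
    from this[of "x + 2 * real i"] show ?thesis unfolding c scaleR_scaleR using x by (simp add: add_ac)
  qed
  finally show ?case .
qed

end

text \<open>The eigenvalue of $AC$ on $C^iS_u^jH$ is $N(i+1)/((x+2i+2)(y+2i+2))$; this is the recursion for it, after
  clearing denominators.\<close>

lemma lam_polynomial:
  fixes k l j i m :: real
  defines "x \<equiv> 2 * (k - j) - 4 + m" and "y \<equiv> 2 * (l + j) - 4 + m"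
  defines "N \<equiv> \<lambda>i. i * (2 * k + m + 2 * i - 2) * (2 * l + m + 2 * i - 4) * (k + l + m - 3 + i)"
  shows "N (i + 1) * ((x + 2 * i) * (y + 2 * i))
    = (k + l + 2 * i + m) * ((x + 2 * i) * (y + 2 * i) * ((x + 2 * i + 2) * (y + 2 * i + 2)))
      + ((x + 2 * i + 2) * (y + 2 * i + 2) - 4) * N i
      - 2 * (x * (y + 2) * (y + 2 * i) * ((j + 1) * (k - l - j)))
      - 2 * (y * (x + 2) * (x + 2 * i) * (j * (k - l - j + 1)))"
  unfolding x_def y_def N_def by algebra

lemma lam_recursion:
  fixes k l j i m :: real
  defines "x \<equiv> 2 * (k - j) - 4 + m" and "y \<equiv> 2 * (l + j) - 4 + m"
  defines "N \<equiv> \<lambda>i. i * (2 * k + m + 2 * i - 2) * (2 * l + m + 2 * i - 4) * (k + l + m - 3 + i)"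
  assumes "x + 2 * i \<noteq> 0" "y + 2 * i \<noteq> 0" "x + 2 * i + 2 \<noteq> 0" "y + 2 * i + 2 \<noteq> 0"
  shows "N (i + 1) / ((x + 2 * i + 2) * (y + 2 * i + 2))
    = (k + l + 2 * i + m) + (1 - 4 / ((x + 2 * i + 2) * (y + 2 * i + 2))) * (N i / ((x + 2 * i) * (y + 2 * i)))
      - (2 / (x + 2 * i + 2)) * (x / (x + 2 * i) * ((y + 2) / (y + 2 * i + 2)) * ((j + 1) * (k - l - j)))
      - (2 / (y + 2 * i + 2)) * (y / (y + 2 * i) * ((x + 2) / (x + 2 * i + 2)) * (j * (k - l - j + 1)))"
proof -
  define X Y where "X = x + 2 * i" and "Y = y + 2 * i"
  have nz: "X \<noteq> 0" "Y \<noteq> 0" "X + 2 \<noteq> 0" "Y + 2 \<noteq> 0" using assms by (simp_all add: X_def Y_def)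
  have "N (i + 1) * (X * Y) = (k + l + 2 * i + m) * (X * Y * ((X + 2) * (Y + 2)))
      + ((X + 2) * (Y + 2) - 4) * N i
      - 2 * (x * (y + 2) * Y * ((j + 1) * (k - l - j)))
      - 2 * (y * (x + 2) * X * (j * (k - l - j + 1)))"
    using lam_polynomial[of i k m l j] unfolding X_def Y_def x_def y_def N_def by simp
  then have "N (i + 1) = ((k + l + 2 * i + m) * (X * Y * ((X + 2) * (Y + 2)))
      + ((X + 2) * (Y + 2) - 4) * N i
      - 2 * (x * (y + 2) * Y * ((j + 1) * (k - l - j)))
      - 2 * (y * (x + 2) * X * (j * (k - l - j + 1)))) / (X * Y)"
    using nz by (simp add: eq_divide_eq)
  moreover have "\<dots> / ((X + 2) * (Y + 2)) = (k + l + 2 * i + m) + (1 - 4 / ((X + 2) * (Y + 2))) * (N i / (X * Y))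
      - (2 / (X + 2)) * (x / X * ((y + 2) / (Y + 2)) * ((j + 1) * (k - l - j)))
      - (2 / (Y + 2)) * (y / Y * ((x + 2) / (X + 2)) * (j * (k - l - j + 1)))"
  proof -
    have W: "1 - 4 / ((X + 2) * (Y + 2)) = ((X + 2) * (Y + 2) - 4) / ((X + 2) * (Y + 2))"
      using nz by (simp add: diff_divide_distrib)
    \<comment> \<open>The numerators are abstracted to variables, so that only the cancellation of
      denominators remains.\<close>
    have "((a * (X * Y * ((X + 2) * (Y + 2))) + g * b - 2 * (c * Y * e) - 2 * (d * X * f)) / (X * Y)) / ((X + 2) * (Y + 2))
      = a + (g / ((X + 2) * (Y + 2))) * (b / (X * Y)) - (2 / (X + 2)) * (c / (X * (Y + 2)) * e) - (2 / (Y + 2)) * (d / (Y * (X + 2)) * f)" for a b c d e f g :: real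
      using nz by (simp add: add_divide_distrib diff_divide_distrib mult_ac)
    from this[of "k + l + 2 * i + m" "(X + 2) * (Y + 2) - 4" "N i" "x * (y + 2)" "(j + 1) * (k - l - j)" "y * (x + 2)" "j * (k - l - j + 1)"]
    show ?thesis unfolding W by simp
  qed
  ultimately show ?thesis unfolding X_def Y_def by simp
qed

context dim_gt_4
begin

text \<open>The factor by which A takes C^i S_u^j H to C^(i-1) S_u^j H: in the notation of
  \<open>lam_polynomial\<close> it is N(i) / ((x + 2i)(y + 2i)). The numerator does not depend on
  j.\<close>

definition lam :: "nat \<Rightarrow> nat \<Rightarrow> nat \<Rightarrow> nat \<Rightarrow> real" where
  "lam k l i j = real i * (2 * real k + real CARD('n) + 2 * real i - 2) * (2 * real l + real CARD('n) + 2 * real i - 4)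
      * (real k + real l + real CARD('n) - 3 + real i)
    / ((2 * (real k - real j) - 4 + real CARD('n) + 2 * real i) * (2 * (real l + real j) - 4 + real CARD('n) + 2 * real i))"

lemma lam_0: "lam k l 0 j = 0"
  by (simp add: lam_def)

lemma lam_Suc_nonzero: "j \<le> k \<Longrightarrow> lam k l (Suc i) j \<noteq> 0"
proof -
  assume "j \<le> k"
  then have "real j \<le> real k" by simp
  then show ?thesis using dim unfolding lam_def
    by (simp add: add_pos_nonneg add_nonneg_pos)
qed

context
  fixes k l :: nat and H :: "'n dpoly"
  assumes H: "SHH k l H" and lk: "l \<le> k"
begin

lemma V0: "V 0 j H = (udX ^^ j) H" and HH_V0: "HH (int k - int j) (int l + int j) (V 0 j H)"
  using H SU_pow_HH[of k l H j] HH_udX_pow[of k l H j] by (simp_all add: V_def SHH_def)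

lemma V_CC: "V i j H = (CC ^^ i) (V 0 j H)"
  by (simp add: V_def)

lemma V_Suc: "V (Suc i) j H = CC (V i j H)"
  by (simp add: V_def)

lemma DH_V: "DH (int k - int j + int i) (int l + int j + int i) (V i j H)"
  unfolding V_CC[of i j] by (intro CC_pow_DH) (use HH_V0[of j] in \<open>simp add: HH_def\<close>)

lemma dh_V: "dh (V i j H)"
  using DH_V by (simp add: DH_def)

lemma SU_V0: "SU (V 0 j H) = V 0 (Suc j) H"
  by (simp add: V_def)

lemma xdU_V0: "xdU (V 0 (Suc j) H) = ((real j + 1) * (real k - real l - real j)) *\<^sub>R V 0 j H"
  using xdU_udX_pow[of k l H j] H unfolding V0 by (simp add: SHH_def)

lemma SX_V0: "SX (V 0 j H) = xdU (V 0 j H)"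
  by (rule S_HH(2)[OF HH_V0])

text \<open>At i = 0 the vector has weight (l - 1, k + 1), and \<open>xdU\<close> kills it because
  the factor k - l - j in \<open>xdU_V0\<close> is zero at j = k - l; \<open>HH_lowest\<close> then
  forces it to vanish.\<close>

lemma V_top: "V i (Suc (k - l)) H = 0"
proof -
  have "HH (int l - 1) (int k + 1) (V 0 (Suc (k - l)) H)"
  proof -
    have "int k - int (Suc (k - l)) = int l - 1" "int l + int (Suc (k - l)) = int k + 1" using lk by simp_all
    then show ?thesis using HH_V0[of "Suc (k - l)"] by (simp only:)
  qed
  moreover have "udX (xdU (V 0 (Suc (k - l)) H)) = 0"
    unfolding xdU_V0 of_nat_diff[OF lk] by simp
  moreover have "int l - 1 < int k + 1" using lk by simp
  ultimately have "V 0 (Suc (k - l)) H = 0" by (rule HH_lowest)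
  then show ?thesis unfolding V_CC[of i "Suc (k - l)"] using CC_pow_linear(5)[OF dh_linear(1)] by (simp only:)
qed

lemma SU_V:
  assumes "j \<le> k"
  defines "x \<equiv> 2 * (real k - real j) - 4 + real CARD('n)"
  shows "SU (V i j H) = (x / (x + 2 * real i)) *\<^sub>R V i (Suc j) H"
proof -
  have "DH (int k - int j) (int l + int j) (V 0 j H)" using DH_V[of j 0] by simp
  from SU_CC_pow[OF this, of i] show ?thesis
    using assms(1) unfolding V_CC[of i j, symmetric] SU_V0 V_CC[of i "Suc j", symmetric] by (simp add: cf_def x_def algebra_simps)
qed

text \<open>For j = 0 the truncated index j - 1 does no harm: the factor \<open>real j\<close>
  vanishes, in accordance with \<open>xdU H = 0\<close>.\<close>

lemma SX_V:
  fixes j :: nat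
  defines "y \<equiv> 2 * (real l + real j) - 4 + real CARD('n)"
  shows "SX (V i j H) = (y / (y + 2 * real i)) *\<^sub>R (real j * (real k - real l - real j + 1)) *\<^sub>R V i (j - 1) H"
proof -
  have "SX (V 0 j H) = (real j * (real k - real l - real j + 1)) *\<^sub>R V 0 (j - 1) H"
  proof (cases j)
    case 0
    then show ?thesis unfolding SX_V0 using H by (simp add: V0 SHH_def)
  next
    case (Suc j')
    then show ?thesis unfolding SX_V0 by (simp add: xdU_V0 algebra_simps)
  qed
  moreover have "DH (int k - int j) (int l + int j) (V 0 j H)" using DH_V[of j 0] by simp
  from SX_CC_pow[OF this, of i] have "SX (V i j H) = (y / (y + 2 * real i)) *\<^sub>R (CC ^^ i) (SX (V 0 j H))"
    unfolding V_CC[of i j, symmetric] by (simp add: cf_def y_def algebra_simps)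
  ultimately show ?thesis
    using CC_pow_linear(3)[OF dh_V[of 0 "j - 1"]] unfolding V_CC[of i "j - 1"] by simp
qed

text \<open>\<open>dUX_CC\<close> is solved for A C P with P = C^i S_u^j H. By \<open>SU_V\<close>,
  \<open>SX_V\<close> and the induction hypothesis, S_x S_u P, S_u S_x P and C A P are all multiples
  of P, so a scalar recursion remains, which \<open>lam_recursion\<close> settles.\<close>

lemma dUX_V:
  assumes j: "j \<le> k - l"
  shows "dUX (V i j H) = lam k l i j *\<^sub>R V (i - 1) j H"
proof (induction i)
  case 0
  then show ?case using HH_V0[of j] by (simp add: lam_0 HH_def)
next
  case (Suc i)
  define x y where "x = 2 * (real k - real j) - 4 + real CARD('n)" and "y = 2 * (real l + real j) - 4 + real CARD('n)"
  have jk: "j \<le> k" and "real j \<le> real k - real l" using j lk by (simp_all add: of_nat_diff le_diff_conv2)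
  then have xy: "x > 0" "y > 0" using dim by (simp_all add: x_def y_def)
  let ?P = "V i j H"
  have cx: "cf (int k - int j + int i) = x + 2 * real i + 2" and cy: "cf (int l + int j + int i) = y + 2 * real i + 2"
    by (simp_all add: cf_def x_def y_def)
  \<comment> \<open>At i = 0 the index i - 1 is truncated, but both sides vanish since
    \<open>lam k l 0 j = 0\<close>.\<close>
  have A: "CC (dUX ?P) = lam k l i j *\<^sub>R ?P"
    unfolding Suc S_scaleR(3)[OF dh_V] by (cases i) (simp_all add: lam_0 V_Suc)
  have "SX (V i (Suc j) H) = ((y + 2) / (y + 2 * real i + 2)) *\<^sub>R ((real j + 1) * (real k - real l - real j)) *\<^sub>R ?P"
    using SX_V[of i "Suc j"] by (simp add: y_def algebra_simps)
  then have B: "SX (SU ?P) = (x / (x + 2 * real i) * ((y + 2) / (y + 2 * real i + 2)) * ((real j + 1) * (real k - real l - real j))) *\<^sub>R ?P"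
    unfolding SU_V[OF jk] S_scaleR(2)[OF dh_V] by (simp add: x_def)
  have C: "SU (SX ?P) = (y / (y + 2 * real i) * ((x + 2) / (x + 2 * real i + 2)) * (real j * (real k - real l - real j + 1))) *\<^sub>R ?P"
  proof (cases j)
    case 0
    then show ?thesis unfolding SX_V by (simp add: S_0)
  next
    case (Suc j')
    have "SU (V i j' H) = ((x + 2) / (x + 2 * real i + 2)) *\<^sub>R ?P"
      using SU_V[of j' i] jk Suc by (simp add: x_def algebra_simps)
    then show ?thesis using Suc
      unfolding SX_V scaleR_scaleR S_scaleR(1)[OF dh_V] by (simp add: y_def)
  qed
  have "dUX (V (Suc i) j H) = CC (dUX ?P) + (of_int (int k - int j + int i + (int l + int j + int i)) + real CARD('n)) *\<^sub>R ?P
      - (2 / (x + 2 * real i + 2)) *\<^sub>R SX (SU ?P) - (2 / (y + 2 * real i + 2)) *\<^sub>R SU (SX ?P)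
      - (4 / ((x + 2 * real i + 2) * (y + 2 * real i + 2))) *\<^sub>R CC (dUX ?P)"
    using dUX_CC[OF DH_V[of j i]] unfolding cx cy V_Suc by (simp add: algebra_simps)
  also have "\<dots> = (lam k l i j + (real k + real l + 2 * real i + real CARD('n))
      - (2 / (x + 2 * real i + 2)) * (x / (x + 2 * real i) * ((y + 2) / (y + 2 * real i + 2)) * ((real j + 1) * (real k - real l - real j)))
      - (2 / (y + 2 * real i + 2)) * (y / (y + 2 * real i) * ((x + 2) / (x + 2 * real i + 2)) * (real j * (real k - real l - real j + 1)))
      - (4 / ((x + 2 * real i + 2) * (y + 2 * real i + 2))) * lam k l i j) *\<^sub>R ?P"
    unfolding A B C scaleR_scaleR scaleR_add_left scaleR_diff_left by (simp add: scaleR_add_left)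
  also have "\<dots> = lam k l (Suc i) j *\<^sub>R ?P"
  proof -
    have nz: "x + 2 * real i \<noteq> 0" "y + 2 * real i \<noteq> 0" "x + 2 * real i + 2 \<noteq> 0" "y + 2 * real i + 2 \<noteq> 0"
      using xy by (simp_all add: add_pos_nonneg less_imp_neq[symmetric])
    have l: "lam k l (Suc i) j = real (Suc i) * (2 * real k + real CARD('n) + 2 * real (Suc i) - 2) * (2 * real l + real CARD('n) + 2 * real (Suc i) - 4)
      * (real k + real l + real CARD('n) - 3 + real (Suc i)) / ((x + 2 * real i + 2) * (y + 2 * real i + 2))"
      by (simp add: lam_def x_def y_def algebra_simps)
    have l': "lam k l i j = real i * (2 * real k + real CARD('n) + 2 * real i - 2) * (2 * real l + real CARD('n) + 2 * real i - 4)
      * (real k + real l + real CARD('n) - 3 + real i) / ((x + 2 * real i) * (y + 2 * real i))"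
      by (simp add: lam_def x_def y_def)
    have "lam k l (Suc i) j = (real k + real l + 2 * real i + real CARD('n))
      + (1 - 4 / ((x + 2 * real i + 2) * (y + 2 * real i + 2))) * lam k l i j
      - (2 / (x + 2 * real i + 2)) * (x / (x + 2 * real i) * ((y + 2) / (y + 2 * real i + 2)) * ((real j + 1) * (real k - real l - real j)))
      - (2 / (y + 2 * real i + 2)) * (y / (y + 2 * real i) * ((x + 2) / (x + 2 * real i + 2)) * (real j * (real k - real l - real j + 1)))"
      using lam_recursion[of "real k" "real j" "real CARD('n)" "real i" "real l", folded x_def y_def, OF nz]
      unfolding l l' by (simp add: add.commute)
    \<comment> \<open>This collects the two occurrences of the previous eigenvalue z: one from C A P
      and one from the correction of C A P with coefficient w.\<close>
    moreover have "L = A + (1 - w) * z - B - C \<Longrightarrow> z + A - B - C - w * z = L" for L A w z B C :: real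
      by (simp add: algebra_simps)
    ultimately show ?thesis by presburger
  qed
  finally show ?case by simp
qed

end

end

section \<open>The decomposition\<close>

text \<open>Scalar multiples are absorbed in \<open>H\<close>. The bidegree is a parameter, so that
  the inductions on the degree in u can take place inside one weight space.\<close>

inductive spanV :: "int \<Rightarrow> int \<Rightarrow> 'n::finite dpoly \<Rightarrow> bool" where
  spanV_0: "spanV p q 0"
| spanV_V: "SHH k l H \<Longrightarrow> l \<le> k \<Longrightarrow> j \<le> k - l \<Longrightarrow> p = int k - int j + int i \<Longrightarrow> q = int l + int j + int i \<Longrightarrow> spanV p q (V i j H)"
| spanV_add: "spanV p q P \<Longrightarrow> spanV p q Q \<Longrightarrow> spanV p q (P + Q)"

text \<open>The part with i = 0; \<open>spanK_HH\<close> and \<open>HH_spanK\<close> identify it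
  with the kernel of A.\<close>

inductive spanK :: "int \<Rightarrow> int \<Rightarrow> 'n::finite dpoly \<Rightarrow> bool" where
  spanK_0: "spanK p q 0"
| spanK_V: "SHH k l H \<Longrightarrow> l \<le> k \<Longrightarrow> j \<le> k - l \<Longrightarrow> p = int k - int j \<Longrightarrow> q = int l + int j \<Longrightarrow> spanK p q (V 0 j H)"
| spanK_add: "spanK p q P \<Longrightarrow> spanK p q Q \<Longrightarrow> spanK p q (P + Q)"

lemma spanK_imp_spanV: "spanK p q P \<Longrightarrow> spanV p q P"
  by (induction rule: spanK.induct) (auto intro: spanV.intros spanV_V[where i = 0])

lemma SHH_dh: "SHH k l H \<Longrightarrow> dh H"
  by (simp add: SHH_def HH_def DH_def)

context dim_gt_4
begin

lemma V_linear:
  fixes P :: "'n dpoly"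
  assumes "dh P"
  shows "V i j (cst c * P) = cst c * V i j P" "V i j (r *\<^sub>R P) = r *\<^sub>R V i j P"
    "dh Q \<Longrightarrow> V i j (P + Q) = V i j P + V i j Q" "V i j (0 :: 'n dpoly) = 0"
proof -
  have dh: "dh ((SU ^^ j) P)" if "dh P" for P :: "'n dpoly" and j by (induction j) (use that dh_S in auto)
  have "(SU ^^ j) (cst c * P) = cst c * (SU ^^ j) P" "(SU ^^ j) (r *\<^sub>R P) = r *\<^sub>R (SU ^^ j) P" "(SU ^^ j) (0 :: 'n dpoly) = 0"
    by (induction j) (use dh[OF assms] S_cst S_scaleR S_0 in auto)
  then show "V i j (cst c * P) = cst c * V i j P" "V i j (r *\<^sub>R P) = r *\<^sub>R V i j P" "V i j (0 :: 'n dpoly) = 0"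
    using CC_pow_linear[OF dh[OF assms]] CC_pow_linear(5)[OF assms] by (simp_all add: V_def)
  assume Q: "dh Q"
  have "(SU ^^ j) (P + Q) = (SU ^^ j) P + (SU ^^ j) Q"
    by (induction j) (use dh assms Q S_add in auto)
  then show "V i j (P + Q) = V i j P + V i j Q"
    using CC_pow_linear(4)[OF dh[OF assms] dh[OF Q]] by (simp add: V_def)
qed

lemma spanK_HH: "spanK p q (P :: 'n dpoly) \<Longrightarrow> HH p q P"
  by (induction rule: spanK.induct) (auto intro: HH_linear HH_V0)

lemma spanV_DH: "spanV p q (P :: 'n dpoly) \<Longrightarrow> DH p q P"
  by (induction rule: spanV.induct) (auto intro: DH_linear DH_V)

text \<open>$G$ collects the lowest weight vectors $S_u^{k-l}H$, which are not in the image of $\langle x,\partial_u\rangle$.\<close>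

lemma spanK_split:
  assumes "spanK p q (R :: 'n dpoly)"
  shows "\<exists>S G. spanK (p - 1) (q + 1) S \<and> R = xdU S + G \<and> udX G = 0 \<and> (q < p \<longrightarrow> G = 0)"
  using assms
proof (induction rule: spanK.induct)
  case (spanK_0 p q)
  then show ?case by (intro exI[of _ 0]) (simp add: spanK.spanK_0)
next
  case (spanK_V k l H j p q)
  show ?case
  proof (cases "j = k - l")
    case False
    \<comment> \<open>The factor by which \<open>xdU\<close> takes S_u^(j+1) H to S_u^j H. It is
      nonzero below the top index, and its inverse is absorbed in \<open>H\<close>.\<close>
    define c where "c = (real j + 1) * (real k - real l - real j)"
    have "j < k - l" using False spanK_V by simp
    then have "real j < real k - real l" by linarith
    then have c: "c \<noteq> 0" unfolding c_def by auto
    have "spanK (p - 1) (q + 1) (V 0 (Suc j) ((1 / c) *\<^sub>R H))"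
      using spanK_V \<open>j < k - l\<close> by (intro spanK.spanK_V[of k l]) (auto intro: SHH_linear)
    moreover have "xdU (V 0 (Suc j) ((1 / c) *\<^sub>R H)) = V 0 j H"
      using xdU_V0[OF spanK_V(1,2), of j] c by (simp add: V_linear SHH_dh[OF spanK_V(1)] c_def)
    ultimately show ?thesis by (intro exI[of _ "V 0 (Suc j) ((1 / c) *\<^sub>R H)"] exI[of _ 0]) simp
  next
    case True
    have "udX (V 0 j H) = V 0 (Suc j) H"
      using SU_V0[OF spanK_V(1,2)] S_HH(1)[OF HH_V0[OF spanK_V(1,2)]] by metis
    then have "udX (V 0 j H) = 0" using V_top[OF spanK_V(1,2)] True by simp
    moreover have "\<not> q < p" using spanK_V True by simp
    ultimately show ?thesis by (intro exI[of _ 0] exI[of _ "V 0 j H"]) (simp add: spanK.spanK_0)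
  qed
next
  case (spanK_add p q P Q)
  then obtain S G S' G' where "spanK (p - 1) (q + 1) S" "P = xdU S + G" "udX G = 0" "q < p \<longrightarrow> G = 0"
    "spanK (p - 1) (q + 1) S'" "Q = xdU S' + G'" "udX G' = 0" "q < p \<longrightarrow> G' = 0" by blast
  then show ?case by (intro exI[of _ "S + S'"] exI[of _ "G + G'"]) (auto intro: spanK.spanK_add)
qed

text \<open>Induction on the degree q in u. Since \<open>xdU P\<close> has lower degree,
  \<open>spanK_split\<close> writes it as \<open>xdU S + G\<close>, and R = P - S satisfies
  \<open>xdU R = G\<close> with \<open>udX G = 0\<close>. If p < q, then R = 0 by
  \<open>HH_lowest\<close>; otherwise G = 0 and R is itself a simplicial harmonic.\<close>

lemma HH_spanK:
  fixes P :: "'n dpoly"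
  shows "HH p (int n) P \<Longrightarrow> spanK p (int n) P"
proof (induction n arbitrary: p P)
  case 0
  have "xdU P = 0"
    using HH_xdU[OF 0] bh_negative[of "p + 1" "-1" "xdU P"] by (simp add: HH_def DH_def)
  show ?case
  proof (cases "p < 0")
    case True
    then have "P = 0" using 0 bh_negative[of p 0 P] by (simp add: HH_def DH_def)
    then show ?thesis by (simp add: spanK_0)
  next
    case False
    then have "spanK p (int 0) (V 0 0 P)" using 0 \<open>xdU P = 0\<close>
      by (intro spanK_V[of "nat p" 0]) (auto simp: SHH_def)
    then show ?thesis by (simp add: V_def)
  qed
next
  case (Suc n)
  have "HH (p + 1) (int n) (xdU P)" using HH_xdU[OF Suc.prems] by simp
  then have "spanK (p + 1) (int n) (xdU P)" by (rule Suc.IH)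
  from spanK_split[OF this] obtain S G where S: "spanK p (int (Suc n)) S" "xdU P = xdU S + G" "udX G = 0" "int n < p + 1 \<longrightarrow> G = 0"
    by (auto simp: add.commute)
  define R where "R = P - S"
  have R: "HH p (int (Suc n)) R" using Suc.prems spanK_HH[OF S(1)] by (simp add: R_def HH_linear)
  have xR: "xdU R = G" using S(2) by (simp add: R_def)
  have "spanK p (int (Suc n)) R"
  proof (cases "p < int (Suc n)")
    case True
    then have "R = 0" using HH_lowest[OF R] xR S(3) by simp
    then show ?thesis by (simp add: spanK_0)
  next
    case False
    then have "SHH (nat p) (Suc n) R" using R xR S(4) by (simp add: SHH_def)
    then have "spanK p (int (Suc n)) (V 0 0 R)" using False by (intro spanK_V[of "nat p" "Suc n"]) auto
    then show ?thesis by (simp add: V_def)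
  qed
  then have "spanK p (int (Suc n)) (R + S)" using S(1) by (rule spanK_add)
  then show ?case by (simp add: R_def)
qed

text \<open>A reaches C^i S_u^j H from C^(i+1) S_u^j H with a nonzero factor, which is divided out
  of \<open>H\<close>.\<close>

lemma spanV_lift:
  assumes "spanV p q (R :: 'n dpoly)"
  shows "\<exists>S. spanV (p + 1) (q + 1) S \<and> dUX S = R"
  using assms
proof (induction rule: spanV.induct)
  case (spanV_V k l H j p i q)
  have jk: "j \<le> k" using spanV_V by simp
  let ?c = "1 / lam k l (Suc i) j"
  have "dUX (V (Suc i) j (?c *\<^sub>R H)) = V i j H"
    using dUX_V[OF spanV_V(1-3), of "Suc i"] lam_Suc_nonzero[OF jk] by (simp add: V_linear SHH_dh[OF spanV_V(1)])
  moreover have "spanV (p + 1) (q + 1) (V (Suc i) j (?c *\<^sub>R H))"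
    using spanV_V by (intro spanV.spanV_V[of k l]) (auto intro: SHH_linear)
  ultimately show ?case by blast
next
  case (spanV_add p q P Q)
  then obtain S S' where "spanV (p + 1) (q + 1) S" "dUX S = P" "spanV (p + 1) (q + 1) S'" "dUX S' = Q" by blast
  then show ?case by (intro exI[of _ "S + S'"]) (auto intro: spanV.spanV_add)
qed (auto intro: exI[of _ 0] spanV.spanV_0)

lemma DH_spanV:
  fixes P :: "'n dpoly"
  shows "DH p (int n) P \<Longrightarrow> spanV p (int n) P"
proof (induction n arbitrary: p P)
  case 0
  have "dUX P = 0"
    using DH_dUX[OF 0] bh_negative[of "p - 1" "-1" "dUX P"] by (simp add: DH_def)
  then show ?case using 0 HH_spanK[of p 0 P] spanK_imp_spanV by (simp add: HH_def)
next
  case (Suc n)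
  have "spanV (p - 1) (int n) (dUX P)" using DH_dUX[OF Suc.prems] by (intro Suc.IH) simp
  from spanV_lift[OF this] obtain S where S: "spanV p (int (Suc n)) S" "dUX S = dUX P"
    by (auto simp: add.commute)
  have "HH p (int (Suc n)) (P - S)"
    using Suc.prems spanV_DH[OF S(1)] S(2) by (simp add: HH_def DH_linear)
  then have "spanV p (int (Suc n)) (P - S)" by (intro spanK_imp_spanV HH_spanK)
  then have "spanV p (int (Suc n)) ((P - S) + S)" using S(1) by (rule spanV_add)
  then show ?case by simp
qed

section \<open>Families of simplicial harmonics: existence and uniqueness\<close>

definition family :: "(nat \<times> nat \<times> nat \<times> nat \<Rightarrow> 'n dpoly) \<Rightarrow> bool" where
  "family F \<longleftrightarrow> finite {t. F t \<noteq> 0} \<and> (\<forall>t. F t \<noteq> 0 \<longrightarrow> valid_idx t) \<and> (\<forall>k l i j. SHH k l (F (k,l,i,j)))"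

definition total :: "(nat \<times> nat \<times> nat \<times> nat \<Rightarrow> 'n dpoly) \<Rightarrow> 'n dpoly" where
  "total F = (\<Sum>t\<in>{t. F t \<noteq> 0}. case t of (k,l,i,j) \<Rightarrow> V i j (F t))"

lemma total_superset:
  assumes "finite T" "{t. F t \<noteq> 0} \<subseteq> T"
  shows "total F = (\<Sum>t\<in>T. case t of (k,l,i,j) \<Rightarrow> V i j (F t))"
  unfolding total_def using assms V_linear(4)[OF dh_linear(1)] by (intro sum.mono_neutral_left) auto

lemma family_dh: "family F \<Longrightarrow> dh (F t)"
  unfolding family_def using SHH_dh by (cases t) blast

lemma family_add:
  assumes "family F" "family G"
  shows "family (\<lambda>t. F t + G t)" "total (\<lambda>t. F t + G t) = total F + total G"
proof -
  have sub: "{t. F t + G t \<noteq> 0} \<subseteq> {t. F t \<noteq> 0} \<union> {t. G t \<noteq> 0}" by auto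
  have fin: "finite ({t. F t \<noteq> 0} \<union> {t. G t \<noteq> 0})" using assms by (simp add: family_def)
  show "family (\<lambda>t. F t + G t)"
    using finite_subset[OF sub fin] assms sub unfolding family_def by (auto intro: SHH_linear)
  have "total (\<lambda>t. F t + G t) = (\<Sum>t\<in>{t. F t \<noteq> 0} \<union> {t. G t \<noteq> 0}. (case t of (k,l,i,j) \<Rightarrow> V i j (F t)) + (case t of (k,l,i,j) \<Rightarrow> V i j (G t)))"
    unfolding total_superset[OF fin sub]
    using V_linear(3)[OF family_dh[OF assms(1)] family_dh[OF assms(2)]] by (intro sum.cong) (auto split: prod.split)
  also have "\<dots> = total F + total G"
    unfolding sum.distrib using fin by (subst (1 2) total_superset[symmetric]) auto
  finally show "total (\<lambda>t. F t + G t) = total F + total G" .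
qed

lemma family_diff:
  assumes "family F" "family G"
  shows "family (\<lambda>t. F t - G t)" "total (\<lambda>t. F t - G t) = total F - total G"
proof -
  have sub: "{t. F t - G t \<noteq> 0} \<subseteq> {t. F t \<noteq> 0} \<union> {t. G t \<noteq> 0}" by auto
  have fin: "finite ({t. F t \<noteq> 0} \<union> {t. G t \<noteq> 0})" using assms by (simp add: family_def)
  show f: "family (\<lambda>t. F t - G t)"
    using finite_subset[OF sub fin] assms sub unfolding family_def by (auto intro: SHH_linear)
  show "total (\<lambda>t. F t - G t) = total F - total G"
    using family_add(2)[OF f assms(2)] by (simp add: eq_diff_eq)
qed

lemma spanV_family: "spanV p q (P :: 'n dpoly) \<Longrightarrow> \<exists>F. family F \<and> P = total F"
proof (induction rule: spanV.induct)
  case (spanV_0 p q)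
  show ?case by (intro exI[of _ "\<lambda>t. 0"]) (auto simp: family_def total_def intro: SHH_linear)
next
  case (spanV_V k l H j p i q)
  define F where "F t = (if t = (k,l,i,j) then H else 0)" for t
  have "family F" using spanV_V unfolding family_def F_def by (auto simp: valid_idx_def intro: SHH_linear)
  moreover have "total F = (\<Sum>t\<in>{(k,l,i,j)}. case t of (k,l,i,j) \<Rightarrow> V i j (F t))"
    by (rule total_superset) (auto simp: F_def)
  then have "V i j H = total F" by (simp add: F_def[of "(k,l,i,j)"])
  ultimately show ?case by blast
next
  case (spanV_add p q P Q)
  then obtain F F' where "family F" "P = total F" "family F'" "Q = total F'" by blast
  then have "family (\<lambda>t. F t + F' t) \<and> P + Q = total (\<lambda>t. F t + F' t)" by (simp add: family_add)
  then show ?case by blast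
qed

lemma family_exists:
  assumes "dh (P :: 'n dpoly)"
  shows "\<exists>F. family F \<and> P = total F"
proof -
  obtain D G where D: "finite D" "P = (\<Sum>d\<in>D. G d)"
    "\<And>d. d \<in> D \<Longrightarrow> fst d \<ge> 0 \<and> snd d \<ge> 0 \<and> bh (fst d) (snd d) (G d) \<and> dh (G d)"
    by (rule dh_decomp[OF assms]) (rule that)
  have f: "\<exists>F. family F \<and> G d = total F" if "d \<in> D" for d
  proof -
    have "DH (fst d) (int (nat (snd d))) (G d)" using D(3)[OF that] by (simp add: DH_def)
    then show ?thesis by (rule spanV_family[OF DH_spanV])
  qed
  have "\<exists>F. family F \<and> (\<Sum>d\<in>D'. G d) = total F" if "finite D'" "D' \<subseteq> D" for D'
    using that
  proof (induction rule: finite_induct)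
    case empty
    show ?case using spanV_family[OF spanV_0] by simp
  next
    case (insert d D')
    then obtain F F' where "family F" "G d = total F" "family F'" "(\<Sum>d\<in>D'. G d) = total F'"
      using f[of d] by (meson insert_subset)
    then show ?case using insert.hyps family_add[of F F'] by auto
  qed
  then show ?thesis using D by blast
qed

lemma dUX_pow_V:
  assumes "SHH k l (H :: 'n dpoly)" "l \<le> k" "j \<le> k - l"
  shows "\<exists>c. c \<noteq> 0 \<and> (dUX ^^ i) (V i j H) = c *\<^sub>R V 0 j H"
proof (induction i)
  case 0
  show ?case by (intro exI[of _ 1]) simp
next
  case (Suc i)
  then obtain c where c: "c \<noteq> 0" "(dUX ^^ i) (V i j H) = c *\<^sub>R V 0 j H" by blast
  have lin: "(dUX ^^ n) (r *\<^sub>R P) = r *\<^sub>R (dUX ^^ n) P" for n r and P :: "'n dpoly" by (induction n) simp_all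
  have "(dUX ^^ Suc i) (V (Suc i) j H) = (lam k l (Suc i) j * c) *\<^sub>R V 0 j H"
    using dUX_V[OF assms, of "Suc i"] c(2) by (simp only: funpow_Suc_right o_apply diff_Suc_1 lin scaleR_scaleR)
  moreover have "lam k l (Suc i) j * c \<noteq> 0" using lam_Suc_nonzero[of j k] assms c by simp
  ultimately show ?case by blast
qed

text \<open>Each step down contributes a factor (j + 1)(k - l - j), which is nonzero as long as the
  index stays within k - l.\<close>

lemma xdU_pow_V:
  assumes "SHH k l (H :: 'n dpoly)" "l \<le> k" "j \<le> k - l"
  shows "\<exists>c. c \<noteq> 0 \<and> (xdU ^^ j) (V 0 j H) = c *\<^sub>R H"
  using assms(3)
proof (induction j)
  case 0
  show ?case by (intro exI[of _ 1]) (simp add: V_def)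
next
  case (Suc j)
  then obtain c where c: "c \<noteq> 0" "(xdU ^^ j) (V 0 j H) = c *\<^sub>R H" by auto
  have lin: "(xdU ^^ n) (r *\<^sub>R P) = r *\<^sub>R (xdU ^^ n) P" for n r and P :: "'n dpoly" by (induction n) simp_all
  define e where "e = (real j + 1) * (real k - real l - real j)"
  have "real j < real k - real l" using Suc.prems by linarith
  then have e: "e \<noteq> 0" unfolding e_def by auto
  have "(xdU ^^ Suc j) (V 0 (Suc j) H) = (e * c) *\<^sub>R H"
    using xdU_V0[OF assms(1,2), of j] c(2) unfolding e_def by (simp only: funpow_Suc_right o_apply lin scaleR_scaleR)
  then show ?case using c e by (intro exI[of _ "e * c"]) simp
qed

lemma funpow_kills:
  assumes "(f ^^ i) P = c *\<^sub>R Q" "f Q = 0" "\<And>r P. f (r *\<^sub>R P) = r *\<^sub>R f P" "i < n"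
  shows "(f ^^ n) (P :: 'n dpoly) = 0"
proof -
  have z: "(f ^^ m) 0 = 0" for m using assms(3)[of 0 0] by (induction m) simp_all
  have "(f ^^ n) P = (f ^^ (n - Suc i)) (f ((f ^^ i) P))"
    using assms(4) by (simp flip: funpow_Suc_right funpow_add comp_apply[of f] comp_apply[of "f ^^ (n - Suc i)"] funpow.simps(2))
  then show ?thesis using assms z by simp
qed

lemma family_unique_0:
  assumes F: "family F" and 0: "total F = 0"
  shows "F = (\<lambda>t. 0)"
proof (rule ccontr)
  assume "F \<noteq> (\<lambda>t. 0)"
  define T where "T = {t. F t \<noteq> 0}"
  have T: "finite T" "T \<noteq> {}" using F \<open>F \<noteq> (\<lambda>t. 0)\<close> by (auto simp: T_def family_def)
  define fi where "fi t = (case t of (k,l,i,j) \<Rightarrow> i)" for t :: "nat \<times> nat \<times> nat \<times> nat"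
  define fj where "fj t = (case t of (k,l,i,j) \<Rightarrow> j)" for t :: "nat \<times> nat \<times> nat \<times> nat"
  define fkl where "fkl t = (case t of (k,l,i,j) \<Rightarrow> (int k, int l))" for t :: "nat \<times> nat \<times> nat \<times> nat"
  define n where "n = Max (fi ` T)"
  define T1 where "T1 = {t\<in>T. fi t = n}"
  have "n \<in> fi ` T" unfolding n_def using T by (intro Max_in) auto
  then have T1: "finite T1" "T1 \<noteq> {}" using T by (auto simp: T1_def)
  define m where "m = Max (fj ` T1)"
  define T2 where "T2 = {t\<in>T1. fj t = m}"
  have "m \<in> fj ` T1" unfolding m_def using T1 by (intro Max_in) auto
  then have T2: "finite T2" "T2 \<noteq> {}" using T1 by (auto simp: T2_def)
  have le_n: "fi t \<le> n" if "t \<in> T" for t using that T by (auto simp: n_def)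
  have le_m: "fj t \<le> m" if "t \<in> T1" for t using that T1 by (auto simp: m_def)
  \<comment> \<open>The unprojected operators are linear on all polynomials. On the terms at hand
    they agree with A and S_x, because after \<open>dUX ^^ n\<close> only vectors in the kernel of A
    are left.\<close>
  define W where "W P = (xdU ^^ m) ((dUX ^^ n) P)" for P :: "'n dpoly"
  have pw: "(xdU ^^ m) (P + Q) = (xdU ^^ m) P + (xdU ^^ m) Q" "(dUX ^^ m) (P + Q) = (dUX ^^ m) P + (dUX ^^ m) Q"
    "(xdU ^^ m) (r *\<^sub>R P) = r *\<^sub>R (xdU ^^ m) P" "(dUX ^^ m) (r *\<^sub>R P) = r *\<^sub>R (dUX ^^ m) P" for m r and P Q :: "'n dpoly"
    by (induction m) simp_all
  have W0: "W 0 = 0" using pw(3)[of m 0 0] pw(4)[of n 0 0] by (simp add: W_def)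
  have Wsum: "W (sum f S) = (\<Sum>s\<in>S. W (f s))" for f and S :: "(nat \<times> nat \<times> nat \<times> nat) set"
    by (induction S rule: infinite_finite_induct) (use W0 in \<open>auto simp: W_def pw\<close>)
  define v where "v t = (case t of (k,l,i,j) \<Rightarrow> V i j (F t))" for t
  have main: "(t \<in> T2 \<longrightarrow> (\<exists>c. c \<noteq> 0 \<and> W (v t) = c *\<^sub>R F t)) \<and> (t \<notin> T2 \<longrightarrow> W (v t) = 0)" if t: "t \<in> T" for t
  proof -
    obtain k l i j where tt: "t = (k,l,i,j)" by (cases t)
    have H: "SHH k l (F t)" "l \<le> k" "j \<le> k - l" using F t unfolding family_def tt T_def valid_idx_def by auto
    obtain c where c: "c \<noteq> 0" "(dUX ^^ i) (V i j (F t)) = c *\<^sub>R V 0 j (F t)" using dUX_pow_V[OF H] by blast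
    obtain d where d: "d \<noteq> 0" "(xdU ^^ j) (V 0 j (F t)) = d *\<^sub>R F t" using xdU_pow_V[OF H] by blast
    have v: "v t = V i j (F t)" by (simp add: v_def tt)
    consider "i < n" | "i = n" "j < m" | "i = n" "j = m"
      using le_n[OF t] le_m[of t] t by (force simp: T1_def tt fi_def fj_def)
    then show ?thesis
    proof cases
      case 1
      have "(dUX ^^ n) (V i j (F t)) = 0"
        using HH_V0[OF H(1,2), of j] by (intro funpow_kills[OF c(2) _ _ 1]) (simp_all add: HH_def)
      then have "W (v t) = 0" using pw(3)[of m 0 0] by (simp add: W_def v)
      moreover have "t \<notin> T2" using 1 by (simp add: T2_def T1_def tt fi_def)
      ultimately show ?thesis by simp
    next
      case 2
      have "(xdU ^^ m) (V 0 j (F t)) = 0"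
        using H(1) by (intro funpow_kills[OF d(2) _ _ 2(2)]) (simp_all add: SHH_def)
      then have "W (v t) = 0" using c(2) 2 by (simp add: W_def v pw)
      moreover have "t \<notin> T2" using 2 by (simp add: T2_def tt fj_def)
      ultimately show ?thesis by simp
    next
      case 3
      then have "W (v t) = (c * d) *\<^sub>R F t" using c(2) d(2) by (simp add: W_def v pw)
      moreover have "t \<in> T2" using 3 t by (simp add: T2_def T1_def tt fi_def fj_def)
      ultimately show ?thesis using c(1) d(1) by (intro conjI impI exI[of _ "c * d"]) auto
    qed
  qed
  have "0 = W (\<Sum>t\<in>T. v t)" using 0 W0 by (simp add: total_def T_def v_def)
  also have "\<dots> = (\<Sum>t\<in>T2. W (v t))"
    unfolding Wsum using main T by (intro sum.mono_neutral_right) (auto simp: T2_def T1_def)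
  finally have s: "(\<Sum>t\<in>T2. W (v t)) = 0" by simp
  have "\<forall>t\<in>T2. W (v t) = 0"
  proof (rule bh_independent[where w = fkl, OF T2(1) _ _ s])
    \<comment> \<open>On \<open>T2\<close> the indices i and j are constant, so a tuple is
      determined by (k,l).\<close>
    show "inj_on fkl T2" by (auto simp: inj_on_def T2_def T1_def fkl_def fi_def fj_def)
    fix t assume t: "t \<in> T2"
    then obtain c where c: "W (v t) = c *\<^sub>R F t" using main[of t] by (auto simp: T2_def T1_def)
    obtain k l i j where tt: "t = (k,l,i,j)" by (cases t)
    have "SHH k l (F t)" using F unfolding family_def tt by blast
    then show "bh (fst (fkl t)) (snd (fkl t)) (W (v t))"
      unfolding c by (intro bh_linear) (simp add: fkl_def tt SHH_def HH_def DH_def)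
  qed
  moreover obtain t where "t \<in> T2" using T2 by blast
  moreover obtain c where "c \<noteq> 0" "W (v t) = c *\<^sub>R F t" using main[of t] \<open>t \<in> T2\<close> by (auto simp: T2_def T1_def)
  ultimately have "F t = 0" by simp
  with \<open>t \<in> T2\<close> show False by (simp add: T2_def T1_def T_def)
qed

lemma family_unique:
  assumes "family F" "family G" "total F = total G"
  shows "F = G"
  using family_unique_0[OF family_diff(1)[OF assms(1,2)]] family_diff(2)[OF assms(1,2)] assms(3)
  by (simp add: fun_eq_iff)

end

section \<open>Transfer to polynomial functions\<close>

lemma zf_eval: "zf = eval 0"
  by (simp add: zf_def fun_eq_iff)

lemma eval_eq_iff [simp]: "eval P = eval Q \<longleftrightarrow> P = Q"
  by (rule eval_inject)

lemma is_poly_eval: "is_poly (eval P)"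
  using eval by blast

lemma is_poly_iff: "is_poly f \<longleftrightarrow> (\<exists>P. f = eval P)"
  using Abs_dpoly_inverse is_poly_eval by (metis mem_Collect_eq)

lemma ops_eval:
  "lap_x (eval P) = eval (lapX P)" "lap_u (eval P) = eval (lapU P)" "dudx (eval P) = eval (dUX P)"
  "xdu (eval P) = eval (xdU P)" "udx (eval P) = eval (udX P)"
  "Ex (eval P) = eval (eulX P)" "Eu (eval P) = eval (eulU P)" "mult_ux (eval P) = eval (ip * P)"
  by (simp_all add: fun_eq_iff lap_x_def lap_u_def dudx_def xdu_def udx_def Ex_def Eu_def mult_ux_def op_defs ip_def
      flip: dX.rep_eq dU.rep_eq)

lemma eval_nx: "eval nx x u = complex_of_real (\<Sum>j\<in>UNIV. (x $ j)^2)" "eval nu x u = complex_of_real (\<Sum>j\<in>UNIV. (u $ j)^2)"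
  by (simp_all add: nx_def nu_def power2_eq_square)

lemma dharm_eval: "dharm (eval P) \<longleftrightarrow> dh P"
  by (simp add: dharm_def dh_def is_poly_eval ops_eval zf_eval)

lemma dharm_iff: "dharm f \<longleftrightarrow> (\<exists>P. f = eval P \<and> dh P)"
  using dharm_eval by (metis dharm_def is_poly_iff)

lemma SH_iff: "f \<in> SH k l \<longleftrightarrow> (\<exists>P. f = eval P \<and> SHH k l P)"
proof
  assume "f \<in> SH k l"
  then obtain P where P: "f = eval P" "bh (int k) (int l) P" unfolding SH_def bihom_iff by blast
  with \<open>f \<in> SH k l\<close> have "SHH k l P"
    by (simp add: SH_def SHH_def HH_def DH_def dh_def ops_eval zf_eval)
  with P show "\<exists>P. f = eval P \<and> SHH k l P" by blast
qed (auto simp: SH_def bihom_iff SHH_def HH_def DH_def dh_def ops_eval zf_eval)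

lemma pi_s_eval:
  assumes "hpart P H"
  shows "pi_s (eval P) = eval H"
  unfolding pi_s_def
proof (rule the_equality)
  obtain F Hf where e: "expands P F Hf" "H = Hf (0,0)" using assms unfolding hpart_def by blast
  \<comment> \<open>\<open>pi_s\<close> asks for (0,0) in the index set, so it is added; the
    coefficient there may be zero.\<close>
  have "expands P (insert (0,0) F) Hf" using e by (intro expands_superset[OF e(1)]) (auto simp: expands_def)
  then show "\<exists>F Hf. finite F \<and> (0, 0) \<in> F \<and> (\<forall>ab\<in>F. dharm (Hf ab)) \<and> eval H = Hf (0, 0) \<and>
       eval P = (\<lambda>x u. \<Sum>(a, b)\<in>F. complex_of_real ((\<Sum>j\<in>UNIV. (x $ j)\<^sup>2) ^ a * (\<Sum>j\<in>UNIV. (u $ j)\<^sup>2) ^ b) * Hf (a, b) x u)"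
    using e(2) unfolding expands_def
    by (intro exI[of _ "insert (0,0) F"] exI[of _ "\<lambda>t. eval (Hf t)"])
      (auto simp: dharm_eval fun_eq_iff split_def eval_nx)
next
  fix h
  assume "\<exists>F Hf. finite F \<and> (0, 0) \<in> F \<and> (\<forall>ab\<in>F. dharm (Hf ab)) \<and> h = Hf (0, 0) \<and>
       eval P = (\<lambda>x u. \<Sum>(a, b)\<in>F. complex_of_real ((\<Sum>j\<in>UNIV. (x $ j)\<^sup>2) ^ a * (\<Sum>j\<in>UNIV. (u $ j)\<^sup>2) ^ b) * Hf (a, b) x u)"
  then obtain F Hf where F: "finite F" "(0, 0) \<in> F" "\<forall>ab\<in>F. dharm (Hf ab)" "h = Hf (0, 0)"
    "eval P = (\<lambda>x u. \<Sum>(a, b)\<in>F. complex_of_real ((\<Sum>j\<in>UNIV. (x $ j)\<^sup>2) ^ a * (\<Sum>j\<in>UNIV. (u $ j)\<^sup>2) ^ b) * Hf (a, b) x u)"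
    by blast
  from F(3) obtain g where g: "\<And>t. t \<in> F \<Longrightarrow> Hf t = eval (g t) \<and> dh (g t)" unfolding dharm_iff by metis
  \<comment> \<open>\<open>pi_s\<close> leaves the coefficients outside \<open>F\<close> arbitrary,
    whereas \<open>expands\<close> wants them to be zero.\<close>
  define g' where "g' t = (if t \<in> F then g t else 0)" for t
  have "P = (\<Sum>(a,b)\<in>F. nx ^ a * nu ^ b * g' (a,b))"
    by (rule dpoly_eqI) (use F(5) g in \<open>auto simp: g'_def eval_nx split_def intro!: sum.cong\<close>)
  then have "expands P F g'" using F(1) g by (auto simp: expands_def g'_def dh_linear)
  then have "hpart P (g' (0,0))" unfolding hpart_def by blast
  then have "H = g' (0,0)" using hpart_unique assms by blast
  then show "h = eval H" using F(2,4) g by (simp add: g'_def)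
qed

section \<open>Rotations and equivariance of the operators\<close>

lift_definition rot :: "real^'n^'n \<Rightarrow> 'n::finite dpoly \<Rightarrow> 'n dpoly" is "\<lambda>M P x u. P (M *v x) (M *v u)"
proof -
  fix M :: "real^'n^'n" and f :: "'n pfun"
  assume "is_poly f"
  then show "is_poly (\<lambda>x u. f (M *v x) (M *v u))"
  proof (induction rule: is_poly_induct)
    case (x j)
    have "is_poly (\<lambda>(x::real^'n) (u::real^'n). \<Sum>i\<in>UNIV. complex_of_real (M $ j $ i) * complex_of_real (x $ i))"
      by (intro is_poly_sum is_poly_mult is_poly_const is_poly_x)
    then show ?case by (simp add: matrix_vector_mult_def)
  next
    case (u j)
    have "is_poly (\<lambda>(x::real^'n) (u::real^'n). \<Sum>i\<in>UNIV. complex_of_real (M $ j $ i) * complex_of_real (u $ i))"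
      by (intro is_poly_sum is_poly_mult is_poly_const is_poly_u)
    then show ?case by (simp add: matrix_vector_mult_def)
  qed (auto intro: is_poly_const is_poly_add is_poly_mult)
qed

lemma act_eval: "act g (eval P) = eval (rot (matrix_inv g) P)"
  by (simp add: act_def rot.rep_eq)

lemma rot_simps [simp]:
  "rot M (P + Q) = rot M P + rot M Q" "rot M (P * Q) = rot M P * rot M Q" "rot M (cst c) = cst c"
  "rot M (r *\<^sub>R P) = r *\<^sub>R rot M P" "rot M 0 = 0" "rot M 1 = 1"
  "rot M (cX j) = (\<Sum>i\<in>UNIV. (M $ j $ i) *\<^sub>R cX i)" "rot M (cU j) = (\<Sum>i\<in>UNIV. (M $ j $ i) *\<^sub>R cU i)"
  by (rule dpoly_eqI, simp add: rot.rep_eq matrix_vector_mult_def)+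

lemma rot_more [simp]: "rot M (sum f S) = (\<Sum>s\<in>S. rot M (f s))" "rot M (P ^ n) = rot M P ^ n"
  by (rule dpoly_eqI, simp add: rot.rep_eq)+

text \<open>The chain rule for a linear substitution; for polynomials it follows from the generators
  by the Leibniz rule.\<close>

lemma d_rot:
  "dX i (rot M P) = (\<Sum>j\<in>UNIV. (M $ j $ i) *\<^sub>R rot M (dX j P))"
  "dU i (rot M P) = (\<Sum>j\<in>UNIV. (M $ j $ i) *\<^sub>R rot M (dU j P))"
proof -
  have d: "(\<Sum>s\<in>UNIV. c s *\<^sub>R (if s = i then 1 else 0 :: 'a dpoly)) = c i *\<^sub>R 1"
    "(\<Sum>s\<in>UNIV. c s *\<^sub>R rot M (if i = s then 1 else 0)) = c i *\<^sub>R 1" for c :: "'a \<Rightarrow> real" and i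
    by (simp_all add: if_distrib[of "\<lambda>z. c _ *\<^sub>R z"] if_distrib[of "rot M"] cong: if_cong)
  show "dX i (rot M P) = (\<Sum>j\<in>UNIV. (M $ j $ i) *\<^sub>R rot M (dX j P))"
    by (induction P rule: dpoly_induct)
      (simp_all add: d sum.distrib sum_distrib_left sum_distrib_right scaleR_add_right)
  show "dU i (rot M P) = (\<Sum>j\<in>UNIV. (M $ j $ i) *\<^sub>R rot M (dU j P))"
    by (induction P rule: dpoly_induct)
      (simp_all add: d sum.distrib sum_distrib_left sum_distrib_right scaleR_add_right)
qed

text \<open>Coordinates and derivatives transform in dual ways, so contracting one with the other is
  invariant under every linear substitution. Orthogonality enters when two derivatives or two
  coordinates are contracted.\<close>

lemma vfield_rot:
  "xdU (rot M P) = rot M (xdU P)" "udX (rot M P) = rot M (udX P)"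
  "eulX (rot M P) = rot M (eulX P)" "eulU (rot M P) = rot M (eulU P)"
proof -
  have "(\<Sum>i\<in>UNIV. c i * (\<Sum>j\<in>UNIV. (M $ j $ i) *\<^sub>R f j)) = (\<Sum>j\<in>UNIV. (\<Sum>i\<in>UNIV. (M $ j $ i) *\<^sub>R c i) * f j)"
    for c f :: "'a \<Rightarrow> 'a dpoly"
    unfolding sum_distrib_left sum_distrib_right by (subst sum.swap) simp
  then show "xdU (rot M P) = rot M (xdU P)" "udX (rot M P) = rot M (udX P)"
    "eulX (rot M P) = rot M (eulX P)" "eulU (rot M P) = rot M (eulU P)"
    by (simp_all add: op_defs d_rot)
qed

lemma orthogonal_rows:
  fixes M :: "real^'n^'n"
  assumes "orthogonal_matrix M"
  shows "(\<Sum>i\<in>UNIV. M $ j $ i * M $ k $ i) = (if j = k then 1 else 0)"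
proof -
  have "(M ** transpose M) $ j $ k = (mat 1 :: real^'n^'n) $ j $ k"
    using assms by (simp add: orthogonal_matrix_def)
  then show ?thesis by (simp add: matrix_matrix_mult_def transpose_def mat_def)
qed

lemma second_order_rot:
  assumes "orthogonal_matrix M"
  shows "lapX (rot M P) = rot M (lapX P)" "lapU (rot M P) = rot M (lapU P)" "dUX (rot M P) = rot M (dUX P)"
proof -
  have "(\<Sum>i\<in>UNIV. \<Sum>j\<in>UNIV. (M $ j $ i) *\<^sub>R (\<Sum>k\<in>UNIV. (M $ k $ i) *\<^sub>R f k j)) = (\<Sum>j\<in>UNIV. f j j)"
    for f :: "'a \<Rightarrow> 'a \<Rightarrow> 'a dpoly"
  proof -
    have "(\<Sum>i\<in>UNIV. \<Sum>j\<in>UNIV. (M $ j $ i) *\<^sub>R (\<Sum>k\<in>UNIV. (M $ k $ i) *\<^sub>R f k j))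
      = (\<Sum>j\<in>UNIV. \<Sum>k\<in>UNIV. \<Sum>i\<in>UNIV. (M $ j $ i * M $ k $ i) *\<^sub>R f k j)"
      \<comment> \<open>Moving the sum over i to the inside makes the orthogonality of the rows of
        \<open>M\<close> applicable.\<close>
      unfolding scaleR_sum_right scaleR_scaleR by (subst sum.swap, rule sum.cong[OF refl], rule sum.swap)
    also have "\<dots> = (\<Sum>j\<in>UNIV. \<Sum>k\<in>UNIV. (if j = k then f k j else 0))"
      unfolding scaleR_sum_left[symmetric] orthogonal_rows[OF assms] by (intro sum.cong refl) simp
    also have "\<dots> = (\<Sum>j\<in>UNIV. f j j)" by simp
    finally show ?thesis .
  qed
  then show "lapX (rot M P) = rot M (lapX P)" "lapU (rot M P) = rot M (lapU P)" "dUX (rot M P) = rot M (dUX P)"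
    by (simp_all add: op_defs d_rot)
qed

lemma quad_rot:
  fixes M :: "real^'n::finite^'n"
  assumes "orthogonal_matrix M"
  shows "rot M nx = nx" "rot M nu = nu" "rot M ip = ip"
proof -
  have "(M *v x) \<bullet> (M *v y) = x \<bullet> y" for x y
    using assms orthogonal_transformation_matrix[of "(*v) M"] by (simp add: orthogonal_transformation_def)
  then have "(\<Sum>j\<in>UNIV. (M *v x) $ j * (M *v y) $ j) = (\<Sum>j\<in>UNIV. x $ j * y $ j)" for x y
    by (simp add: inner_vec_def)
  then have *: "(\<Sum>j\<in>UNIV. complex_of_real ((M *v x) $ j) * complex_of_real ((M *v y) $ j)) = (\<Sum>j\<in>UNIV. complex_of_real (x $ j) * complex_of_real (y $ j))" for x y
    by (simp flip: of_real_mult of_real_sum)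
  show "rot M nx = nx" "rot M nu = nu" "rot M ip = ip"
    by (rule dpoly_eqI, simp add: rot.rep_eq nx_def nu_def ip_def * del: rot_simps rot_more)+
qed

lemma dh_rot: "orthogonal_matrix M \<Longrightarrow> dh P \<Longrightarrow> dh (rot M P)"
  by (simp add: dh_def second_order_rot)

lemma SHH_rot: "orthogonal_matrix M \<Longrightarrow> SHH k l P \<Longrightarrow> SHH k l (rot M P)"
  by (simp add: SHH_def HH_def DH_def dh_rot bh_def second_order_rot vfield_rot)

lemma hpart_rot:
  assumes "orthogonal_matrix M" "hpart P H"
  shows "hpart (rot M P) (rot M H)"
proof -
  obtain F Hf where e: "expands P F Hf" "H = Hf (0,0)" using assms unfolding hpart_def by blast
  then have "expands (rot M P) F (\<lambda>t. rot M (Hf t))"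
    using assms(1) by (auto simp: expands_def dh_rot split_def quad_rot)
  with e show ?thesis unfolding hpart_def by blast
qed

context dim_gt_4
begin

lemma SCA_eval:
  fixes P :: "'n dpoly"
  assumes "dh P"
  shows "Sx (eval P) = eval (SX P)" "Su (eval P) = eval (SU P)" "Cop (eval P) = eval (CC P)" "Aop (eval P) = eval (AA P)"
  using hpart_ops[OF assms] hpart_dUX[OF assms]
  by (simp_all add: Sx_def Su_def Cop_def Aop_def ops_eval pi_s_eval AA_eq[OF assms])

lemma dh_pow:
  fixes P :: "'n dpoly"
  assumes "dh P"
  shows "dh ((SU ^^ j) P)" "dh (V i j P)"
proof -
  show *: "dh ((SU ^^ j) P)" by (induction j) (use assms dh_S in auto)
  show "dh (V i j P)" unfolding V_def by (rule CC_pow_linear(1)[OF *])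
qed

lemma CS_eval:
  fixes P :: "'n dpoly"
  assumes "dh P"
  shows "CS i j (eval P) = eval (V i j P)"
proof -
  have "(Su ^^ j) (eval P) = eval ((SU ^^ j) P)"
    by (induction j) (use dh_pow(1)[OF assms] SCA_eval in auto)
  moreover have "(Cop ^^ i) (eval Q) = eval ((CC ^^ i) Q)" if "dh Q" for Q :: "'n dpoly"
    by (induction i) (use CC_pow_linear(1)[OF that] SCA_eval in auto)
  ultimately show ?thesis using dh_pow(1)[OF assms] by (simp add: CS_def V_def)
qed

lemma S_rot:
  fixes P :: "'n dpoly"
  assumes M: "orthogonal_matrix M" and P: "dh P"
  shows "SU (rot M P) = rot M (SU P)" "CC (rot M P) = rot M (CC P)"
  using hpart_rot[OF M hpart_ops(1)[OF P]] hpart_rot[OF M hpart_ops(3)[OF P]]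
  by (simp_all add: SU_def[of "rot M P"] CC_def[of "rot M P"] vfield_rot quad_rot[OF M] pis_eq)

lemma V_rot:
  fixes P :: "'n dpoly"
  assumes M: "orthogonal_matrix M" and P: "dh P"
  shows "V i j (rot M P) = rot M (V i j P)"
proof -
  have "(SU ^^ j) (rot M P) = rot M ((SU ^^ j) P)"
    by (induction j) (use dh_pow(1)[OF P] S_rot[OF M] in auto)
  moreover have "(CC ^^ i) (rot M Q) = rot M ((CC ^^ i) Q)" if "dh Q" for Q :: "'n dpoly"
    by (induction i) (use CC_pow_linear(1)[OF that] S_rot[OF M] in auto)
  ultimately show ?thesis using dh_pow(1)[OF P] by (simp add: V_def)
qed

lemma rep_eval:
  assumes "family F"
  shows "rep (\<lambda>t. eval (F t)) = eval (total F)"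
proof -
  have "(\<Sum>t\<in>{t. F t \<noteq> 0}. (case t of (k,l,i,j) \<Rightarrow> CS i j (eval (F t)) x u))
      = (\<Sum>t\<in>{t. F t \<noteq> 0}. eval (case t of (k,l,i,j) \<Rightarrow> V i j (F t)) x u)" for x u
    using CS_eval[OF family_dh[OF assms]] by (intro sum.cong) (auto split: prod.split)
  moreover have "{t. eval (F t) \<noteq> zf} = {t. F t \<noteq> 0}" by (simp add: zf_eval)
  ultimately show ?thesis unfolding rep_def total_def by (intro ext) (simp only: eval_more)
qed

text \<open>An element of V[k,l] tensor H_{k,l} amounts to a finite family of simplicial harmonics
  indexed by the basis vectors C^i S_u^j. Uniqueness of the family therefore expresses both
  injectivity of each map and directness of the sum.\<close>

lemma decomposition:
  assumes "dharm (P :: 'n pfun)"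
  shows "\<exists>!F. finite {t. F t \<noteq> zf} \<and> (\<forall>t. F t \<noteq> zf \<longrightarrow> valid_idx t)
             \<and> (\<forall>k l i j. F (k,l,i,j) \<in> SH k l) \<and> P = rep F"
proof -
  obtain P' where P': "P = eval P'" "dh P'" using assms unfolding dharm_iff by blast
  obtain F where F: "family F" "P' = total F" using family_exists[OF P'(2)] by blast
  show ?thesis
  proof (rule ex1I[of _ "\<lambda>t. eval (F t)"])
    show "finite {t. eval (F t) \<noteq> zf} \<and> (\<forall>t. eval (F t) \<noteq> zf \<longrightarrow> valid_idx t)
             \<and> (\<forall>k l i j. eval (F (k,l,i,j)) \<in> SH k l) \<and> P = rep (\<lambda>t. eval (F t))"
      using F(1) unfolding rep_eval[OF F(1)] P'(1) F(2)
      by (auto simp: family_def zf_eval SH_iff)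
    fix G assume G: "finite {t. G t \<noteq> zf} \<and> (\<forall>t. G t \<noteq> zf \<longrightarrow> valid_idx t)
             \<and> (\<forall>k l i j. G (k,l,i,j) \<in> SH k l) \<and> P = rep G"
    have "\<forall>t. \<exists>Q. G t = eval Q \<and> SHH (fst t) (fst (snd t)) Q"
    proof
      fix t :: "nat \<times> nat \<times> nat \<times> nat"
      obtain k l i j where t: "t = (k,l,i,j)" by (cases t)
      have "G (k,l,i,j) \<in> SH k l" using G by blast
      then show "\<exists>Q. G t = eval Q \<and> SHH (fst t) (fst (snd t)) Q" by (simp add: SH_iff t)
    qed
    then obtain G' where G': "\<And>t. G t = eval (G' t)" "\<And>t. SHH (fst t) (fst (snd t)) (G' t)" by metis
    then have GG: "G = (\<lambda>t. eval (G' t))" by (simp add: fun_eq_iff)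
    have fam: "family G'" using G G'(2) unfolding GG family_def zf_eval eval_eq_iff by fastforce
    have "total F = total G'" using G rep_eval[OF fam] P' F(2) unfolding GG by simp
    then show "G = (\<lambda>t. eval (F t))" using family_unique[OF F(1) fam] GG by simp
  qed
qed

section \<open>Intertwining with the generators of the transvector algebra\<close>

definition lc :: "(nat \<times> nat \<Rightarrow> complex) \<Rightarrow> 'n dpoly \<Rightarrow> 'n dpoly" where
  "lc c H = (\<Sum>t\<in>{t. c t \<noteq> 0}. cst (c t) * V (fst t) (snd t) H)"

lemma lincomb_eval: "dh H \<Longrightarrow> lincomb c (eval H) = eval (lc c H)"
  by (simp add: lincomb_def lc_def fun_eq_iff split_def CS_eval)

text \<open>\<open>X\<close> sends each C^i S_u^j H to a multiple of a single such vector, with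
  target index and factor chosen before \<open>H\<close>. Hence one coefficient family
  \<open>d\<close> describes the image of the combination \<open>c\<close> for all \<open>H\<close>
  at once, which is the intertwining property.\<close>

lemma intertwining:
  fixes X :: "'n dpoly \<Rightarrow> 'n dpoly" and c :: "nat \<times> nat \<Rightarrow> complex"
  assumes add: "\<And>P Q. dh P \<Longrightarrow> dh Q \<Longrightarrow> X (P + Q) = X P + X Q"
    and cst: "\<And>a P. dh P \<Longrightarrow> X (cst a * P) = cst a * X P"
    and V: "\<And>i j. j \<le> k - l \<Longrightarrow> \<exists>r i' j'. j' \<le> k - l \<and> (\<forall>H. SHH k l H \<longrightarrow> X (V i j H) = r *\<^sub>R V i' j' H)"
    and c: "finite {t. c t \<noteq> 0}" "\<And>i j. c (i,j) \<noteq> 0 \<Longrightarrow> j \<le> k - l"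
  shows "\<exists>d. finite {t. d t \<noteq> 0} \<and> (\<forall>i j. d (i,j) \<noteq> 0 \<longrightarrow> j \<le> k - l) \<and> (\<forall>H. SHH k l H \<longrightarrow> X (lc c H) = lc d H)"
proof -
  define S where "S = {t. c t \<noteq> 0}"
  have "\<forall>t\<in>S. \<exists>r s. snd s \<le> k - l \<and> (\<forall>H. SHH k l H \<longrightarrow> X (V (fst t) (snd t) H) = r *\<^sub>R V (fst s) (snd s) H)"
    using V c(2) by (fastforce simp: S_def)
  then obtain r s where rs: "\<And>t. t \<in> S \<Longrightarrow> snd (s t) \<le> k - l"
    "\<And>t H. t \<in> S \<Longrightarrow> SHH k l H \<Longrightarrow> X (V (fst t) (snd t) H) = r t *\<^sub>R V (fst (s t)) (snd (s t)) H"
    by metis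
  have S: "finite S" using c(1) by (simp add: S_def)
  \<comment> \<open>Several indices may share a target, so the coefficients are summed over the
    fibres of \<open>s\<close>.\<close>
  define d where "d u = (\<Sum>t\<in>{t\<in>S. s t = u}. c t * complex_of_real (r t))" for u
  have sub: "{u. d u \<noteq> 0} \<subseteq> s ` S"
  proof
    fix u assume "u \<in> {u. d u \<noteq> 0}"
    then have "{t\<in>S. s t = u} \<noteq> {}" unfolding d_def by (metis (mono_tags, lifting) mem_Collect_eq sum.empty)
    then show "u \<in> s ` S" by blast
  qed
  have X0: "X 0 = 0" using cst[OF dh_linear(1), of 0] by (simp add: cst_simps)
  have Xsum: "X (sum f T) = (\<Sum>t\<in>T. X (f t))" if "finite T" "\<And>t. dh (f t)" for f and T :: "(nat \<times> nat) set"
    using that(1) by (induction T rule: finite_induct) (auto simp: X0 add that(2) dh_sum)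
  have "X (lc c H) = lc d H" if H: "SHH k l H" for H
  proof -
    note dV = dh_pow(2)[OF SHH_dh[OF H]]
    have cs: "cst (sum g T) = (\<Sum>t\<in>T. cst (g t))" for g :: "nat \<times> nat \<Rightarrow> complex" and T
      by (induction T rule: infinite_finite_induct) (simp_all add: cst_simps)
    have "X (lc c H) = (\<Sum>t\<in>S. cst (c t) * X (V (fst t) (snd t) H))"
      using S dV unfolding lc_def S_def[symmetric] by (subst Xsum) (auto simp: cst dh_linear)
    also have "\<dots> = (\<Sum>t\<in>S. cst (c t * complex_of_real (r t)) * V (fst (s t)) (snd (s t)) H)"
      using rs(2)[OF _ H] by (intro sum.cong) (simp_all add: scaleR_conv_cst cst_simps mult.assoc)
    also have "\<dots> = (\<Sum>u\<in>s ` S. \<Sum>t\<in>{t\<in>S. s t = u}. cst (c t * complex_of_real (r t)) * V (fst (s t)) (snd (s t)) H)"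
      by (rule sum.image_gen[OF S])
    also have "\<dots> = (\<Sum>u\<in>s ` S. cst (d u) * V (fst u) (snd u) H)"
      unfolding d_def cs sum_distrib_right by (intro sum.cong refl) auto
    also have "\<dots> = lc d H"
      unfolding lc_def using S sub by (intro sum.mono_neutral_right) (auto simp: cst_simps)
    finally show ?thesis .
  qed
  moreover have "finite {u. d u \<noteq> 0}" using sub S finite_subset by blast
  moreover have "j \<le> k - l" if "d (i,j) \<noteq> 0" for i j
  proof -
    have "(i,j) \<in> s ` S" using sub that by blast
    then obtain t where "t \<in> S" "s t = (i,j)" by (metis imageE)
    with rs(1)[of t] show ?thesis by simp
  qed
  ultimately show ?thesis by blast
qed

lemma V_shift:
  assumes lk: "l \<le> k" and j: "j \<le> k - l"
    and X: "X \<in> {SX, SU, AA, CC, eulX, eulU :: 'n dpoly \<Rightarrow> 'n dpoly}"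
  shows "\<exists>r i' j'. j' \<le> k - l \<and> (\<forall>H. SHH k l H \<longrightarrow> X (V i j H) = r *\<^sub>R V i' j' H)"
proof -
  from X consider "X = SX" | "X = SU" "j < k - l" | "X = SU" "j = k - l" | "X = AA" | "X = CC" | "X = eulX" | "X = eulU"
    using j by fastforce
  then show ?thesis
  proof cases
    case 1
    show ?thesis unfolding 1 using SX_V[of k l _ i j] lk j
      by (intro exI[of _ "(2 * (real l + real j) - 4 + real CARD('n)) / (2 * (real l + real j) - 4 + real CARD('n) + 2 * real i) * (real j * (real k - real l - real j + 1))"] exI[of _ i] exI[of _ "j - 1"]) auto
  next
    case 2
    have "j \<le> k" using j by simp
    then show ?thesis unfolding 2 using SU_V[of k l _ j i] lk 2
      by (intro exI[of _ "(2 * (real k - real j) - 4 + real CARD('n)) / (2 * (real k - real j) - 4 + real CARD('n) + 2 * real i)"] exI[of _ i] exI[of _ "Suc j"]) auto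
  next
    \<comment> \<open>The index k - l + 1 would leave the range, but the vector there is zero, so
      the factor 0 with the placeholder index k - l serves.\<close>
    case 3
    have "j \<le> k" using j by simp
    then show ?thesis unfolding 3 using SU_V[of k l _ "k - l" i] V_top[of k l _ i] lk
      by (intro exI[of _ 0] exI[of _ i] exI[of _ "k - l"]) auto
  next
    case 4
    show ?thesis unfolding 4 using dUX_V[of k l _ j i] lk j AA_eq[OF dh_V[of k l _ i j]]
      by (intro exI[of _ "lam k l i j"] exI[of _ "i - 1"] exI[of _ j]) auto
  next
    case 5
    show ?thesis unfolding 5 using j by (intro exI[of _ 1] exI[of _ "Suc i"] exI[of _ j]) (auto simp: V_def)
  next
    case 6
    show ?thesis unfolding 6 using DH_V[of k l _ j i] j lk
      by (intro exI[of _ "of_int (int k - int j + int i)"] exI[of _ i] exI[of _ j]) (auto simp: DH_def bh_def)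
  next
    case 7
    show ?thesis unfolding 7 using DH_V[of k l _ j i] j lk
      by (intro exI[of _ "of_int (int l + int j + int i)"] exI[of _ i] exI[of _ j]) (auto simp: DH_def bh_def)
  qed
qed

lemma intertwining_pfun:
  fixes Y :: "'n pfun \<Rightarrow> 'n pfun"
  assumes Y: "Y \<in> {Sx, Su, Aop, Cop, Ex, Eu}" and lk: "l \<le> k"
    and c: "finite {t. c t \<noteq> 0}" "\<forall>i j. c (i,j) \<noteq> 0 \<longrightarrow> j \<le> k - l"
  shows "\<exists>d. finite {t. d t \<noteq> 0} \<and> (\<forall>i j. d (i,j) \<noteq> 0 \<longrightarrow> j \<le> k - l) \<and> (\<forall>H\<in>SH k l. Y (lincomb c H) = lincomb d H)"
proof -
  have "\<exists>X. X \<in> {SX, SU, AA, CC, eulX, eulU :: 'n dpoly \<Rightarrow> 'n dpoly} \<and> (\<forall>P. dh P \<longrightarrow> Y (eval P) = eval (X P))"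
  proof -
    from Y consider "Y = Sx" | "Y = Su" | "Y = Aop" | "Y = Cop" | "Y = Ex" | "Y = Eu" by blast
    then show ?thesis
    proof cases
      case 1 show ?thesis unfolding 1 using SCA_eval(1) by (intro exI[of _ SX]) simp
    next
      case 2 show ?thesis unfolding 2 using SCA_eval(2) by (intro exI[of _ SU]) simp
    next
      case 3 show ?thesis unfolding 3 using SCA_eval(4) by (intro exI[of _ AA]) simp
    next
      case 4 show ?thesis unfolding 4 using SCA_eval(3) by (intro exI[of _ CC]) simp
    next
      case 5 show ?thesis unfolding 5 by (intro exI[of _ eulX]) (simp add: ops_eval)
    next
      case 6 show ?thesis unfolding 6 by (intro exI[of _ eulU]) (simp add: ops_eval)
    qed
  qed
  then obtain X where X: "X \<in> {SX, SU, AA, CC, eulX, eulU :: 'n dpoly \<Rightarrow> 'n dpoly}" "\<And>P. dh P \<Longrightarrow> Y (eval P) = eval (X P)"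
    by blast
  have add: "X (P + Q) = X P + X Q" if "dh P" "dh Q" for P Q
    using X(1) S_add[OF that] AA_eq[OF that(1)] AA_eq[OF that(2)] AA_eq[OF dh_linear(2)[OF that]] by auto
  have cst: "X (cst a * P) = cst a * X P" if "dh P" for a P
    using X(1) S_cst[OF that] AA_eq[OF that] AA_eq[OF dh_linear(5)[OF that]] by auto
  have cj: "j \<le> k - l" if "c (i,j) \<noteq> 0" for i j using c(2) that by blast
  have "\<exists>d. finite {t. d t \<noteq> 0} \<and> (\<forall>i j. d (i,j) \<noteq> 0 \<longrightarrow> j \<le> k - l) \<and> (\<forall>H. SHH k l H \<longrightarrow> X (lc c H) = lc d H)"
    by (rule intertwining[of X k l c]) (fact add cst V_shift[OF lk _ X(1)] c(1) cj)+
  then obtain d where d: "finite {t. d t \<noteq> 0}" "\<forall>i j. d (i,j) \<noteq> 0 \<longrightarrow> j \<le> k - l" "\<forall>H. SHH k l H \<longrightarrow> X (lc c H) = lc d H"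
    by blast
  have "dh (lc c H)" if "dh H" for H
    unfolding lc_def using dh_pow(2)[OF that] by (intro dh_sum dh_linear)
  then have "Y (lincomb c (eval H)) = lincomb d (eval H)" if "SHH k l H" for H
    using d(3) that X(2) lincomb_eval[OF SHH_dh[OF that]] SHH_dh[OF that] by simp
  then have "\<forall>H\<in>SH k l. Y (lincomb c H) = lincomb d H" unfolding Ball_def SH_iff by blast
  with d(1,2) show ?thesis by blast
qed

end

theorem theorem4p1:
  fixes dummy :: "'n::finite"
  assumes "CARD('n) > 4"
  shows
    \<comment> \<open>the maps land in the double harmonics\<close>
    "(\<forall>k l i j (H'::'n pfun). l \<le> k \<longrightarrow> j \<le> k - l \<longrightarrow> H' \<in> SH k l \<longrightarrow> dharm (CS i j H'))
   \<comment> \<open>injectivity and direct sum decomposition of the whole space\<close>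
   \<and> (\<forall>P::'n pfun. dharm P \<longrightarrow>
        (\<exists>!F. finite {t. F t \<noteq> zf} \<and> (\<forall>t. F t \<noteq> zf \<longrightarrow> valid_idx t)
             \<and> (\<forall>k l i j. F (k,l,i,j) \<in> SH k l) \<and> P = rep F))
   \<comment> \<open>SO(m)-intertwining\<close>
   \<and> (\<forall>g\<in>SOm. \<forall>k l i j (H'::'n pfun). l \<le> k \<longrightarrow> j \<le> k - l \<longrightarrow> H' \<in> SH k l \<longrightarrow>
        act g H' \<in> SH k l \<and> act g (CS i j H') = CS i j (act g H'))
   \<comment> \<open>Z(g,s)-intertwining (generators S_x, S_u, A, C and E_x, E_u)\<close>
   \<and> (\<forall>X\<in>{Sx, Su, Aop, Cop, Ex, Eu::'n pfun \<Rightarrow> 'n pfun}. \<forall>k l (c::nat\<times>nat\<Rightarrow>complex).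
        l \<le> k \<longrightarrow> finite {ij. c ij \<noteq> 0} \<longrightarrow> (\<forall>i j. c (i,j) \<noteq> 0 \<longrightarrow> j \<le> k - l) \<longrightarrow>
        (\<exists>d. finite {ij. d ij \<noteq> 0} \<and> (\<forall>i j. d (i,j) \<noteq> 0 \<longrightarrow> j \<le> k - l) \<and>
             (\<forall>H'\<in>SH k l. X (lincomb c H') = lincomb d H')))"
proof -
  interpret dim_gt_4 "TYPE('n)" by standard (rule assms)
  have "dharm (CS i j H')" if H': "H' \<in> SH k l" for k l i j and H' :: "'n pfun"
  proof -
    obtain Q where Q: "H' = eval Q" "dh Q" using H' SHH_dh unfolding SH_iff by blast
    show ?thesis unfolding Q(1) CS_eval[OF Q(2)] dharm_eval by (rule dh_pow(2)[OF Q(2)])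
  qed
  moreover have "act g H' \<in> SH k l \<and> act g (CS i j H') = CS i j (act g H')"
    if g: "g \<in> SOm" and H': "H' \<in> SH k l" for g k l i j and H' :: "'n pfun"
  proof -
    have g: "orthogonal_matrix g" using g by (simp add: SOm_def)
    \<comment> \<open>\<open>matrix_inv\<close> chooses some two-sided inverse. The transpose shows
      that one exists and must coincide with it, so the inverse is orthogonal.\<close>
    have gt: "g ** transpose g = mat 1" "transpose g ** g = mat 1" using g by (simp_all add: orthogonal_matrix_def)
    then have "g ** matrix_inv g = mat 1 \<and> matrix_inv g ** g = mat 1"
      unfolding matrix_inv_def by (rule someI[where x = "transpose g", OF conjI])
    then have "matrix_inv g ** g = mat 1" ..
    then have "transpose g = matrix_inv g ** (g ** transpose g)"
      unfolding matrix_mul_assoc by (simp only: matrix_mul_lid)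
    also have "\<dots> = matrix_inv g"
      unfolding gt by (rule matrix_mul_rid)
    finally have M: "orthogonal_matrix (matrix_inv g)" using g by (metis orthogonal_matrix_transpose)
    obtain Q where Q: "H' = eval Q" "SHH k l Q" using H' unfolding SH_iff by blast
    note dQ = SHH_dh[OF Q(2)]
    show ?thesis
      unfolding Q(1) act_eval CS_eval[OF dQ] CS_eval[OF dh_rot[OF M dQ]] V_rot[OF M dQ]
      using SHH_rot[OF M Q(2)] unfolding SH_iff by blast
  qed
  ultimately show ?thesis
    by (intro conjI allI ballI impI) (simp_all only: decomposition intertwining_pfun)
qed

end
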